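(* Assume hypothesis $(\tilde{\mathcal H})$ holds, $\sigma^2>0$, and the initial law $\mu_0$ defines a continuous linear form $f\mapsto\int f\,d\mu_0$ both on $\mathcal B$ and on $\tilde{\mathcal B}$. Then $$\sup_{x\in\mathbb R}\Big|\mathbb P\Big(\frac{S_n}{\sigma\sqrt n}\le x\Big)-\mathcal N(0,1)(]-\infty,x])\Big| = O(n^{-1/2}).$$
   Context: Let $(E,\mathcal E)$ be a measurable space, $Q$ a transition probability on $E$ admitting an invariant probability $\nu$, $(X_n)_{n\ge0}$ a Markov chain with transition $Q$ and initial law $\mu_0$, and $\xi:E\to\mathbb R$ a measurable $\nu$-integrable function with $\nu(\xi)=0$; put $S_n=\sum_{k=1}^n\xi(X_k)$. $\mathbf 1$ is the constant function $1$. For $t\in\mathbb R$, $Q(t)f(x)=\int e^{it\xi(y)}f(y)\,Q(x,dy)$. For a Banach space $(\mathcal B,\|\cdot\|)$ of measurable complex functions on $E$, $Q$ is called $\mathcal B$-geometrically ergodic if $\mathbf 1\in\mathcal B$, $\mathcal B$ embeds continuously in $L^1(\nu)$, $Q$ is bounded on $\mathcal B$, and there are $\kappa_0<1$, $C\ge0$ with $\|Q^nf-\nu(f)\mathbf 1\|\le C\kappa_0^n\|f\|$ for all $n\ge1$, $f\in\mathcal B$. If so and $\xi\in\mathcal B$, set $\check\xi=\sum_{n\ge0}Q^n\xi$, and if $\mathcal B\subset L^2(\nu)$, $\sigma^2=\nu(\check\xi^2)-\nu((Q\check\xi)^2)$, $\psi=Q(\check\xi^2)-(Q\check\xi)^2-\sigma^2\mathbf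 1$. Hypothesis $(\mathcal H)$: there is a Banach space $(\mathcal B,\|\cdot\|)$ with $\mathcal B\subset L^3(\nu)$, $\xi\in\mathcal B$, such that (H1) $Q$ is $\mathcal B$-geometrically ergodic; (H2) $\sum_{p\ge0}\nu(|Q^p\psi|^{3/2})^{2/3}<\infty$; (H3) $\sup\{\nu(|e^{it\xi}-1||f|): \|f\|\le1\}=O(|t|)$ as $t\to0$; (H4) there is an open interval $I\ni0$ such that for $t\in I$, $Q(t)$ is bounded on $\mathcal B$, there are $\kappa<1$, $C\ge0$ with $\|Q(t)^nf\|\le C\kappa^n\|f\|+C\nu(|f|)$ for all $n\ge1,t\in I,f\in\mathcal B$, and the essential spectral radius of $Q(t)$ on $\mathcal B$ is $\le\kappa$. Hypothesis $(\tilde{\mathcal H})$: $(\mathcal H)$ holds on $\mathcal B$, and $\mathcal B$ is contained in a Banach space $(\tilde{\mathcal B},\|\cdot\|_\sim)$ such that $Q$ is $\tilde{\mathcal B}$-geometrically ergodic and $\sup\{\|Q(t)f-Qf\|_\sim: f\in\mathcal B,\|f\|\le1\}=O(|t|)$ as $t\to0$. *)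

theory Defs
  imports "HOL-Probability.Probability" "HOL-Library.Function_Algebras"
begin

definition kop :: "('e \<Rightarrow> 'e measure) \<Rightarrow> ('e \<Rightarrow> complex) \<Rightarrow> 'e \<Rightarrow> complex" where
  "kop Q f x = (\<integral>y. f y \<partial>(Q x))"

definition kop_t :: "('e \<Rightarrow> 'e measure) \<Rightarrow> ('e \<Rightarrow> real) \<Rightarrow> real
                     \<Rightarrow> ('e \<Rightarrow> complex) \<Rightarrow> 'e \<Rightarrow> complex" where
  "kop_t Q \<xi> t f x = (\<integral>y. exp (\<i> * complex_of_real (t * \<xi> y)) * f y \<partial>(Q x))"

definition markov_chain ::
  "'e measure \<Rightarrow> ('e \<Rightarrow> 'e measure) \<Rightarrow> 'e measure \<Rightarrow> 'w measure \<Rightarrow> (nat \<Rightarrow> 'w \<Rightarrow> 'e) \<Rightarrow> bool" where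
  "markov_chain E Q \<mu>0 M X \<longleftrightarrow>
     prob_space M \<and> prob_space \<mu>0 \<and> sets \<mu>0 = sets E \<and>
     (\<forall>n. X n \<in> M \<rightarrow>\<^sub>M E) \<and>
     distr M E (X 0) = \<mu>0 \<and>
     (\<forall>n A. (\<forall>i\<le>Suc n. A i \<in> sets E) \<longrightarrow>
        measure M {\<omega>\<in>space M. \<forall>i\<le>Suc n. X i \<omega> \<in> A i}
        = (\<integral>\<omega>. indicator {\<omega>\<in>space M. \<forall>i\<le>n. X i \<omega> \<in> A i} \<omega>
                  * measure (Q (X n \<omega>)) (A (Suc n)) \<partial>M))"

definition banach_fun_space ::
  "'e measure \<Rightarrow> ('e \<Rightarrow> complex) set \<Rightarrow> (('e \<Rightarrow> complex) \<Rightarrow> real) \<Rightarrow> bool" where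
  "banach_fun_space E B nB \<longleftrightarrow>
     B \<subseteq> borel_measurable E \<and>
     (\<lambda>_. 0) \<in> B \<and>
     (\<forall>f\<in>B. \<forall>g\<in>B. f + g \<in> B) \<and>
     (\<forall>f\<in>B. \<forall>c::complex. (\<lambda>x. c * f x) \<in> B) \<and>
     (\<forall>f\<in>B. nB f \<ge> 0 \<and> (nB f = 0 \<longleftrightarrow> f = (\<lambda>_. 0))) \<and>
     (\<forall>f\<in>B. \<forall>c::complex. nB (\<lambda>x. c * f x) = cmod c * nB f) \<and>
     (\<forall>f\<in>B. \<forall>g\<in>B. nB (f + g) \<le> nB f + nB g) \<and>
     (\<forall>s. (\<forall>n. s n \<in> B) \<longrightarrow>
          (\<forall>e>0. \<exists>N. \<forall>m\<ge>N. \<forall>k\<ge>N. nB (s m - s k) < e) \<longrightarrow>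
          (\<exists>f\<in>B. (\<lambda>n. nB (s n - f)) \<longlonglongrightarrow> 0))"

definition geom_ergodic ::
  "'e measure \<Rightarrow> ('e \<Rightarrow> 'e measure) \<Rightarrow> ('e \<Rightarrow> complex) set \<Rightarrow> (('e \<Rightarrow> complex) \<Rightarrow> real) \<Rightarrow> bool" where
  "geom_ergodic \<nu> Q B nB \<longleftrightarrow>
     (\<lambda>_. 1) \<in> B \<and>
     (\<exists>C. \<forall>f\<in>B. integrable \<nu> f \<and> (\<integral>x. cmod (f x) \<partial>\<nu>) \<le> C * nB f) \<and>
     (\<forall>f\<in>B. kop Q f \<in> B) \<and>
     (\<exists>C. \<forall>f\<in>B. nB (kop Q f) \<le> C * nB f) \<and>
     (\<exists>\<kappa>0 C. 0 \<le> \<kappa>0 \<and> \<kappa>0 < 1 \<and> C \<ge> 0 \<and>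
        (\<forall>n\<ge>1. \<forall>f\<in>B. nB ((kop Q ^^ n) f - (\<lambda>_. (\<integral>x. f x \<partial>\<nu>))) \<le> C * \<kappa>0 ^ n * nB f))"

definition op_norm :: "('e \<Rightarrow> complex) set \<Rightarrow> (('e \<Rightarrow> complex) \<Rightarrow> real)
                       \<Rightarrow> (('e \<Rightarrow> complex) \<Rightarrow> ('e \<Rightarrow> complex)) \<Rightarrow> real" where
  "op_norm B nB T = Sup {nB (T f) | f. f \<in> B \<and> nB f \<le> 1}"

definition compact_op :: "('e \<Rightarrow> complex) set \<Rightarrow> (('e \<Rightarrow> complex) \<Rightarrow> real)
                          \<Rightarrow> (('e \<Rightarrow> complex) \<Rightarrow> ('e \<Rightarrow> complex)) \<Rightarrow> bool" where
  "compact_op B nB K \<longleftrightarrow>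
     (\<forall>f\<in>B. K f \<in> B) \<and>
     (\<forall>f\<in>B. \<forall>g\<in>B. K (f + g) = K f + K g) \<and>
     (\<forall>f\<in>B. \<forall>c::complex. K (\<lambda>x. c * f x) = (\<lambda>x. c * K f x)) \<and>
     (\<forall>s. (\<forall>n. s n \<in> B \<and> nB (s n) \<le> 1) \<longrightarrow>
        (\<exists>r::nat \<Rightarrow> nat. strict_mono r \<and>
           (\<forall>e>0. \<exists>N. \<forall>m\<ge>N. \<forall>k\<ge>N. nB (K (s (r m)) - K (s (r k))) < e)))"

text \<open>Essential norm = norm in the Calkin algebra (distance to the compact operators);
essential spectral radius = lim (= inf, by submultiplicativity) of ess_norm(T^n)^(1/n).\<close>

definition ess_norm :: "('e \<Rightarrow> complex) set \<Rightarrow> (('e \<Rightarrow> complex) \<Rightarrow> real)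
                        \<Rightarrow> (('e \<Rightarrow> complex) \<Rightarrow> ('e \<Rightarrow> complex)) \<Rightarrow> real" where
  "ess_norm B nB T = Inf {op_norm B nB (\<lambda>f. T f - K f) | K. compact_op B nB K}"

definition ess_spectral_radius :: "('e \<Rightarrow> complex) set \<Rightarrow> (('e \<Rightarrow> complex) \<Rightarrow> real)
                        \<Rightarrow> (('e \<Rightarrow> complex) \<Rightarrow> ('e \<Rightarrow> complex)) \<Rightarrow> real" where
  "ess_spectral_radius B nB T = Inf {ess_norm B nB (T ^^ n) powr (1 / real n) | n. n \<ge> 1}"

definition xi_check :: "('e \<Rightarrow> 'e measure) \<Rightarrow> ('e \<Rightarrow> complex) set \<Rightarrow> (('e \<Rightarrow> complex) \<Rightarrow> real)
                        \<Rightarrow> ('e \<Rightarrow> real) \<Rightarrow> 'e \<Rightarrow> complex" where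
  "xi_check Q B nB \<xi> = (THE g. g \<in> B \<and>
      (\<lambda>N. nB ((\<Sum>n<N. (kop Q ^^ n) (\<lambda>x. complex_of_real (\<xi> x))) - g)) \<longlonglongrightarrow> 0)"

text \<open>sigma^2 = nu(xi-check^2) - nu((Q xi-check)^2). The quantity is real (xi-check is
nu-a.e. real); we take the real part of the complex integrals.\<close>

definition sigma2 :: "'e measure \<Rightarrow> ('e \<Rightarrow> 'e measure) \<Rightarrow> ('e \<Rightarrow> complex) set
                      \<Rightarrow> (('e \<Rightarrow> complex) \<Rightarrow> real) \<Rightarrow> ('e \<Rightarrow> real) \<Rightarrow> real" where
  "sigma2 \<nu> Q B nB \<xi> =
     Re ((\<integral>x. (xi_check Q B nB \<xi> x)\<^sup>2 \<partial>\<nu>) - (\<integral>x. (kop Q (xi_check Q B nB \<xi>) x)\<^sup>2 \<partial>\<nu>))"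

definition psi :: "'e measure \<Rightarrow> ('e \<Rightarrow> 'e measure) \<Rightarrow> ('e \<Rightarrow> complex) set
                   \<Rightarrow> (('e \<Rightarrow> complex) \<Rightarrow> real) \<Rightarrow> ('e \<Rightarrow> real) \<Rightarrow> 'e \<Rightarrow> complex" where
  "psi \<nu> Q B nB \<xi> x =
     kop Q (\<lambda>y. (xi_check Q B nB \<xi> y)\<^sup>2) x - (kop Q (xi_check Q B nB \<xi>) x)\<^sup>2
     - complex_of_real (sigma2 \<nu> Q B nB \<xi>)"

definition hyp_H :: "'e measure \<Rightarrow> 'e measure \<Rightarrow> ('e \<Rightarrow> 'e measure) \<Rightarrow> ('e \<Rightarrow> real)
                     \<Rightarrow> ('e \<Rightarrow> complex) set \<Rightarrow> (('e \<Rightarrow> complex) \<Rightarrow> real) \<Rightarrow> bool" where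
  "hyp_H E \<nu> Q \<xi> B nB \<longleftrightarrow>
     banach_fun_space E B nB \<and>
     (\<forall>f\<in>B. integrable \<nu> (\<lambda>x. cmod (f x) ^ 3)) \<and>
     (\<lambda>x. complex_of_real (\<xi> x)) \<in> B \<and>
     \<comment> \<open>(H1)\<close>
     geom_ergodic \<nu> Q B nB \<and>
     \<comment> \<open>(H2)\<close>
     (\<forall>p. integrable \<nu> (\<lambda>x. cmod ((kop Q ^^ p) (psi \<nu> Q B nB \<xi>) x) powr (3/2))) \<and>
     summable (\<lambda>p. (\<integral>x. cmod ((kop Q ^^ p) (psi \<nu> Q B nB \<xi>) x) powr (3/2) \<partial>\<nu>) powr (2/3)) \<and>
     \<comment> \<open>(H3)\<close>
     (\<exists>C \<delta>. \<delta> > 0 \<and> (\<forall>t. \<bar>t\<bar> < \<delta> \<longrightarrow> (\<forall>f\<in>B. nB f \<le> 1 \<longrightarrow>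
        (\<integral>x. cmod (exp (\<i> * complex_of_real (t * \<xi> x)) - 1) * cmod (f x) \<partial>\<nu>) \<le> C * \<bar>t\<bar>))) \<and>
     \<comment> \<open>(H4), with I the open interval {a<..<b}\<close>
     (\<exists>a b \<kappa> C. a < 0 \<and> 0 < b \<and> 0 \<le> \<kappa> \<and> \<kappa> < 1 \<and> C \<ge> 0 \<and>
        (\<forall>t\<in>{a<..<b}.
           (\<forall>f\<in>B. kop_t Q \<xi> t f \<in> B) \<and>
           (\<exists>D. \<forall>f\<in>B. nB (kop_t Q \<xi> t f) \<le> D * nB f) \<and>
           (\<forall>n\<ge>1. \<forall>f\<in>B. nB ((kop_t Q \<xi> t ^^ n) f)
                  \<le> C * \<kappa> ^ n * nB f + C * (\<integral>x. cmod (f x) \<partial>\<nu>)) \<and>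
           ess_spectral_radius B nB (kop_t Q \<xi> t) \<le> \<kappa>))"

definition hyp_H_tilde :: "'e measure \<Rightarrow> 'e measure \<Rightarrow> ('e \<Rightarrow> 'e measure) \<Rightarrow> ('e \<Rightarrow> real)
                     \<Rightarrow> ('e \<Rightarrow> complex) set \<Rightarrow> (('e \<Rightarrow> complex) \<Rightarrow> real)
                     \<Rightarrow> ('e \<Rightarrow> complex) set \<Rightarrow> (('e \<Rightarrow> complex) \<Rightarrow> real) \<Rightarrow> bool" where
  "hyp_H_tilde E \<nu> Q \<xi> B nB Bt nBt \<longleftrightarrow>
     hyp_H E \<nu> Q \<xi> B nB \<and>
     banach_fun_space E Bt nBt \<and> B \<subseteq> Bt \<and>
     geom_ergodic \<nu> Q Bt nBt \<and>
     (\<exists>C \<delta>. \<delta> > 0 \<and> (\<forall>t. \<bar>t\<bar> < \<delta> \<longrightarrow> (\<forall>f\<in>B. nB f \<le> 1 \<longrightarrow>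
        nBt (kop_t Q \<xi> t f - kop Q f) \<le> C * \<bar>t\<bar>)))"

end

theory Submission
  imports Defs
begin

text \<open>The proof is Nagaev's method without spectral theory. On the bounded functions in \<open>B\<close> the
  perturbed kernels \<open>P t\<close> are honestly linear. For a fixed large power \<open>R\<close> of \<open>P t\<close> and small \<open>t\<close>,
  the Lasota-Yorke inequality and the weak continuity in \<open>t\<close> make \<open>R\<close> contract the kernel of \<open>\<nu>\<close>
  by 1/4, while \<open>\<nu> R\<close> leaks only \<open>O(t)\<close> from it. The normalised iterates \<open>f\<close> of \<open>1\<close>, with
  \<open>f\<close> replaced by \<open>R f / \<nu>(R f)\<close>, therefore have geometrically converging factors \<open>\<nu>(R f)\<close>, and
  \<open>f - 1\<close> stays \<open>O(t)\<close> in the norm of the larger space. Hence the characteristic function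
  of \<open>S\<^sub>n\<close> is \<open>\<lambda>\<^sup>n (1 + O(t))\<close> for the limit \<open>\<lambda>\<close> of these factors.

  The factor \<open>\<lambda>\<close> is found up to \<open>O(t\<^sup>3)\<close> from the stationary chain: by the Poisson equation, \<open>S\<^sub>n\<close> is
  a martingale up to a coboundary, and a Lindeberg step costs \<open>O(t\<^sup>3)\<close> because the conditional variances
  differ from \<open>\<sigma>\<^sup>2\<close> by \<open>\<psi>\<close>, whose contribution telescopes along \<open>Q\<^sup>p \<psi>\<close>. Comparing both
  descriptions at all times up to \<open>1/t\<^sup>2\<close> determines \<open>\<lambda>\<close>. Esseen's smoothing inequality,
  obtained from Levy inversion after convolution with the Fejer kernel, concludes.\<close>

section \<open>Esseen's smoothing inequality\<close>

text \<open>The hypotheses make \<open>P t - P 0\<close> small only from the strong norm into a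
  weaker one (L^1 of \<open>\<nu>\<close>, or the norm of the larger space), so smallness in L^1 has
  to be converted back into smallness in \<open>B\<close> by the Lasota-Yorke inequality, at the
  price of a fixed number of steps. A second obstacle is that a non-integrable function has integral
  0 by convention: \<open>kop Q\<close> is additive on \<open>B\<close> only almost everywhere,
  whereas equality in \<open>B\<close> is pointwise. Bounded functions are integrable for every
  \<open>Q x\<close>, and the iterates of 1 stay bounded. The sizes of the errors are dictated by
  the division by \<open>|t|\<close> in Esseen's inequality: an error \<open>|t| + n |t|^3\<close>
  times a Gaussian in \<open>t sqrt n\<close> survives it and integrates to order 1/sqrt n. A merely
  bounded error in the prefactor would not; hence the larger space, in whose norm the normalised
  iterates are O(t)-close to 1. The cubic accuracy of the factor is gained from time: an error O(t)
  valid at all times up to \<open>1/t^2\<close> is an error O(t^3) per step.\<close>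

lemma char_convolution:
  assumes "real_distribution M" "real_distribution N"
  shows "real_distribution (M \<star> N)" "char (M \<star> N) t = char M t * char N t"
proof -
  interpret M: real_distribution M by fact
  interpret N: real_distribution N by fact
  interpret MN: pair_prob_space M N ..
  have [measurable]: "(\<lambda>p. fst p + snd p) \<in> borel_measurable (M \<Otimes>\<^sub>M N)" by simp
  have conv: "M \<star> N = distr (M \<Otimes>\<^sub>M N) borel (\<lambda>p. fst p + snd p)"
    by (simp add: convolution_def case_prod_beta')
  show "real_distribution (M \<star> N)" unfolding conv
    by (rule MN.real_distribution_distr) simp
  have "char (M \<star> N) t = (CLINT p|M \<Otimes>\<^sub>M N. iexp (t * (fst p + snd p)))"
    unfolding char_def conv by (subst integral_distr) simp_all
  also have "\<dots> = (CLINT p|M \<Otimes>\<^sub>M N. (\<lambda>(x, y). iexp (t * x) * iexp (t * y)) p)"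
    by (intro Bochner_Integration.integral_cong) (auto simp: algebra_simps exp_add)
  also have "\<dots> = (CLINT x|M. CLINT y|N. iexp (t * x) * iexp (t * y))"
    by (subst MN.integral_fst'[symmetric])
       (auto intro!: MN.P.integrable_const_bound[where B=1] simp: norm_mult split_beta)
  also have "\<dots> = char M t * char N t"
    by (simp add: char_def)
  finally show "char (M \<star> N) t = char M t * char N t" .
qed

lemma cdf_convolution:
  assumes "real_distribution M" "real_distribution N"
  shows "cdf (M \<star> N) x = (\<integral>z. cdf M (x - z) \<partial>N)"
    and "(\<lambda>z. cdf M (x - z)) \<in> borel_measurable borel"
proof -
  interpret M: real_distribution M by fact
  interpret N: real_distribution N by fact
  interpret C: real_distribution "M \<star> N" by (rule char_convolution) fact+
  have "mono (cdf M)" by (auto simp: mono_def intro: M.cdf_nondecreasing)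
  then have [measurable]: "cdf M \<in> borel_measurable borel" by (rule borel_measurable_mono)
  show "(\<lambda>z. cdf M (x - z)) \<in> borel_measurable borel" by simp
  \<comment> \<open>The mass of a convolution is computed by integrating over its first factor; the
    swap puts the smoothing law \<open>N\<close> outside.\<close>
  have comm: "(M \<star> N) = (N \<star> M)"
    by (rule convolution_commutative) (simp_all add: M.finite_measure_axioms N.finite_measure_axioms)
  have "emeasure (N \<star> M) {..x} = (\<integral>\<^sup>+z. emeasure M {a. a + z \<in> {..x}} \<partial>N)"
    by (rule convolution_emeasure) (simp_all add: M.finite_measure_axioms N.finite_measure_axioms)
  also have "\<dots> = (\<integral>\<^sup>+z. ennreal (cdf M (x - z)) \<partial>N)"
  proof (intro nn_integral_cong)
    fix z
    have "{a. a + z \<in> {..x}} = {..x - z}" by (auto simp: algebra_simps)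
    then show "emeasure M {a. a + z \<in> {..x}} = ennreal (cdf M (x - z))"
      by (simp add: cdf_def M.emeasure_eq_measure)
  qed
  also have "\<dots> = ennreal (\<integral>z. cdf M (x - z) \<partial>N)"
    by (rule nn_integral_eq_integral)
       (auto intro!: N.integrable_const_bound[where B=1] simp: M.cdf_nonneg M.cdf_bounded_prob)
  finally have "ennreal (measure (M \<star> N) {..x}) = ennreal (\<integral>z. cdf M (x - z) \<partial>N)"
    by (simp add: comm[symmetric] C.emeasure_eq_measure)
  then show "cdf (M \<star> N) x = (\<integral>z. cdf M (x - z) \<partial>N)"
    by (subst (asm) ennreal_inj) (auto simp: cdf_def intro!: Bochner_Integration.integral_nonneg)
qed

text \<open>Levy inversion only reaches intervals whose end points carry no mass. One atomless
  factor removes every atom, because all translates of a point are null for it.\<close>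

lemma convolution_atomless:
  assumes "real_distribution M" "real_distribution N" "\<And>x. measure N {x} = 0"
  shows "measure (M \<star> N) {x} = 0"
proof -
  interpret M: real_distribution M by fact
  interpret N: real_distribution N by fact
  have "emeasure (M \<star> N) {x} = (\<integral>\<^sup>+z. emeasure N {a. a + z \<in> {x}} \<partial>M)"
    by (rule convolution_emeasure) (simp_all add: M.finite_measure_axioms N.finite_measure_axioms)
  also have "\<dots> = (\<integral>\<^sup>+z. 0 \<partial>M)"
  proof (intro nn_integral_cong)
    fix z
    have "{a. a + z \<in> {x}} = {x - z}" by (auto simp: algebra_simps)
    then show "emeasure N {a. a + z \<in> {x}} = 0"
      using assms(3)[of "x - z"] by (simp add: N.emeasure_eq_measure)
  qed
  finally show ?thesis by (simp add: measure_def)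
qed

text \<open>Levy inversion writes the difference of the masses of \<open>{a<..b}\<close> as an
  integral of the difference of the characteristic functions against a kernel of modulus at most
  2/|t|. With the prefactor 1/(2 pi) this leaves the integral of \<open>d\<close> over pi, uniformly
  in \<open>a\<close>, so that \<open>a\<close> may tend to minus infinity.\<close>

lemma cdf_diff_le_char_integral:
  assumes rd: "real_distribution M" "real_distribution G"
    and at: "\<And>x. measure M {x} = 0" "\<And>x. measure G {x} = 0"
    and int: "integrable lborel d"
    and le: "\<And>t. t \<noteq> 0 \<Longrightarrow> cmod (char M t - char G t) / \<bar>t\<bar> \<le> d t"
    and T: "\<And>t. 0 \<le> d t"
  shows "\<bar>cdf M x - cdf G x\<bar> \<le> (\<integral>t. d t \<partial>lborel) / pi"
proof -
  interpret M: real_distribution M by fact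
  interpret G: real_distribution G by fact
  have dmeas[measurable]: "d \<in> borel_measurable borel" using int by auto
  have main: "\<bar>measure M {a<..b} - measure G {a<..b}\<bar> \<le> (\<integral>t. d t \<partial>lborel) / pi" if "a \<le> b" for a b
  proof -
    define F where "F t = (iexp (-(t * a)) - iexp (-(t * b))) / (\<i> * complex_of_real t)" for t :: real
    \<comment> \<open>This bound, finite at 0, makes the two inversion integrals exist separately;
      the bound 2/|t| enters only once the characteristic functions have been subtracted.\<close>
    have Fb: "cmod (F t) \<le> b - a" if "t \<noteq> 0" for t
      using Levy_Inversion_aux2[of "-b" "-a" t] \<open>a \<le> b\<close> that by (simp add: F_def)
    have [measurable]: "F \<in> borel_measurable borel" unfolding F_def by measurable
    have inb: "interval_lebesgue_integrable lborel (ereal (- real n)) (ereal (real n)) (\<lambda>t. F t * \<phi> t)"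
      if [measurable]: "\<phi> \<in> borel_measurable borel" and "\<And>t. cmod (\<phi> t) \<le> 1" for n :: nat and \<phi>
    proof -
      have "set_integrable lborel {- real n<..<real n} (\<lambda>t. F t * \<phi> t)"
        unfolding set_integrable_def
      proof (rule Bochner_Integration.integrable_bound)
        show "integrable lborel (\<lambda>t. indicator {- real n<..<real n} t *\<^sub>R (b - a))"
          by (intro integrable_scaleR_left integrable_indicator) simp_all
        show "AE t in lborel. norm (indicat_real {- real n<..<real n} t *\<^sub>R (F t * \<phi> t))
              \<le> norm (indicat_real {- real n<..<real n} t *\<^sub>R (b - a))"
          using AE_lborel_singleton[of 0]
        proof eventually_elim
          case (elim t)
          have "cmod (F t) * cmod (\<phi> t) \<le> (b - a) * 1"
            using Fb[OF elim] that(2)[of t] \<open>a \<le> b\<close> by (intro mult_mono) auto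
          then show ?case using \<open>a \<le> b\<close> by (auto simp: norm_mult indicator_def)
        qed
      qed simp
      then show ?thesis by (simp add: interval_lebesgue_integrable_def einterval_eq)
    qed
    have lim: "(\<lambda>n::nat. 1 / (2 * pi) * (CLBINT t=-real n..real n. F t * char M t) -
                   1 / (2 * pi) * (CLBINT t=-real n..real n. F t * char G t))
        \<longlonglongrightarrow> complex_of_real (measure M {a<..b}) - complex_of_real (measure G {a<..b})"
      using M.Levy_Inversion[OF that at(1) at(1)] G.Levy_Inversion[OF that at(2) at(2)]
      unfolding F_def by (intro tendsto_diff) auto
    have bd: "cmod (1 / (2 * pi) * (CLBINT t=-real n..real n. F t * char M t) -
                   1 / (2 * pi) * (CLBINT t=-real n..real n. F t * char G t)) \<le> (\<integral>t. d t \<partial>lborel) / pi" for n :: nat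
    proof -
      have iM: "interval_lebesgue_integrable lborel (ereal (- real n)) (ereal (real n)) (\<lambda>t. F t * char M t)"
        by (rule inb) (simp_all add: M.cmod_char_le_1)
      have iG: "interval_lebesgue_integrable lborel (ereal (- real n)) (ereal (real n)) (\<lambda>t. F t * char G t)"
        by (rule inb) (simp_all add: G.cmod_char_le_1)
      have "(CLBINT t=-real n..real n. F t * char M t) - (CLBINT t=-real n..real n. F t * char G t)
         = (CLBINT t=-real n..real n. F t * char M t - F t * char G t)"
        using interval_lebesgue_integral_diff(2)[OF iM iG] by simp
      also have "\<dots> = (\<integral>t. indicat_real {- real n<..<real n} t *\<^sub>R (F t * char M t - F t * char G t) \<partial>lborel)"
        by (simp add: interval_lebesgue_integral_def einterval_eq(1) set_lebesgue_integral_def)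
      also have "cmod \<dots> \<le> (\<integral>t. 2 * d t \<partial>lborel)"
      proof (rule Bochner_Integration.integral_norm_bound_integral)
        show "integrable lborel (\<lambda>t. indicat_real {- real n<..<real n} t *\<^sub>R (F t * char M t - F t * char G t))"
          using interval_lebesgue_integral_diff(1)[OF iM iG]
          by (simp add: interval_lebesgue_integrable_def set_integrable_def einterval_eq)
        show "integrable lborel (\<lambda>t. 2 * d t)" using int by simp
        show "norm (indicat_real {- real n<..<real n} t *\<^sub>R (F t * char M t - F t * char G t)) \<le> 2 * d t" for t
        proof (cases "t = 0")
          case True then show ?thesis using T[of t] by (simp add: F_def)
        next
          case False
          have "cmod (iexp (-(t * a)) - iexp (-(t * b))) \<le> 1 + 1"
            by (rule order_trans[OF norm_triangle_ineq4]) (simp del: of_real_mult of_real_minus)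
          then have "cmod (F t) \<le> 2 / \<bar>t\<bar>"
            by (simp add: F_def norm_divide norm_mult divide_right_mono)
          then have "cmod (F t) * cmod (char M t - char G t) \<le> 2 / \<bar>t\<bar> * cmod (char M t - char G t)"
            by (intro mult_right_mono) auto
          also have "\<dots> \<le> 2 * d t" using le[OF False] by simp
          finally show ?thesis using T[of t]
            by (auto simp: indicator_def right_diff_distrib[symmetric] norm_mult)
        qed
      qed
      finally have "cmod ((CLBINT t=-real n..real n. F t * char M t) - (CLBINT t=-real n..real n. F t * char G t))
          \<le> 2 * (\<integral>t. d t \<partial>lborel)" by simp
      then have "cmod (1 / (2 * pi)) * cmod ((CLBINT t=-real n..real n. F t * char M t) - (CLBINT t=-real n..real n. F t * char G t))
          \<le> 1 / (2 * pi) * (2 * (\<integral>t. d t \<partial>lborel))"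
        by (intro mult_mono) (auto simp: norm_divide)
      then show ?thesis unfolding norm_mult[symmetric] right_diff_distrib by simp
    qed
    have "cmod (complex_of_real (measure M {a<..b}) - complex_of_real (measure G {a<..b})) \<le> (\<integral>t. d t \<partial>lborel) / pi"
      by (rule LIMSEQ_le_const2[OF tendsto_norm[OF lim]]) (use bd in auto)
    then show ?thesis by (metis norm_of_real of_real_diff)
  qed
  have "((\<lambda>a. \<bar>(cdf M x - cdf M a) - (cdf G x - cdf G a)\<bar>) \<longlongrightarrow> \<bar>(cdf M x - 0) - (cdf G x - 0)\<bar>) at_bot"
    by (intro tendsto_intros M.cdf_lim_at_bot G.cdf_lim_at_bot)
  moreover have "\<forall>\<^sub>F a in at_bot. \<bar>(cdf M x - cdf M a) - (cdf G x - cdf G a)\<bar> \<le> (\<integral>t. d t \<partial>lborel) / pi"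
    using eventually_gt_at_bot[of x]
  proof (rule eventually_mono)
    fix a assume "a < x"
    then show "\<bar>(cdf M x - cdf M a) - (cdf G x - cdf G a)\<bar> \<le> (\<integral>t. d t \<partial>lborel) / pi"
      using main[of a x] by (simp add: M.cdf_diff_eq G.cdf_diff_eq)
  qed
  ultimately show ?thesis
    by (auto intro: tendsto_upperbound)
qed

text \<open>A deviation \<open>u\<close> of the distribution functions at one point persists, up to
  \<open>2 * m * \<delta>\<close>, on a window of length \<open>2 * \<delta>\<close> beside it: one
  function is monotone and the other Lipschitz. A kernel with mass 3/4 in the window sees at least
  3/4 of it and loses at most \<open>D / 4\<close> outside, \<open>D\<close> being the supremum.
  Solving \<open>D \<le> 4/3 * J + D/3 + 2 * m * \<delta>\<close> for \<open>D\<close> gives the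
  constants 2 and 3.\<close>

lemma esseen_smoothing:
  assumes rd: "real_distribution M" "real_distribution G" "real_distribution K"
    and Kat: "\<And>x. measure K {x} = 0" and Kchar: "\<And>t. T < \<bar>t\<bar> \<Longrightarrow> char K t = 0"
    and Kmass: "measure K {-\<delta>..\<delta>} \<ge> 3 / 4" and \<delta>: "\<delta> \<ge> 0"
    and m: "\<And>x y. x \<le> y \<Longrightarrow> cdf G y - cdf G x \<le> m * (y - x)" "m \<ge> 0"
    and int: "integrable lborel d" and d0: "\<And>t. 0 \<le> d t"
    and le: "\<And>t. t \<noteq> 0 \<Longrightarrow> \<bar>t\<bar> \<le> T \<Longrightarrow> cmod (char M t - char G t) / \<bar>t\<bar> \<le> d t"
  shows "\<bar>cdf M x - cdf G x\<bar> \<le> 2 * (\<integral>t. d t \<partial>lborel) / pi + 3 * m * \<delta>"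
proof -
  interpret M: real_distribution M by fact
  interpret G: real_distribution G by fact
  interpret K: real_distribution K by fact
  define J where "J = (\<integral>t. d t \<partial>lborel) / pi"
  define H where "H x = cdf M x - cdf G x" for x
  define D where "D = (SUP x. \<bar>H x\<bar>)"
  have Hb: "\<bar>H x\<bar> \<le> 1" for x
    using M.cdf_nonneg[of x] M.cdf_bounded_prob[of x] G.cdf_nonneg[of x] G.cdf_bounded_prob[of x]
    by (auto simp: H_def)
  have HD: "\<bar>H x\<bar> \<le> D" for x unfolding D_def
    by (rule cSUP_upper) (auto intro!: bdd_aboveI[where M=1] Hb)
  have D0: "0 \<le> D" using HD[of 0] by linarith
  have [measurable]: "cdf M \<in> borel_measurable borel" "cdf G \<in> borel_measurable borel"
    by (auto intro!: borel_measurable_mono simp: mono_def M.cdf_nondecreasing G.cdf_nondecreasing)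
  have [measurable]: "H \<in> borel_measurable borel" unfolding H_def by measurable
  have Hint: "integrable K (\<lambda>z. H (y - z))" for y
    by (rule K.integrable_const_bound[where B=1]) (auto simp: Hb)
  have conv: "\<bar>\<integral>z. H (y - z) \<partial>K\<bar> \<le> J" for y
  proof -
    have "(\<integral>z. H (y - z) \<partial>K) = cdf (M \<star> K) y - cdf (G \<star> K) y"
      unfolding H_def cdf_convolution(1)[OF rd(1,3)] cdf_convolution(1)[OF rd(2,3)]
      by (rule Bochner_Integration.integral_diff)
         (auto intro!: K.integrable_const_bound[where B=1] simp: M.cdf_nonneg M.cdf_bounded_prob G.cdf_nonneg G.cdf_bounded_prob)
    also have "\<bar>\<dots>\<bar> \<le> J" unfolding J_def
    proof (rule cdf_diff_le_char_integral)
      show "cmod (char (M \<star> K) t - char (G \<star> K) t) / \<bar>t\<bar> \<le> d t" if "t \<noteq> 0" for t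
      proof (cases "\<bar>t\<bar> \<le> T")
        case True
        have "cmod (char (M \<star> K) t - char (G \<star> K) t) = cmod (char M t - char G t) * cmod (char K t)"
          using rd by (simp add: char_convolution(2) left_diff_distrib[symmetric] norm_mult)
        also have "\<dots> \<le> cmod (char M t - char G t) * 1"
          by (intro mult_left_mono K.cmod_char_le_1) auto
        finally have "cmod (char (M \<star> K) t - char (G \<star> K) t) / \<bar>t\<bar> \<le> cmod (char M t - char G t) / \<bar>t\<bar>"
          by (intro divide_right_mono) auto
        also have "\<dots> \<le> d t" by (rule le[OF that True])
        finally show ?thesis .
      next
        case False
        then show ?thesis using rd Kchar[of t] d0[of t] by (simp add: char_convolution(2))
      qed
    qed (use rd Kat int d0 in \<open>auto intro: char_convolution convolution_atomless\<close>)
    finally show ?thesis .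
  qed
  define p where "p = measure K {-\<delta>..\<delta>}"
  have p: "3 / 4 \<le> p" "p \<le> 1" using Kmass by (auto simp: p_def)
  have intind: "integrable K (indicat_real {-\<delta>..\<delta>})" "(\<integral>z. indicator {-\<delta>..\<delta>} z \<partial>K) = p"
    by (auto simp: p_def intro!: K.integrable_const_bound[where B=1])
  \<comment> \<open>\<open>s\<close> is the sign of the deviation and \<open>y\<close> the centre of
    the window, so both signs of \<open>H\<close> share one argument. Inside the window the
    integrand is at least \<open>u - 2 * m * \<delta>\<close>, outside at least
    \<open>- D\<close>.\<close>
  have key: "u \<le> 4 / 3 * J + D / 3 + 2 * m * \<delta>"
    if low: "\<And>z. \<bar>z\<bar> \<le> \<delta> \<Longrightarrow> u - 2 * m * \<delta> \<le> s * H (y - z)" and s: "\<bar>s\<bar> = 1" for u s y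
  \<comment> \<open>Replacing the mass \<open>p\<close> of the window by its lower bound 3/4 needs a
    nonnegative factor \<open>u - 2 * m * \<delta>\<close>; otherwise the claim is
    immediate.\<close>
  proof (cases "u \<le> 2 * m * \<delta>")
    case True
    have "0 \<le> J" using conv[of 0] by linarith
    with True D0 show ?thesis by linarith
  next
    case False
    have "(u - 2 * m * \<delta>) * p - D * (1 - p)
        = (\<integral>z. (u - 2 * m * \<delta> + D) * indicator {-\<delta>..\<delta>} z - D \<partial>K)"
      using intind by (simp add: K.prob_space algebra_simps del: K.space_eq_univ)
    also have "\<dots> \<le> (\<integral>z. s * H (y - z) \<partial>K)"
    proof (rule integral_mono)
      show "(u - 2 * m * \<delta> + D) * indicat_real {- \<delta>..\<delta>} z - D \<le> s * H (y - z)" for z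
      proof (cases "\<bar>z\<bar> \<le> \<delta>")
        case True then show ?thesis using low[OF True] by (auto simp: indicator_def)
      next
        case False
        have "- D \<le> s * H (y - z)" using HD[of "y - z"] s by (auto simp: abs_if split: if_splits)
        then show ?thesis using False by (auto simp: indicator_def)
      qed
    qed (use intind Hint in auto)
    also have "\<dots> = s * (\<integral>z. H (y - z) \<partial>K)" by simp
    also have "\<dots> \<le> J" using conv[of y] s by (auto simp: abs_if split: if_splits)
    finally have 1: "(u - 2 * m * \<delta>) * p - D * (1 - p) \<le> J" .
    have "(u - 2 * m * \<delta>) * (3/4) \<le> (u - 2 * m * \<delta>) * p"
      using False p by (intro mult_left_mono) auto
    moreover have "D * (1 - p) \<le> D * (1/4)" using D0 p by (intro mult_left_mono) auto
    ultimately show ?thesis using 1 by (simp add: field_simps)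
  qed
  have "\<bar>H y\<bar> \<le> 4 / 3 * J + D / 3 + 2 * m * \<delta>" for y
  proof (cases "H y \<ge> 0")
    case True
    \<comment> \<open>Centred at \<open>y + \<delta>\<close>, the window puts every
      \<open>y + \<delta> - z\<close> to the right of \<open>y\<close>, where \<open>cdf M\<close>
      is no smaller and \<open>cdf G\<close> has grown by at most \<open>2 * m * \<delta>\<close>. A
      negative deviation is propagated to the left instead.\<close>
    have "H y \<le> 4 / 3 * J + D / 3 + 2 * m * \<delta>"
    proof (rule key[of _ 1 "y + \<delta>"])
      fix z assume z: "\<bar>z\<bar> \<le> \<delta>"
      have "cdf M y \<le> cdf M (y + \<delta> - z)" using z by (intro M.cdf_nondecreasing) auto
      moreover have "cdf G (y + \<delta> - z) - cdf G y \<le> m * (\<delta> - z)" using m(1)[of y "y + \<delta> - z"] z by (simp add: algebra_simps)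
      moreover have "m * (\<delta> - z) \<le> m * (2 * \<delta>)" using z m(2) by (intro mult_left_mono) auto
      ultimately show "H y - 2 * m * \<delta> \<le> 1 * H (y + \<delta> - z)" by (simp add: H_def)
    qed simp
    with True show ?thesis by simp
  next
    case False
    have "- H y \<le> 4 / 3 * J + D / 3 + 2 * m * \<delta>"
    proof (rule key[of _ "-1" "y - \<delta>"])
      fix z assume z: "\<bar>z\<bar> \<le> \<delta>"
      have "cdf M (y - \<delta> - z) \<le> cdf M y" using z by (intro M.cdf_nondecreasing) auto
      moreover have "cdf G y - cdf G (y - \<delta> - z) \<le> m * (\<delta> + z)" using m(1)[of "y - \<delta> - z" y] z by (simp add: algebra_simps)
      moreover have "m * (\<delta> + z) \<le> m * (2 * \<delta>)" using z m(2) by (intro mult_left_mono) auto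
      ultimately show "- H y - 2 * m * \<delta> \<le> - 1 * H (y - \<delta> - z)" by (simp add: H_def)
    qed simp
    with False show ?thesis by simp
  qed
  then have "D \<le> 4 / 3 * J + D / 3 + 2 * m * \<delta>" unfolding D_def by (intro cSUP_least) auto
  then have "D \<le> 2 * J + 3 * m * \<delta>" by simp
  with HD[of x] show ?thesis by (simp add: H_def J_def)
qed

section \<open>The Fejer kernel and the support of its characteristic function\<close>

lemma DERIV_sin_sinc:
  "((\<lambda>x. sin x * sinc x) has_real_derivative
     (if x = 0 then 1 else 2 * sin x * cos x / x - (sin x)\<^sup>2 / x\<^sup>2)) (at x)"
proof (cases "x = 0")
  case True
  have "((\<lambda>h. sinc h * sinc h) \<longlongrightarrow> sinc 0 * sinc 0) (at 0)"
    using isCont_sinc[of 0] by (intro tendsto_mult) (auto simp: isCont_def)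
  then have "((\<lambda>h. (sin (0 + h) * sinc (0 + h) - sin 0 * sinc 0) / h) \<longlongrightarrow> 1) (at 0)"
    by (subst tendsto_cong[where g="\<lambda>h. sinc h * sinc h"]) (auto simp: eventually_at_filter)
  then show ?thesis unfolding DERIV_def True by simp
next
  case False
  have "((\<lambda>x. sin x * (sin x / x)) has_real_derivative 2 * sin x * cos x / x - (sin x)\<^sup>2 / x\<^sup>2) (at x)"
    using False by (auto intro!: derivative_eq_intros simp: field_simps power2_eq_square)
  moreover have "\<forall>\<^sub>F y in nhds x. sin y * (sin y / y) = sin y * sinc y"
    using t1_space_nhds[OF False] by eventually_elim simp
  ultimately show ?thesis using False DERIV_cong_ev[of x x] by auto
qed

lemma sin_sinc_tendsto_0:
  "((\<lambda>x. g x * (sin x * sinc x)) \<longlongrightarrow> 0) at_top"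
  "((\<lambda>x. g x * (sin x * sinc x)) \<longlongrightarrow> 0) at_bot" if g: "\<And>x. \<bar>g x\<bar> \<le> 1" for g :: "real \<Rightarrow> real"
proof -
  have b: "norm (g x * (sin x * sinc x)) \<le> norm (inverse x)" if "x \<noteq> 0" for x
  proof -
    have "\<bar>g x\<bar> * (\<bar>sin x\<bar> * \<bar>sin x\<bar>) \<le> 1 * (1 * 1)"
      by (intro mult_mono g) auto
    then show ?thesis using that by (simp add: abs_mult field_simps)
  qed
  show "((\<lambda>x. g x * (sin x * sinc x)) \<longlongrightarrow> 0) at_top"
    by (rule Lim_null_comparison[OF _ tendsto_norm_zero[OF tendsto_inverse_0_at_top[OF filterlim_ident]]])
       (use eventually_gt_at_top[of 0] b in \<open>auto elim!: eventually_mono\<close>)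
  show "((\<lambda>x. g x * (sin x * sinc x)) \<longlongrightarrow> 0) at_bot"
    by (rule Lim_null_comparison[OF _ tendsto_norm_zero[OF tendsto_inverse_0[THEN filterlim_mono]]])
       (use eventually_gt_at_bot[of 0] b in \<open>auto elim!: eventually_mono simp: at_bot_le_at_infinity\<close>)
qed

lemma Si_uminus: "Si (- T) = - Si T"
  using Si_neg[of T] Si_neg[of "- T"] by (cases "T \<ge> 0") auto

lemma Si_scaled_tendsto:
  "((\<lambda>x. c * Si (c * x)) \<longlongrightarrow> \<bar>c\<bar> * pi / 2) at_top"
  "((\<lambda>x. c * Si (c * x)) \<longlongrightarrow> - (\<bar>c\<bar> * pi / 2)) at_bot"
proof -
  have eq: "c * Si (c * x) = \<bar>c\<bar> * Si (\<bar>c\<bar> * x)" for x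
    using Si_uminus[of "c * x"] by (cases "c \<ge> 0") auto
  have top: "((\<lambda>x. \<bar>c\<bar> * Si (\<bar>c\<bar> * x)) \<longlongrightarrow> \<bar>c\<bar> * pi / 2) at_top"
  proof (cases "c = 0")
    case False
    have "((\<lambda>x. Si (\<bar>c\<bar> * x)) \<longlongrightarrow> pi / 2) at_top"
      by (rule filterlim_compose[OF Si_at_top])
         (use False in \<open>intro filterlim_tendsto_pos_mult_at_top[OF tendsto_const] filterlim_ident, auto\<close>)
    from tendsto_mult[OF tendsto_const this, of "\<bar>c\<bar>"] show ?thesis by simp
  qed simp
  from top show "((\<lambda>x. c * Si (c * x)) \<longlongrightarrow> \<bar>c\<bar> * pi / 2) at_top" by (simp add: eq)
  have "((\<lambda>x. - (\<bar>c\<bar> * Si (\<bar>c\<bar> * (- x)))) \<longlongrightarrow> - (\<bar>c\<bar> * pi / 2)) at_bot"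
    by (intro tendsto_minus filterlim_compose[OF top] filterlim_uminus_at_top_at_bot)
  then show "((\<lambda>x. c * Si (c * x)) \<longlongrightarrow> - (\<bar>c\<bar> * pi / 2)) at_bot"
    by (simp add: eq Si_uminus)
qed

text \<open>Obtained by integrating \<open>cos (t * x) * (sin x / x)^2\<close> by parts: the
  boundary term is the first summand, and product-to-sum formulas turn the remaining integral into
  sine integrals of frequencies \<open>t\<close> and \<open>t + 2\<close>,
  \<open>t - 2\<close>.\<close>

definition fejer_primitive :: "real \<Rightarrow> real \<Rightarrow> real" where
  "fejer_primitive t x = - cos (t * x) * (sin x * sinc x) - t * Si (t * x) / 2
     + (t + 2) * Si ((t + 2) * x) / 4 + (t - 2) * Si ((t - 2) * x) / 4"

lemma DERIV_fejer_primitive: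
  "(fejer_primitive t has_real_derivative cos (t * x) * (sinc x)\<^sup>2) (at x)"
proof -
  have Si: "((\<lambda>x. c * Si (c * x)) has_real_derivative c * (sinc (c * x) * c)) (at x)" for c
    by (intro DERIV_cmult DERIV_chain2[OF DERIV_Si]) (auto intro!: derivative_eq_intros)
  define p where "p = (if x = 0 then 1 else 2 * sin x * cos x / x - (sin x)\<^sup>2 / x\<^sup>2)"
  have P: "((\<lambda>x. sin x * sinc x) has_real_derivative p) (at x)"
    unfolding p_def by (rule DERIV_sin_sinc)
  have "(fejer_primitive t has_real_derivative
      (- (cos (t * x)) * p + (sin (t * x) * t) * (sin x * sinc x)) - t * (sinc (t * x) * t) / 2
       + (t + 2) * (sinc ((t + 2) * x) * (t + 2)) / 4 + (t - 2) * (sinc ((t - 2) * x) * (t - 2)) / 4) (at x)"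
    unfolding fejer_primitive_def[abs_def]
    by (intro DERIV_add DERIV_diff DERIV_mult' P DERIV_cdivide Si)
       (auto intro!: derivative_eq_intros)
  moreover have "(- (cos (t * x)) * p + (sin (t * x) * t) * (sin x * sinc x)) - t * (sinc (t * x) * t) / 2
       + (t + 2) * (sinc ((t + 2) * x) * (t + 2)) / 4 + (t - 2) * (sinc ((t - 2) * x) * (t - 2)) / 4
      = cos (t * x) * (sinc x)\<^sup>2"
  proof (cases "x = 0")
    case True then show ?thesis by (simp add: p_def field_simps)
  next
    case False
    have s: "c * (sinc (c * x) * c) = c * sin (c * x) / x" for c
      using False by (cases "c = 0") auto
    define S C s c where "S = sin (t * x)" and "C = cos (t * x)" and "s = sin x" and "c = cos x"
    have e: "sin ((t + 2) * x) = S * cos (2 * x) + C * sin (2 * x)" "sin ((t - 2) * x) = S * cos (2 * x) - C * sin (2 * x)"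
      by (simp_all add: distrib_right left_diff_distrib sin_add sin_diff S_def C_def)
    have e2: "cos (2 * x) = 1 - 2 * s\<^sup>2" "sin (2 * x) = 2 * s * c"
      by (simp_all add: s_def c_def cos_double_sin sin_double)
    show ?thesis unfolding s[where c=t] s[where c="t+2"] s[where c="t-2"] unfolding e e2 using False
      by (simp add: p_def S_def[symmetric] C_def[symmetric] s_def[symmetric] c_def[symmetric])
         (simp add: field_simps power2_eq_square)
  qed
  ultimately show ?thesis by simp
qed

text \<open>The bracket is the tent function \<open>max 0 (1 - |t| / 2)\<close>. Its vanishing from
  \<open>|t| = 2\<close> on is what makes the kernel band-limited.\<close>

lemma fejer_primitive_tendsto:
  "(fejer_primitive t \<longlongrightarrow> pi / 2 * (\<bar>t + 2\<bar> / 4 + \<bar>t - 2\<bar> / 4 - \<bar>t\<bar> / 2)) at_top"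
  "(fejer_primitive t \<longlongrightarrow> - (pi / 2 * (\<bar>t + 2\<bar> / 4 + \<bar>t - 2\<bar> / 4 - \<bar>t\<bar> / 2))) at_bot"
proof -
  have "(fejer_primitive t \<longlongrightarrow> 0 - \<bar>t\<bar> * pi / 2 / 2 + \<bar>t + 2\<bar> * pi / 2 / 4 + \<bar>t - 2\<bar> * pi / 2 / 4) at_top"
    unfolding fejer_primitive_def[abs_def]
    by (intro tendsto_add tendsto_diff sin_sinc_tendsto_0 tendsto_divide Si_scaled_tendsto tendsto_const) auto
  then show "(fejer_primitive t \<longlongrightarrow> pi / 2 * (\<bar>t + 2\<bar> / 4 + \<bar>t - 2\<bar> / 4 - \<bar>t\<bar> / 2)) at_top"
    by (rule back_subst[where P="\<lambda>l. (_ \<longlongrightarrow> l) _"]) (simp add: algebra_simps)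
  have "(fejer_primitive t \<longlongrightarrow> 0 - (- (\<bar>t\<bar> * pi / 2)) / 2 + (- (\<bar>t + 2\<bar> * pi / 2)) / 4 + (- (\<bar>t - 2\<bar> * pi / 2)) / 4) at_bot"
    unfolding fejer_primitive_def[abs_def]
    by (intro tendsto_add tendsto_diff sin_sinc_tendsto_0 tendsto_divide Si_scaled_tendsto tendsto_const) auto
  then show "(fejer_primitive t \<longlongrightarrow> - (pi / 2 * (\<bar>t + 2\<bar> / 4 + \<bar>t - 2\<bar> / 4 - \<bar>t\<bar> / 2))) at_bot"
    by (rule back_subst[where P="\<lambda>l. (_ \<longlongrightarrow> l) _"]) (simp add: algebra_simps)
qed

lemma isCont_cos_sinc2: "isCont (\<lambda>x. cos (t * x) * (sinc x)\<^sup>2) x"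
  by (intro continuous_intros isCont_sinc)

text \<open>This is the frequency 0, where the integrand is nonnegative, so the limits of the
  primitive yield integrability along with the value. The same function then dominates the
  integrands of all other frequencies.\<close>

lemma integral_sinc2: "integrable lborel (\<lambda>x. (sinc x)\<^sup>2)" "(\<integral>x. (sinc x)\<^sup>2 \<partial>lborel) = pi"
proof -
  note FTC = interval_integral_FTC_nonneg[of "-\<infinity>" "\<infinity>" "fejer_primitive 0" "\<lambda>x. cos (0 * x) * (sinc x)\<^sup>2" "- (pi / 2)" "pi / 2"]
  have A: "set_integrable lborel (einterval (-\<infinity>) \<infinity>) (\<lambda>x. cos (0 * x) * (sinc x)\<^sup>2)"
    by (rule FTC) (use DERIV_fejer_primitive[of 0] isCont_cos_sinc2[where t=0] fejer_primitive_tendsto[of 0] in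
        \<open>auto simp: ereal_tendsto_simps\<close>)
  have B: "(LBINT x=-\<infinity>..\<infinity>. cos (0 * x) * (sinc x)\<^sup>2) = pi / 2 - (- (pi / 2))"
    by (rule FTC) (use DERIV_fejer_primitive[of 0] isCont_cos_sinc2[where t=0] fejer_primitive_tendsto[of 0] in
        \<open>auto simp: ereal_tendsto_simps\<close>)
  show "integrable lborel (\<lambda>x. (sinc x)\<^sup>2)" using A by (simp add: set_integrable_def)
  show "(\<integral>x. (sinc x)\<^sup>2 \<partial>lborel) = pi"
    using B by (simp add: interval_lebesgue_integral_def set_lebesgue_integral_def del: sinc_neg)
qed

lemma integral_cos_sinc2:
  assumes "2 \<le> \<bar>t\<bar>"
  shows "(\<integral>x. cos (t * x) * (sinc x)\<^sup>2 \<partial>lborel) = 0"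
proof -
  have z: "\<bar>t + 2\<bar> / 4 + \<bar>t - 2\<bar> / 4 - \<bar>t\<bar> / 2 = 0"
    using assms by (cases "t \<ge> 0") (auto simp: abs_if field_simps split: if_splits)
  have int: "integrable lborel (\<lambda>x. cos (t * x) * (sinc x)\<^sup>2)"
    by (rule Bochner_Integration.integrable_bound[OF integral_sinc2(1)])
       (auto simp: abs_mult intro!: mult_left_le_one_le)
  have "(LBINT x=-\<infinity>..\<infinity>. cos (t * x) * (sinc x)\<^sup>2) = 0 - 0"
    by (rule interval_integral_FTC_integrable[where F="fejer_primitive t"])
       (use DERIV_fejer_primitive[of t] isCont_cos_sinc2[where t=t] fejer_primitive_tendsto[of t] int z in
        \<open>auto simp: ereal_tendsto_simps set_integrable_def has_real_derivative_iff_has_vector_derivative simp del: sinc_neg\<close>)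
  then show ?thesis
    by (simp add: interval_lebesgue_integral_def set_lebesgue_integral_def)
qed

lemma integral_odd:
  fixes f :: "real \<Rightarrow> real"
  assumes "\<And>x. f (- x) = - f x"
  shows "(\<integral>x. f x \<partial>lborel) = 0"
proof -
  have "(\<integral>x. f x \<partial>lborel) = (\<integral>x. f (- x) \<partial>lborel)"
    using lborel_integral_real_affine[of "-1" f 0] by simp
  then show ?thesis by (simp add: assms)
qed

text \<open>The density is \<open>(sinc x)^2 / pi\<close>. The real part of its characteristic
  function is the cosine integral, which vanishes from 2 on; the imaginary part vanishes by
  oddness.\<close>

lemma fejer_kernel:
  obtains K where "real_distribution K" "\<And>x. measure K {x} = 0" "\<And>t. 2 \<le> \<bar>t\<bar> \<Longrightarrow> char K t = 0"
proof
  define K where "K = density lborel (\<lambda>x. ennreal ((sinc x)\<^sup>2 / pi))"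
  have "emeasure K UNIV = ennreal (\<integral>x. (sinc x)\<^sup>2 / pi \<partial>lborel)"
    unfolding K_def using integral_sinc2(1)
    by (subst emeasure_density)
       (simp_all add: nn_integral_eq_integral[of lborel "\<lambda>x. (sinc x)\<^sup>2 / pi"] del: sinc_neg)
  also have "\<dots> = 1" by (simp add: integral_sinc2(2) del: power_divide)
  finally have "prob_space K" by (intro prob_spaceI) (simp add: K_def)
  then show rd: "real_distribution K"
    by (auto simp: real_distribution_def real_distribution_axioms_def K_def)
  have "emeasure K {x} = 0" for x
    unfolding K_def using AE_lborel_singleton[of x]
    by (subst emeasure_density) (auto simp: nn_integral_0_iff_AE elim: eventually_mono)
  then show "measure K {x} = 0" for x by (simp add: measure_def)
  show "char K t = 0" if "2 \<le> \<bar>t\<bar>" for t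
  proof -
    have int: "integrable lborel (\<lambda>x. g (t * x) * (sinc x)\<^sup>2)" if [measurable]: "g \<in> borel_measurable borel" and "\<And>x. \<bar>g x\<bar> \<le> 1"
      for g :: "real \<Rightarrow> real"
      by (rule Bochner_Integration.integrable_bound[OF integral_sinc2(1)])
         (auto simp: abs_mult intro!: mult_left_le_one_le that)
    have "char K t = (CLINT x|lborel. ((sinc x)\<^sup>2 / pi) *\<^sub>R iexp (t * x))"
      unfolding char_def K_def by (rule integral_density) auto
    also have "\<dots> = (CLINT x|lborel. (of_real (cos (t * x) * (sinc x)\<^sup>2) + \<i> * of_real (sin (t * x) * (sinc x)\<^sup>2)) / pi)"
      by (rule Bochner_Integration.integral_cong)
         (simp_all add: complex_eq_iff scaleR_conv_of_real Re_exp Im_exp del: of_real_power sinc_neg)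
    also have "\<dots> = (of_real (\<integral>x. cos (t * x) * (sinc x)\<^sup>2 \<partial>lborel) + \<i> * of_real (\<integral>x. sin (t * x) * (sinc x)\<^sup>2 \<partial>lborel)) / pi"
      using int[of cos] int[of sin]
      by (subst integral_divide_zero, subst Bochner_Integration.integral_add)
         (simp_all del: of_real_mult add: integrable_of_real)
    also have "\<dots> = 0" using integral_cos_sinc2[OF that]
      by (simp add: integral_odd)
    finally show ?thesis .
  qed
qed

text \<open>Dilation by \<open>2 / T\<close> moves the edge of the frequency band from 2 to
  \<open>T\<close> and an interval \<open>{-n..n}\<close> of mass above 3/4 to
  \<open>{-2n/T..2n/T}\<close>. Hence \<open>A = 2n\<close> serves all \<open>T\<close> at
  once.\<close>

lemma fejer_kernel_scaled:
  obtains A where "0 \<le> A"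
    "\<And>T. 0 < T \<Longrightarrow> \<exists>K. real_distribution K \<and> (\<forall>x. measure K {x} = 0) \<and> (\<forall>t. T \<le> \<bar>t\<bar> \<longrightarrow> char K t = 0)
       \<and> 3 / 4 \<le> measure K {- (A / T)..A / T}"
proof -
  obtain K where K: "real_distribution K" "\<And>x. measure K {x} = 0" "\<And>t. 2 \<le> \<bar>t\<bar> \<Longrightarrow> char K t = 0"
    using fejer_kernel by blast
  interpret K: real_distribution K by fact
  have "(\<lambda>n. measure K {- real n..real n}) \<longlonglongrightarrow> measure K (\<Union>n. {- real n..real n})"
    by (rule K.finite_Lim_measure_incseq) (auto simp: incseq_def)
  moreover have "(\<Union>n. {- real n..real n}) = UNIV"
    by (auto simp: abs_le_iff[symmetric] minus_le_iff intro: real_arch_simple)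
       (metis abs_le_iff minus_le_iff real_arch_simple)
  ultimately have "(\<lambda>n. measure K {- real n..real n}) \<longlonglongrightarrow> 1"
    using K.prob_space by simp
  then have "\<forall>\<^sub>F n in sequentially. 3 / 4 < measure K {- real n..real n}"
    by (rule order_tendstoD) simp
  then obtain n where n: "3 / 4 < measure K {- real n..real n}"
    by (auto simp: eventually_sequentially)
  show ?thesis
  proof (rule that[of "2 * real n"])
    fix T :: real assume T: "0 < T"
    let ?K = "distr K borel (\<lambda>z. 2 / T * z)"
    have "real_distribution ?K" by (rule K.real_distribution_distr) simp
    moreover have "measure ?K {x} = 0" for x
    proof -
      have "measure ?K {x} = measure K ((\<lambda>z. 2 / T * z) -` {x} \<inter> space K)"
        by (rule measure_distr) auto
      also have "(\<lambda>z. 2 / T * z) -` {x} \<inter> space K = {x * T / 2}" using T by (auto simp: field_simps)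
      finally show ?thesis using K(2) by simp
    qed
    moreover have "char ?K t = 0" if "T \<le> \<bar>t\<bar>" for t
    proof -
      have "char ?K t = char K (t * (2 / T))"
        unfolding char_def by (subst integral_distr) (auto simp: mult.assoc)
      also have "\<dots> = 0" using that T by (intro K(3)) (simp add: abs_mult field_simps)
      finally show ?thesis .
    qed
    moreover have "3 / 4 \<le> measure ?K {- (2 * real n / T)..2 * real n / T}"
    proof -
      have "measure ?K {- (2 * real n / T)..2 * real n / T} = measure K ((\<lambda>z. 2 / T * z) -` {- (2 * real n / T)..2 * real n / T} \<inter> space K)"
        by (rule measure_distr) auto
      also have "(\<lambda>z. 2 / T * z) -` {- (2 * real n / T)..2 * real n / T} \<inter> space K = {- real n..real n}"
        using T by (auto simp: field_simps)
      finally show ?thesis using n by simp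
    qed
    ultimately show "\<exists>K. real_distribution K \<and> (\<forall>x. measure K {x} = 0) \<and> (\<forall>t. T \<le> \<bar>t\<bar> \<longrightarrow> char K t = 0)
       \<and> 3 / 4 \<le> measure K {- (2 * real n / T)..2 * real n / T}"
      by blast
  qed simp
qed

section \<open>From an estimate of characteristic functions to the rate 1/sqrt n\<close>

lemma integrable_gaussian_weight:
  fixes b c :: real
  assumes "0 < b"
  shows "integrable lborel (\<lambda>u. (1 + c * u\<^sup>2) * exp (- (b * u\<^sup>2)))"
proof -
  define \<rho> where "\<rho> = sqrt (1 / (2 * b))"
  have \<rho>: "0 < \<rho>" "2 * \<rho>\<^sup>2 = 1 / b" using assms by (simp_all add: \<rho>_def)
  have e: "exp (- (b * u\<^sup>2)) = sqrt (2 * pi * \<rho>\<^sup>2) * normal_density 0 \<rho> u" for u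
    using \<rho> assms by (simp add: normal_density_def)
  have "integrable lborel (\<lambda>u. sqrt (2 * pi * \<rho>\<^sup>2) * (normal_density 0 \<rho> u * (u - 0) ^ 0)
      + c * sqrt (2 * pi * \<rho>\<^sup>2) * (normal_density 0 \<rho> u * (u - 0) ^ 2))"
    by (intro Bochner_Integration.integrable_add integrable_mult_right integrable_normal_moment \<rho>)
  then show ?thesis unfolding e by (simp add: algebra_simps)
qed

lemma cdf_std_normal_lipschitz:
  assumes "x \<le> y"
  shows "cdf std_normal_distribution y - cdf std_normal_distribution x \<le> 1 * (y - x)"
proof (cases "x = y")
  case False
  then have xy: "x < y" using assms by simp
  interpret G: real_distribution std_normal_distribution by (rule real_dist_normal_dist)
  have "emeasure std_normal_distribution {x<..y} = (\<integral>\<^sup>+u. ennreal (std_normal_density u) * indicator {x<..y} u \<partial>lborel)"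
    by (rule emeasure_density) auto
  also have "\<dots> \<le> (\<integral>\<^sup>+u. indicator {x<..y} u \<partial>lborel)"
  proof (intro nn_integral_mono)
    fix u :: real
    have "std_normal_density u \<le> 1 * 1"
    proof -
      have "1 \<le> sqrt (2 * pi)" using pi_gt3 by (simp add: real_le_rsqrt)
      then have "1 / sqrt (2 * pi) \<le> 1" by simp
      then show ?thesis unfolding std_normal_density_def by (intro mult_mono) auto
    qed
    then show "ennreal (std_normal_density u) * indicator {x<..y} u \<le> indicator {x<..y} u"
      by (auto simp: indicator_def)
  qed
  also have "\<dots> = ennreal (y - x)" using xy by simp
  finally have "ennreal (measure std_normal_distribution {x<..y}) \<le> ennreal (y - x)"
    by (simp add: G.emeasure_eq_measure)
  then have "measure std_normal_distribution {x<..y} \<le> y - x" using xy by simp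
  then show ?thesis using G.cdf_diff_eq[OF xy] by simp
qed simp

text \<open>In the frequency \<open>u = t * sqrt (s * n)\<close> of the normalised sum,
  \<open>|t| + n |t|^3\<close> becomes \<open>\<epsilon> |u| (1 + u^2 / s)\<close> with
  \<open>\<epsilon> = 1 / sqrt (s * n)\<close>. The factor \<open>|u|\<close> cancels the singular
  weight of Esseen's inequality and \<open>\<epsilon>\<close> is the rate; the rest is an integrable
  Gaussian weight independent of \<open>n\<close>.\<close>

theorem berry_esseen_of_char_estimate:
  fixes S :: "nat \<Rightarrow> 'w \<Rightarrow> real"
  assumes M: "prob_space M" and S [measurable]: "\<And>n. S n \<in> borel_measurable M"
    and c: "0 < s" "0 < \<delta>" "0 \<le> G" "0 < a"
    and est: "\<And>t n. \<bar>t\<bar> \<le> \<delta> \<Longrightarrow> cmod ((\<integral>\<omega>. iexp (t * S n \<omega>) \<partial>M) - complex_of_real (exp (- (real n * s * t\<^sup>2 / 2))))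
       \<le> G * (\<bar>t\<bar> + real n * \<bar>t\<bar> ^ 3) * exp (- (a * real n * t\<^sup>2))"
  shows "\<exists>C. \<forall>n\<ge>1. \<forall>x. \<bar>measure M {\<omega>\<in>space M. S n \<omega> / (sqrt s * sqrt (real n)) \<le> x}
            - measure std_normal_distribution {..x}\<bar> \<le> C / sqrt (real n)"
proof -
  interpret M: prob_space M by fact
  obtain A where A: "0 \<le> A" and kern: "\<And>T. 0 < T \<Longrightarrow> \<exists>K. real_distribution K \<and> (\<forall>x. measure K {x} = 0) \<and> (\<forall>t. T \<le> \<bar>t\<bar> \<longrightarrow> char K t = 0)
       \<and> 3 / 4 \<le> measure K {- (A / T)..A / T}"
    using fejer_kernel_scaled by blast
  define wt where "wt u = (1 + 1 / s * u\<^sup>2) * exp (- (a / s * u\<^sup>2))" for u :: real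
  define J where "J = (\<integral>u. wt u \<partial>lborel)"
  have wt: "integrable lborel wt" "\<And>u. 0 \<le> wt u"
    using c integrable_gaussian_weight[of "a / s" "1 / s"] by (auto simp: wt_def[abs_def])
  define C where "C = 2 * (G / sqrt s * J) / pi + 3 * 1 * (A / (\<delta> * sqrt s))"
  show ?thesis
  proof (intro exI[of _ C] allI impI)
    fix n :: nat and x :: real assume n: "1 \<le> n"
    define \<epsilon> where "\<epsilon> = 1 / (sqrt s * sqrt (real n))"
    have eps: "0 < \<epsilon>" "real n * \<epsilon>\<^sup>2 = 1 / s" using c n by (simp_all add: \<epsilon>_def power_divide power_mult_distrib)
    \<comment> \<open>\<open>|t| \<le> \<delta>\<close> means \<open>|u| \<le> T\<close>. As
      \<open>T\<close> is of order sqrt n, the smoothing error \<open>A / T\<close> has the right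
      order too.\<close>
    define T where "T = \<delta> / \<epsilon>"
    have T: "0 < T" using c eps by (simp add: T_def)
    obtain K where K: "real_distribution K" "\<And>x. measure K {x} = 0" "\<And>t. T \<le> \<bar>t\<bar> \<Longrightarrow> char K t = 0"
       "3 / 4 \<le> measure K {- (A / T)..A / T}" using kern[OF T] by blast
    define m where "m = distr M borel (\<lambda>\<omega>. \<epsilon> * S n \<omega>)"
    have m: "real_distribution m" unfolding m_def by (rule M.real_distribution_distr) simp
    have "\<bar>cdf m x - cdf std_normal_distribution x\<bar> \<le> 2 * (\<integral>u. (G * \<epsilon>) * wt u \<partial>lborel) / pi + 3 * 1 * (A / T)"
    proof (rule esseen_smoothing[OF m real_dist_normal_dist K(1,2) _ K(4) _ cdf_std_normal_lipschitz])
      show "char K t = 0" if "T < \<bar>t\<bar>" for t using K(3)[of t] that by simp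
      show "0 \<le> A / T" using A T by simp
      show "integrable lborel (\<lambda>u. (G * \<epsilon>) * wt u)" using wt(1) by simp
      show "0 \<le> (G * \<epsilon>) * wt t" for t using wt(2) c eps by simp
      show "cmod (char m u - char std_normal_distribution u) / \<bar>u\<bar> \<le> (G * \<epsilon>) * wt u" if u: "u \<noteq> 0" "\<bar>u\<bar> \<le> T" for u
      proof -
        define t where "t = u * \<epsilon>"
        have nt: "real n * t\<^sup>2 = u\<^sup>2 / s"
        proof -
          have "real n * t\<^sup>2 = u\<^sup>2 * (real n * \<epsilon>\<^sup>2)" by (simp add: t_def power_mult_distrib mult_ac)
          then show ?thesis by (simp add: eps(2))
        qed
        have td: "\<bar>t\<bar> \<le> \<delta>" using u(2) eps by (simp add: t_def T_def abs_mult field_simps)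
        have ch: "char m u = (\<integral>\<omega>. iexp (t * S n \<omega>) \<partial>M)"
          unfolding char_def m_def by (subst integral_distr) (auto simp: t_def mult_ac)
        have cn: "char std_normal_distribution u = complex_of_real (exp (- (real n * s * t\<^sup>2 / 2)))"
        proof -
          have "real n * s * t\<^sup>2 = s * (u\<^sup>2 / s)" unfolding nt[symmetric] by simp
          then show ?thesis using c by (simp add: char_std_normal_distribution)
        qed
        have ta: "\<bar>t\<bar> = \<bar>u\<bar> * \<epsilon>" using eps by (simp add: t_def abs_mult)
        have "real n * \<bar>t\<bar> ^ 3 = \<bar>t\<bar> * (real n * t\<^sup>2)" by (simp add: power3_eq_cube power2_eq_square)
        then have cube: "\<bar>t\<bar> + real n * \<bar>t\<bar> ^ 3 = \<bar>u\<bar> * \<epsilon> * (1 + 1 / s * u\<^sup>2)"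
          unfolding nt ta by (simp add: algebra_simps)
        have ex: "a * real n * t\<^sup>2 = a / s * u\<^sup>2" using nt by (simp add: mult.assoc)
        have "cmod (char m u - char std_normal_distribution u) \<le> G * (\<bar>u\<bar> * \<epsilon> * (1 + 1 / s * u\<^sup>2)) * exp (- (a / s * u\<^sup>2))"
          unfolding ch cn using est[OF td, of n] unfolding cube ex .
        also have "\<dots> = (G * \<epsilon>) * wt u * \<bar>u\<bar>" by (simp add: wt_def mult_ac)
        finally show ?thesis using u by (simp add: divide_le_eq)
      qed
    qed simp_all
    also have "\<dots> = C / sqrt (real n)"
      by (simp add: C_def J_def T_def \<epsilon>_def add_divide_distrib mult_ac)
    also have "cdf m x = measure M {\<omega>\<in>space M. S n \<omega> / (sqrt s * sqrt (real n)) \<le> x}"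
    proof -
      have "cdf m x = measure M ((\<lambda>\<omega>. \<epsilon> * S n \<omega>) -` {..x} \<inter> space M)"
        unfolding cdf_def m_def by (rule measure_distr) auto
      also have "(\<lambda>\<omega>. \<epsilon> * S n \<omega>) -` {..x} \<inter> space M = {\<omega>\<in>space M. S n \<omega> / (sqrt s * sqrt (real n)) \<le> x}"
        by (auto simp: \<epsilon>_def)
      finally show ?thesis .
    qed
    finally show "\<bar>measure M {\<omega>\<in>space M. S n \<omega> / (sqrt s * sqrt (real n)) \<le> x}
            - measure std_normal_distribution {..x}\<bar> \<le> C / sqrt (real n)"
      by (simp add: cdf_def)
  qed
qed

section \<open>Markov kernels on integrable functions\<close>

lemma power_le_one_plus_cube:
  fixes a :: real
  assumes "a \<ge> 0" "k \<le> 3"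
  shows "a ^ k \<le> 1 + a ^ 3"
proof (cases "a \<le> 1")
  case True
  have "a ^ k \<le> 1" using True assms by (simp add: power_le_one)
  then show ?thesis using assms by (smt (verit) zero_le_power)
next
  case False
  then have "a ^ k \<le> a ^ 3" using assms by (intro power_increasing) auto
  then show ?thesis by simp
qed

locale markov_kernel =
  fixes E :: "'e measure" and Q :: "'e \<Rightarrow> 'e measure"
  assumes Q_kernel: "Q \<in> E \<rightarrow>\<^sub>M prob_algebra E"
begin

lemma Q_subprob [measurable]: "Q \<in> E \<rightarrow>\<^sub>M subprob_algebra E"
  using Q_kernel by (rule measurable_prob_algebraD)

lemma prob_space_Q: "x \<in> space E \<Longrightarrow> prob_space (Q x)"
  and sets_Q: "x \<in> space E \<Longrightarrow> sets (Q x) = sets E"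
  using measurable_space[OF Q_kernel] by (auto simp: space_prob_algebra)

lemma space_Q: "x \<in> space E \<Longrightarrow> space (Q x) = space E"
  by (rule sets_eq_imp_space_eq) (rule sets_Q)

lemma meas_Q: "x \<in> space E \<Longrightarrow> f \<in> borel_measurable (Q x) \<longleftrightarrow> f \<in> borel_measurable E"
  using sets_Q[of x] by (simp cong: measurable_cong_sets)

lemma integral_Q_measurable [measurable]:
  fixes f :: "'e \<Rightarrow> 'b::{banach, second_countable_topology}"
  assumes "f \<in> borel_measurable E"
  shows "(\<lambda>x. \<integral>y. f y \<partial>Q x) \<in> borel_measurable E"
  using measurable_compose[OF Q_subprob integral_measurable_subprob_algebra[OF assms]] .

lemma kop_measurable [measurable]:
  "f \<in> borel_measurable E \<Longrightarrow> kop Q f \<in> borel_measurable E"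
  unfolding kop_def[abs_def] by (rule integral_Q_measurable)

end

locale stationary_kernel = markov_kernel E Q for E :: "'e measure" and Q +
  fixes \<nu> :: "'e measure"
  assumes nu_prob: "prob_space \<nu>" and nu_sets: "sets \<nu> = sets E"
    and nu_inv: "bind \<nu> Q = \<nu>"

sublocale stationary_kernel \<subseteq> prob_space \<nu> by (rule nu_prob)

context stationary_kernel
begin

lemma space_nu [simp]: "space \<nu> = space E"
  using nu_sets by (rule sets_eq_imp_space_eq)

lemma meas_nu: "f \<in> borel_measurable \<nu> \<longleftrightarrow> f \<in> borel_measurable E"
  using nu_sets by (simp cong: measurable_cong_sets)

lemma nn_integral_Q:
  assumes "u \<in> borel_measurable E"
  shows "(\<integral>\<^sup>+x. \<integral>\<^sup>+y. u y \<partial>Q x \<partial>\<nu>) = (\<integral>\<^sup>+x. u x \<partial>\<nu>)"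
proof -
  have "Q \<in> \<nu> \<rightarrow>\<^sub>M subprob_algebra E" using Q_subprob nu_sets by (simp cong: measurable_cong_sets)
  from nn_integral_bind[OF assms this] show ?thesis by (simp add: nu_inv)
qed

lemma integrable_nu_meas:
  fixes f :: "'e \<Rightarrow> 'b::{banach, second_countable_topology}"
  shows "integrable \<nu> f \<Longrightarrow> f \<in> borel_measurable E"
  using borel_measurable_integrable meas_nu by auto

text \<open>Invariance makes the integral over \<open>\<nu>\<close> of \<open>Q |f|\<close> equal to
  that of \<open>|f|\<close>, so \<open>Q |f|\<close> is finite almost everywhere. Identities for
  \<open>kop Q\<close> on integrable functions can only be expected off such a null set.\<close>

lemma AE_integrable_Q:
  fixes f :: "'e \<Rightarrow> 'b::{banach, second_countable_topology}"
  assumes "integrable \<nu> f"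
  shows "AE x in \<nu>. integrable (Q x) f"
proof -
  have f[measurable]: "f \<in> borel_measurable E" using assms by (rule integrable_nu_meas)
  have "(\<integral>\<^sup>+x. \<integral>\<^sup>+y. norm (f y) \<partial>Q x \<partial>\<nu>) = (\<integral>\<^sup>+x. norm (f x) \<partial>\<nu>)"
    by (rule nn_integral_Q) simp
  also have "\<dots> < \<infinity>" using assms by (simp add: integrable_iff_bounded)
  finally have fin: "(\<integral>\<^sup>+x. \<integral>\<^sup>+y. norm (f y) \<partial>Q x \<partial>\<nu>) \<noteq> \<infinity>" by simp
  have "(\<lambda>x. \<integral>\<^sup>+y. norm (f y) \<partial>Q x) \<in> borel_measurable \<nu>"
    unfolding meas_nu by (rule measurable_compose[OF Q_subprob nn_integral_measurable_subprob_algebra]) simp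
  from nn_integral_PInf_AE[OF this fin]
  have "AE x in \<nu>. (\<integral>\<^sup>+y. norm (f y) \<partial>Q x) \<noteq> \<infinity>" .
  moreover have "AE x in \<nu>. x \<in> space E" by (metis AE_space space_nu)
  ultimately show ?thesis
    by eventually_elim (auto simp: integrable_iff_bounded meas_Q top.not_eq_extremum)
qed

lemma integral_Q_norm:
  fixes f :: "'e \<Rightarrow> 'b::{banach, second_countable_topology}"
  assumes "integrable \<nu> f"
  shows "integrable \<nu> (\<lambda>x. \<integral>y. norm (f y) \<partial>Q x)" "(\<integral>x. \<integral>y. norm (f y) \<partial>Q x \<partial>\<nu>) = (\<integral>x. norm (f x) \<partial>\<nu>)"
proof -
  have f[measurable]: "f \<in> borel_measurable E" using assms by (rule integrable_nu_meas)
  have m: "(\<lambda>x. \<integral>y. norm (f y) \<partial>Q x) \<in> borel_measurable \<nu>" unfolding meas_nu by measurable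
  have "(\<integral>\<^sup>+x. ennreal (\<integral>y. norm (f y) \<partial>Q x) \<partial>\<nu>) = (\<integral>\<^sup>+x. \<integral>\<^sup>+y. norm (f y) \<partial>Q x \<partial>\<nu>)"
    using AE_integrable_Q[OF assms]
    by (intro nn_integral_cong_AE, elim eventually_mono) (simp add: nn_integral_eq_integral)
  also have "\<dots> = (\<integral>\<^sup>+x. norm (f x) \<partial>\<nu>)" by (rule nn_integral_Q) simp
  also have "\<dots> = ennreal (\<integral>x. norm (f x) \<partial>\<nu>)" using assms by (simp add: nn_integral_eq_integral)
  finally have "has_bochner_integral \<nu> (\<lambda>x. \<integral>y. norm (f y) \<partial>Q x) (\<integral>x. norm (f x) \<partial>\<nu>)"
    using m by (intro has_bochner_integral_nn_integral) auto
  then show "integrable \<nu> (\<lambda>x. \<integral>y. norm (f y) \<partial>Q x)" "(\<integral>x. \<integral>y. norm (f y) \<partial>Q x \<partial>\<nu>) = (\<integral>x. norm (f x) \<partial>\<nu>)"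
    by (auto simp: has_bochner_integral_iff)
qed

lemma integral_Q:
  fixes f :: "'e \<Rightarrow> 'b::{banach, second_countable_topology}"
  assumes "integrable \<nu> f"
  shows "integrable \<nu> (\<lambda>x. \<integral>y. f y \<partial>Q x)"
    and "(\<integral>x. norm (\<integral>y. f y \<partial>Q x) \<partial>\<nu>) \<le> (\<integral>x. norm (f x) \<partial>\<nu>)"
proof -
  have f[measurable]: "f \<in> borel_measurable E" using assms by (rule integrable_nu_meas)
  show i: "integrable \<nu> (\<lambda>x. \<integral>y. f y \<partial>Q x)"
    by (rule Bochner_Integration.integrable_bound[OF integral_Q_norm(1)[OF assms]])
       (auto simp: meas_nu intro!: order_trans[OF integral_norm_bound abs_ge_self])
  have "(\<integral>x. norm (\<integral>y. f y \<partial>Q x) \<partial>\<nu>) \<le> (\<integral>x. \<integral>y. norm (f y) \<partial>Q x \<partial>\<nu>)"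
    by (rule integral_mono) (use i integral_Q_norm(1)[OF assms] in auto)
  then show "(\<integral>x. norm (\<integral>y. f y \<partial>Q x) \<partial>\<nu>) \<le> (\<integral>x. norm (f x) \<partial>\<nu>)"
    by (simp add: integral_Q_norm(2)[OF assms])
qed

text \<open>Invariance is known for norms, hence for nonnegative functions; \<open>f\<close> is the
  difference of the nonnegative functions \<open>norm f\<close> and
  \<open>norm f - f\<close>.\<close>

lemma integral_integral_Q_real:
  fixes f :: "'e \<Rightarrow> real"
  assumes f: "integrable \<nu> f"
  shows "(\<integral>x. \<integral>y. f y \<partial>Q x \<partial>\<nu>) = (\<integral>x. f x \<partial>\<nu>)"
proof -
  have g: "integrable \<nu> (\<lambda>x. norm (f x) - f x)" using f by simp
  have p: "integrable \<nu> (\<lambda>x. norm (f x))" using f by simp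
  have "(\<integral>x. \<integral>y. norm (norm (f y) - f y) \<partial>Q x \<partial>\<nu>) = (\<integral>x. norm (norm (f x) - f x) \<partial>\<nu>)"
    by (rule integral_Q_norm(2)[OF g])
  then have "(\<integral>x. \<integral>y. (norm (f y) - f y) \<partial>Q x \<partial>\<nu>) = (\<integral>x. norm (f x) - f x \<partial>\<nu>)" by simp
  moreover have "(\<integral>x. \<integral>y. (norm (f y) - f y) \<partial>Q x \<partial>\<nu>) = (\<integral>x. (\<integral>y. norm (f y) \<partial>Q x) - (\<integral>y. f y \<partial>Q x) \<partial>\<nu>)"
    using AE_integrable_Q[OF f] f integrable_nu_meas[OF f] integrable_nu_meas[OF g]
    by (intro integral_cong_AE) (auto simp: meas_nu elim!: eventually_mono)
  ultimately show ?thesis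
    using f integral_Q(1)[OF f] integral_Q_norm[OF f] by simp
qed

lemma integral_kop:
  assumes f: "integrable \<nu> f"
  shows "integrable \<nu> (kop Q f)" "(\<integral>x. kop Q f x \<partial>\<nu>) = (\<integral>x. f x \<partial>\<nu>)"
    "(\<integral>x. cmod (kop Q f x) \<partial>\<nu>) \<le> (\<integral>x. cmod (f x) \<partial>\<nu>)"
proof -
  show i: "integrable \<nu> (kop Q f)" "(\<integral>x. cmod (kop Q f x) \<partial>\<nu>) \<le> (\<integral>x. cmod (f x) \<partial>\<nu>)"
    using integral_Q[OF f] by (simp_all add: kop_def[abs_def])
  have m[measurable]: "f \<in> borel_measurable E" using f by (rule integrable_nu_meas)
  have "(\<integral>x. Re (kop Q f x) \<partial>\<nu>) = (\<integral>x. \<integral>y. Re (f y) \<partial>Q x \<partial>\<nu>)"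
    using AE_integrable_Q[OF f]
    by (intro integral_cong_AE) (auto simp: meas_nu kop_def elim!: eventually_mono)
  also have "\<dots> = (\<integral>x. Re (f x) \<partial>\<nu>)" using f by (intro integral_integral_Q_real) auto
  finally have 1: "(\<integral>x. Re (kop Q f x) \<partial>\<nu>) = (\<integral>x. Re (f x) \<partial>\<nu>)" .
  have "(\<integral>x. Im (kop Q f x) \<partial>\<nu>) = (\<integral>x. \<integral>y. Im (f y) \<partial>Q x \<partial>\<nu>)"
    using AE_integrable_Q[OF f]
    by (intro integral_cong_AE) (auto simp: meas_nu kop_def elim!: eventually_mono)
  also have "\<dots> = (\<integral>x. Im (f x) \<partial>\<nu>)" using f by (intro integral_integral_Q_real) auto
  finally show "(\<integral>x. kop Q f x \<partial>\<nu>) = (\<integral>x. f x \<partial>\<nu>)"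
    using 1 f i(1) by (simp add: complex_eq_iff)
qed

lemma kop_add_AE:
  assumes "integrable \<nu> f" "integrable \<nu> g"
  shows "AE x in \<nu>. kop Q (\<lambda>y. f y + c * g y) x = kop Q f x + c * kop Q g x"
  using AE_integrable_Q[OF assms(1)] AE_integrable_Q[OF assms(2)]
  by eventually_elim (simp add: kop_def)

text \<open>A \<open>\<nu>\<close>-null set is null for \<open>Q x\<close> at almost every
  \<open>x\<close>, since \<open>\<nu>\<close> is the mixture of the \<open>Q x\<close>. Almost sure
  identities may therefore be inserted under the kernel.\<close>

lemma AE_AE_Q:
  assumes [measurable]: "Measurable.pred E P" and "AE x in \<nu>. P x"
  shows "AE x in \<nu>. AE y in Q x. P y"
proof -
  have "Q \<in> \<nu> \<rightarrow>\<^sub>M subprob_algebra E" using Q_subprob nu_sets by (simp cong: measurable_cong_sets)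
  from AE_bind[OF this assms(1)] assms(2) show ?thesis unfolding nu_inv by blast
qed

lemma integral_Q_cong_AE:
  fixes f g :: "'e \<Rightarrow> 'b::{banach, second_countable_topology}"
  assumes [measurable]: "f \<in> borel_measurable E" "g \<in> borel_measurable E" and "AE x in \<nu>. f x = g x"
  shows "AE x in \<nu>. (\<integral>y. f y \<partial>Q x) = (\<integral>y. g y \<partial>Q x)"
proof -
  have "AE x in \<nu>. AE y in Q x. f y = g y" by (rule AE_AE_Q) (use assms in auto)
  moreover have "AE x in \<nu>. x \<in> space E" by (metis AE_space space_nu)
  ultimately show ?thesis
    by eventually_elim (auto intro!: integral_cong_AE simp: meas_Q)
qed

lemma kop_cong_AE:
  assumes "f \<in> borel_measurable E" "g \<in> borel_measurable E" "AE x in \<nu>. f x = g x"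
  shows "AE x in \<nu>. kop Q f x = kop Q g x"
  unfolding kop_def by (rule integral_Q_cong_AE) fact+

lemma mult_integrable:
  assumes "integrable \<nu> f" "c \<in> borel_measurable E" "\<And>x. cmod (c x) \<le> 1"
  shows "integrable \<nu> (\<lambda>x. c x * f x)" "(\<integral>x. cmod (c x * f x) \<partial>\<nu>) \<le> (\<integral>x. cmod (f x) \<partial>\<nu>)"
proof -
  have [measurable]: "f \<in> borel_measurable E" using assms(1) by (rule integrable_nu_meas)
  show i: "integrable \<nu> (\<lambda>x. c x * f x)"
    by (rule Bochner_Integration.integrable_bound[OF assms(1)])
       (use assms in \<open>auto simp: meas_nu norm_mult intro!: mult_left_le_one_le\<close>)
  show "(\<integral>x. cmod (c x * f x) \<partial>\<nu>) \<le> (\<integral>x. cmod (f x) \<partial>\<nu>)"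
    by (rule integral_mono[OF integrable_norm[OF i] integrable_norm[OF assms(1)]])
       (use assms in \<open>auto simp: norm_mult intro!: mult_left_le_one_le\<close>)
qed

lemma integrable_power_of_cube:
  fixes f :: "'e \<Rightarrow> real"
  assumes [measurable]: "f \<in> borel_measurable E" and "integrable \<nu> (\<lambda>x. \<bar>f x\<bar> ^ 3)" "k \<le> 3"
  shows "integrable \<nu> (\<lambda>x. f x ^ k)"
proof (rule Bochner_Integration.integrable_bound)
  show "integrable \<nu> (\<lambda>x. 1 + \<bar>f x\<bar> ^ 3)" using assms by simp
  show "AE x in \<nu>. norm (f x ^ k) \<le> norm (1 + \<bar>f x\<bar> ^ 3)"
    using power_le_one_plus_cube[of "\<bar>f x\<bar>" k for x] assms(3) by (auto simp: power_abs)
qed (simp add: meas_nu)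

text \<open>One form for two operators: phases \<open>exp (-i t g)\<close> and
  \<open>exp (i t h)\<close> give the transition weighted by the martingale increment
  \<open>h y - g x\<close>, while \<open>1\<close> and \<open>exp (i t \<xi>)\<close> give
  \<open>kop_t\<close>. The first is conjugate to the second.\<close>

definition twist :: "('e \<Rightarrow> complex) \<Rightarrow> ('e \<Rightarrow> complex) \<Rightarrow> ('e \<Rightarrow> complex) \<Rightarrow> 'e \<Rightarrow> complex" where
  "twist a b f x = a x * kop Q (\<lambda>y. b y * f y) x"

end

section \<open>Iterates of a kernel weighted by two factors of modulus at most 1\<close>

locale twisted_kernel = stationary_kernel +
  fixes a b :: "'a \<Rightarrow> complex"
  assumes a_meas [measurable]: "a \<in> borel_measurable E" and b_meas [measurable]: "b \<in> borel_measurable E"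
    and a_le: "\<And>x. cmod (a x) \<le> 1" and b_le: "\<And>x. cmod (b x) \<le> 1"
begin

abbreviation "T \<equiv> twist a b"

lemma twist_measurable [measurable]: "f \<in> borel_measurable E \<Longrightarrow> T f \<in> borel_measurable E"
  unfolding twist_def[abs_def] by measurable

lemma twist_integrable:
  assumes "integrable \<nu> f"
  shows "integrable \<nu> (T f)" "(\<integral>x. cmod (T f x) \<partial>\<nu>) \<le> (\<integral>x. cmod (f x) \<partial>\<nu>)"
proof -
  note bf = mult_integrable[OF assms b_meas b_le]
  note k = integral_kop[OF bf(1)]
  note ak = mult_integrable[OF k(1) a_meas a_le]
  show "integrable \<nu> (T f)" using ak(1) by (simp add: twist_def[abs_def])
  show "(\<integral>x. cmod (T f x) \<partial>\<nu>) \<le> (\<integral>x. cmod (f x) \<partial>\<nu>)"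
    using ak(2) k(3) bf(2) by (simp add: twist_def)
qed

lemma twist_add_AE:
  assumes "integrable \<nu> f" "integrable \<nu> g"
  shows "AE x in \<nu>. T (\<lambda>y. f y + c * g y) x = T f x + c * T g x"
  using kop_add_AE[OF mult_integrable(1)[OF assms(1) b_meas b_le] mult_integrable(1)[OF assms(2) b_meas b_le], of c]
  by eventually_elim (simp add: twist_def algebra_simps)

lemma twist_cong_AE:
  assumes [measurable]: "f \<in> borel_measurable E" "g \<in> borel_measurable E" and ae: "AE x in \<nu>. f x = g x"
  shows "AE x in \<nu>. T f x = T g x"
proof -
  have "AE x in \<nu>. kop Q (\<lambda>y. b y * f y) x = kop Q (\<lambda>y. b y * g y) x"
    by (rule kop_cong_AE) (use ae in \<open>auto elim: eventually_mono\<close>)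
  then show ?thesis by eventually_elim (simp add: twist_def)
qed

lemma twist_pow_integrable:
  assumes "integrable \<nu> f"
  shows "integrable \<nu> ((T ^^ n) f) \<and> (\<integral>x. cmod ((T ^^ n) f x) \<partial>\<nu>) \<le> (\<integral>x. cmod (f x) \<partial>\<nu>)"
proof (induction n)
  case (Suc n)
  then show ?case using twist_integrable[of "(T ^^ n) f"] by auto
qed (use assms in auto)

text \<open>The operator is additive only off a null set, and that set must be carried through every
  further application of the kernel; stationarity keeps it null.\<close>

lemma twist_pow_add_AE:
  assumes "integrable \<nu> f" "integrable \<nu> g"
  shows "AE x in \<nu>. (T ^^ n) (\<lambda>y. f y + c * g y) x = (T ^^ n) f x + c * (T ^^ n) g x"
proof (induction n)
  case (Suc n)
  have fn: "integrable \<nu> ((T ^^ n) f)" and gn: "integrable \<nu> ((T ^^ n) g)"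
    using assms twist_pow_integrable by blast+
  have fg: "integrable \<nu> ((T ^^ n) (\<lambda>y. f y + c * g y))"
    using assms twist_pow_integrable[of "\<lambda>y. f y + c * g y" n] by simp
  have "AE x in \<nu>. T ((T ^^ n) (\<lambda>y. f y + c * g y)) x = T (\<lambda>y. (T ^^ n) f y + c * (T ^^ n) g y) x"
    using Suc.IH fn gn fg by (intro twist_cong_AE) (auto intro!: integrable_nu_meas)
  then show ?case using twist_add_AE[OF fn gn, of c] by eventually_elim simp
qed simp

text \<open>For the stationary chain this is the expectation of \<open>f(X_n)\<close> times the
  product of the weights \<open>a(X_{k-1}) b(X_k)\<close> for k from 1 to n. With weights 1 it
  reduces to the mean of \<open>f\<close>.\<close>

definition state :: "nat \<Rightarrow> ('a \<Rightarrow> complex) \<Rightarrow> complex" where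
  "state n f = (\<integral>x. (T ^^ n) f x \<partial>\<nu>)"

lemma state_add:
  assumes "integrable \<nu> f" "integrable \<nu> g"
  shows "state n (\<lambda>x. f x + c * g x) = state n f + c * state n g"
proof -
  have fn: "integrable \<nu> ((T ^^ n) f)" and gn: "integrable \<nu> ((T ^^ n) g)"
    using assms twist_pow_integrable by blast+
  have fg: "integrable \<nu> ((T ^^ n) (\<lambda>y. f y + c * g y))"
    using assms twist_pow_integrable[of "\<lambda>y. f y + c * g y" n] by simp
  have "state n (\<lambda>x. f x + c * g x) = (\<integral>x. (T ^^ n) f x + c * (T ^^ n) g x \<partial>\<nu>)"
    unfolding state_def using fn gn fg twist_pow_add_AE[OF assms]
    by (intro integral_cong_AE) auto
  then show ?thesis using fn gn by (simp add: state_def)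
qed

lemma state_affine:
  assumes "integrable \<nu> f"
  shows "state n (\<lambda>x. r + c * f x) = r * state n (\<lambda>_. 1) + c * state n f"
proof -
  have z: "state n (\<lambda>_. 0) = 0" using state_add[of "\<lambda>_. 0" "\<lambda>_. 0" n 1] by simp
  have "state n (\<lambda>_. r) = r * state n (\<lambda>_. 1)" using state_add[of "\<lambda>_. 0" "\<lambda>_. 1" n r] z by simp
  then show ?thesis using state_add[of "\<lambda>_. r" f n c] assms by simp
qed

lemma cmod_state_le: "integrable \<nu> f \<Longrightarrow> cmod (state n f) \<le> (\<integral>x. cmod (f x) \<partial>\<nu>)"
  unfolding state_def using twist_pow_integrable[of f n]
  by (auto intro: order_trans[OF integral_norm_bound])

lemma state_Suc: "state (Suc n) f = state n (T f)"
  by (simp add: state_def funpow_swap1)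

lemma state_diff_le:
  assumes f: "integrable \<nu> f" and g: "integrable \<nu> g" and u: "integrable \<nu> u"
    and le: "AE x in \<nu>. cmod (f x - g x) \<le> u x"
  shows "cmod (state n f - state n g) \<le> (\<integral>x. u x \<partial>\<nu>)"
proof -
  have "state n f - state n g = state n (\<lambda>x. f x + (-1) * g x)"
    using state_add[OF f g, of n "-1"] by simp
  also have "cmod \<dots> \<le> (\<integral>x. cmod (f x - g x) \<partial>\<nu>)"
    using cmod_state_le[of "\<lambda>x. f x + (-1) * g x"] f g by simp
  also have "\<dots> \<le> (\<integral>x. u x \<partial>\<nu>)"
    using f g u le by (intro integral_mono_AE) auto
  finally show ?thesis .
qed

end

section \<open>The stationary characteristic function\<close>

text \<open>With \<open>F\<close> the \<open>L\<^sup>3\<^sup>/\<^sup>2\<close> norm of \<open>b\<close>, integrating this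
  gives \<open>F (1 + \<integral> a\<^sup>3)\<close>, which stands in for Hoelder's inequality.\<close>

lemma young_three_halves:
  fixes a b F :: real
  assumes "a \<ge> 0" "b \<ge> 0" "F > 0"
  shows "a * b \<le> F * a ^ 3 + b powr (3/2) / sqrt F"
proof (cases "b \<le> F * a\<^sup>2")
  case True
  have "a * b \<le> a * (F * a\<^sup>2)" using True assms by (intro mult_left_mono) auto
  also have "\<dots> = F * a ^ 3" by (simp add: power2_eq_square power3_eq_cube)
  also have "\<dots> \<le> F * a ^ 3 + b powr (3/2) / sqrt F" using assms by simp
  finally show ?thesis .
next
  case False
  then have b: "b > 0" using assms by (smt (verit) zero_le_mult_iff zero_le_power2)
  have "sqrt (F * a\<^sup>2) \<le> sqrt b" using False by simp
  then have "sqrt F * a \<le> sqrt b" using assms by (simp add: real_sqrt_mult)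
  then have "a \<le> sqrt b / sqrt F" using assms by (simp add: field_simps)
  then have "a * b \<le> sqrt b / sqrt F * b" using b by (intro mult_right_mono) auto
  also have "sqrt b * b = b powr (3/2)"
    using powr_mult_base[of b "1/2"] b by (simp add: powr_half_sqrt mult.commute)
  then have "sqrt b / sqrt F * b = b powr (3/2) / sqrt F" by simp
  also have "\<dots> \<le> F * a ^ 3 + b powr (3/2) / sqrt F" using assms by simp
  finally show ?thesis .
qed

lemma abs_diff_cubed_le:
  fixes a b :: real
  shows "\<bar>a - b\<bar> ^ 3 \<le> 4 * (\<bar>a\<bar> ^ 3 + \<bar>b\<bar> ^ 3)"
proof -
  have "\<bar>a - b\<bar> ^ 3 \<le> (\<bar>a\<bar> + \<bar>b\<bar>) ^ 3" by (intro power_mono) auto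
  also have "4 * (\<bar>a\<bar> ^ 3 + \<bar>b\<bar> ^ 3) - (\<bar>a\<bar> + \<bar>b\<bar>) ^ 3 = 3 * ((\<bar>a\<bar> + \<bar>b\<bar>) * (\<bar>a\<bar> - \<bar>b\<bar>)\<^sup>2)"
    by (simp add: power2_eq_square power3_eq_cube algebra_simps)
  then have "(\<bar>a\<bar> + \<bar>b\<bar>) ^ 3 \<le> 4 * (\<bar>a\<bar> ^ 3 + \<bar>b\<bar> ^ 3)"
    by (smt (verit) mult_nonneg_nonneg zero_le_power2 abs_ge_zero)
  finally show ?thesis .
qed

lemma cmod_iexp_minus_one_le: "cmod (iexp u - 1) \<le> \<bar>u\<bar>"
  using iexp_approx1[of u 0] by simp

lemma iexp_taylor2: "cmod (iexp u - (1 + \<i> * u - of_real (u\<^sup>2) / 2)) \<le> \<bar>u\<bar> ^ 3 / 6"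
proof -
  have "(\<Sum>k\<le>2. (\<i> * u)^k / fact k) = 1 + \<i> * u - of_real (u\<^sup>2) / 2"
    by (simp add: numeral_2_eq_2 power_mult_distrib)
  moreover have "fact (Suc 2) = (6 :: real)" by (simp add: eval_nat_numeral)
  ultimately show ?thesis using iexp_approx1[of u 2] by (simp only: of_nat_numeral Suc_numeral) simp
qed

lemma norm_integral_le_integral:
  fixes f :: "'a \<Rightarrow> 'b::{banach, second_countable_topology}"
  assumes "integrable M f" "integrable M g" "\<And>x. x \<in> space M \<Longrightarrow> norm (f x) \<le> g x"
  shows "norm (integral\<^sup>L M f) \<le> integral\<^sup>L M g"
  using assms by (intro order_trans[OF integral_norm_bound] integral_mono) auto

text \<open>With \<open>g = Q h\<close> almost everywhere, the sum of \<open>\<xi>(X_k)\<close> is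
  the martingale with increments \<open>h(X_k) - g(X_{k-1})\<close> plus the boundary term
  \<open>g(X_0) - g(X_n)\<close>. The conditional variance of an increment is
  \<open>s2 + \<psi>\<close>. The splitting of \<open>\<xi>\<close> is demanded pointwise, because
  it is used to conjugate operators as exact functions.\<close>

locale coboundary_kernel = stationary_kernel +
  fixes \<xi> h g :: "'a \<Rightarrow> real" and s2 :: real and \<psi> :: "'a \<Rightarrow> complex"
  assumes h_meas [measurable]: "h \<in> borel_measurable E" and g_meas [measurable]: "g \<in> borel_measurable E"
    and xi: "\<And>x. \<xi> x = h x - g x"
    and h3: "integrable \<nu> (\<lambda>x. \<bar>h x\<bar> ^ 3)" and g3: "integrable \<nu> (\<lambda>x. \<bar>g x\<bar> ^ 3)"
    and Qh: "AE x in \<nu>. (\<integral>y. h y \<partial>Q x) = g x"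
    and psi_meas [measurable]: "\<psi> \<in> borel_measurable E"
    and psi: "AE x in \<nu>. \<psi> x = of_real ((\<integral>y. (h y)\<^sup>2 \<partial>Q x) - (g x)\<^sup>2 - s2)"
    and psi_int: "\<And>p. integrable \<nu> (\<lambda>x. cmod ((kop Q ^^ p) \<psi> x) powr (3/2))"
    and psi_summable: "summable (\<lambda>p. (\<integral>x. cmod ((kop Q ^^ p) \<psi> x) powr (3/2) \<partial>\<nu>) powr (2/3))"
    and psi_mean: "(\<integral>x. \<psi> x \<partial>\<nu>) = 0"
    and s2_nonneg: "0 \<le> s2"
begin

lemma int_h: "integrable \<nu> h" "integrable \<nu> (\<lambda>x. (h x)\<^sup>2)" and int_g: "integrable \<nu> g"
  using integrable_power_of_cube[OF h_meas h3, of 1] integrable_power_of_cube[OF h_meas h3, of 2]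
    integrable_power_of_cube[OF g_meas g3, of 1] by auto

definition m3 :: real where "m3 = (\<integral>x. \<bar>h x\<bar> ^ 3 \<partial>\<nu>) + (\<integral>x. \<bar>g x\<bar> ^ 3 \<partial>\<nu>)"

lemma m3_nonneg: "0 \<le> m3" unfolding m3_def by simp

text \<open>Up to the factor 4 of \<open>abs_diff_cubed_le\<close>, a bound for the conditional
  third absolute moment of the increment \<open>h y - g x\<close> given \<open>x\<close>.\<close>

definition cube :: "'a \<Rightarrow> real" where "cube x = (\<integral>y. \<bar>h y\<bar> ^ 3 \<partial>Q x) + \<bar>g x\<bar> ^ 3"

lemma cube: "integrable \<nu> cube" "(\<integral>x. cube x \<partial>\<nu>) = m3"
  using integral_Q(1)[OF h3] integral_integral_Q_real[OF h3] g3
  by (auto simp: cube_def[abs_def] m3_def)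

abbreviation psip :: "nat \<Rightarrow> 'a \<Rightarrow> complex" where "psip p \<equiv> (kop Q ^^ p) \<psi>"

lemma psip_meas [measurable]: "psip p \<in> borel_measurable E"
  by (induction p) auto

lemma psip_int: "integrable \<nu> (psip p)"
proof (rule Bochner_Integration.integrable_bound)
  show "integrable \<nu> (\<lambda>x. 1 + cmod (psip p x) powr (3/2))" using psi_int[of p] by simp
  have "a \<le> 1 + a powr (3/2)" if "0 \<le> a" for a :: real
  proof (cases "a \<le> 1")
    case False
    then have "a powr 1 \<le> a powr (3/2)" by (intro powr_mono) auto
    then show ?thesis using False by simp
  qed (use that in \<open>smt (verit) powr_ge_zero\<close>)
  then show "AE x in \<nu>. norm (psip p x) \<le> norm (1 + cmod (psip p x) powr (3/2))" by auto
qed (simp add: meas_nu)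

lemma psip_mean: "(\<integral>x. psip p x \<partial>\<nu>) = 0"
  by (induction p) (use psi_mean integral_kop(2)[OF psip_int] in auto)

text \<open>The summand \<open>(1/2)\<^sup>p\<close> only keeps \<open>F p\<close> positive.\<close>

definition F :: "nat \<Rightarrow> real" where
  "F p = (\<integral>x. cmod (psip p x) powr (3/2) \<partial>\<nu>) powr (2/3) + (1/2) ^ p"

lemma F_pos: "0 < F p" unfolding F_def by (intro add_nonneg_pos) auto

lemma F_summable: "summable F"
  unfolding F_def[abs_def] by (intro summable_add psi_summable summable_geometric) simp

text \<open>With \<open>F p\<close> at least the 2/3-th power of the integral, both terms of
  \<open>young_three_halves\<close> taken with weight \<open>F p\<close> become multiples of
  \<open>F p\<close> after integration, and these are summable.\<close>

lemma F_bound: "(\<integral>x. cmod (psip p x) powr (3/2) \<partial>\<nu>) / sqrt (F p) \<le> F p"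
proof -
  define I where "I = (\<integral>x. cmod (psip p x) powr (3/2) \<partial>\<nu>)"
  have I: "0 \<le> I" unfolding I_def by simp
  have "I = (I powr (2/3)) powr (3/2)" using I by (simp add: powr_powr)
  also have "\<dots> \<le> F p powr (3/2)" unfolding F_def I_def by (intro powr_mono2) auto
  also have "\<dots> = F p * sqrt (F p)"
    using powr_mult_base[of "F p" "1/2"] F_pos[of p] by (simp add: powr_half_sqrt)
  finally show ?thesis using F_pos[of p] by (simp add: I_def field_simps)
qed

context
  fixes t :: real
begin

abbreviation "gphase \<equiv> \<lambda>x. iexp (- (t * g x))"
abbreviation "hphase \<equiv> \<lambda>x. iexp (t * h x)"

interpretation tw: twisted_kernel E Q \<nu> gphase hphase
  by unfold_locales (auto simp del: of_real_mult of_real_minus)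

lemma twist_eq: "tw.T f x = (\<integral>y. iexp (t * (h y - g x)) * f y \<partial>Q x)"
proof -
  have "tw.T f x = (\<integral>y. gphase x * (hphase y * f y) \<partial>Q x)" unfolding twist_def kop_def by simp
  also have "\<dots> = (\<integral>y. iexp (t * (h y - g x)) * f y \<partial>Q x)"
  proof (rule Bochner_Integration.integral_cong)
    have "gphase x * hphase y = iexp (t * (h y - g x))" for y
      by (simp add: exp_add[symmetric] algebra_simps)
    then show "gphase x * (hphase y * f y) = iexp (t * (h y - g x)) * f y" for y
      unfolding mult.assoc[symmetric] by simp
  qed simp
  finally show ?thesis .
qed

lemma AE_good:
  "AE x in \<nu>. x \<in> space E \<and> integrable (Q x) h \<and> integrable (Q x) (\<lambda>y. (h y)\<^sup>2) \<and> integrable (Q x) (\<lambda>y. \<bar>h y\<bar> ^ 3)"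
proof -
  have "AE x in \<nu>. x \<in> space E" by (metis AE_space space_nu)
  with AE_integrable_Q[OF int_h(1)] AE_integrable_Q[OF int_h(2)] AE_integrable_Q[OF h3]
  show ?thesis by eventually_elim auto
qed

text \<open>Given \<open>x\<close>, the increment \<open>h y - g x\<close> is centred and has
  variance \<open>s2 + \<psi> x\<close>. The second order expansion of the exponential therefore has
  no linear term, and its remainder is a third moment.\<close>

lemma twist_one_AE:
  "AE x in \<nu>. cmod (tw.T (\<lambda>_. 1) x - (of_real (1 - s2 * t\<^sup>2 / 2) + - of_real (t\<^sup>2 / 2) * \<psi> x)) \<le> \<bar>t\<bar> ^ 3 * cube x"
  using AE_good Qh psi
proof eventually_elim
  case (elim x)
  then have x: "x \<in> space E" by simp
  interpret Qx: prob_space "Q x" using prob_space_Q x by blast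
  have [measurable]: "h \<in> borel_measurable (Q x)" by (simp add: meas_Q[OF x])
  define u where "u y = t * (h y - g x)" for y
  have [measurable]: "u \<in> borel_measurable (Q x)" unfolding u_def by measurable
  have iu: "integrable (Q x) u" unfolding u_def using elim by auto
  have u2: "(u y)\<^sup>2 = t\<^sup>2 * ((h y)\<^sup>2 - 2 * g x * h y + (g x)\<^sup>2)" for y
    by (simp add: u_def power2_eq_square algebra_simps)
  have iu2: "integrable (Q x) (\<lambda>y. (u y)\<^sup>2)" unfolding u2 using elim by auto
  have u3: "\<bar>u y\<bar> ^ 3 \<le> \<bar>t\<bar> ^ 3 * (4 * (\<bar>h y\<bar> ^ 3 + \<bar>g x\<bar> ^ 3))" for y
    unfolding u_def abs_mult power_mult_distrib by (intro mult_left_mono abs_diff_cubed_le) auto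
  \<comment> \<open>The Taylor constant 1/6 absorbs the 4 from the cube of a difference.\<close>
  have u3': "\<bar>u y\<bar> ^ 3 / 6 \<le> \<bar>t\<bar> ^ 3 * (\<bar>h y\<bar> ^ 3 + \<bar>g x\<bar> ^ 3)" for y
  proof -
    have "0 \<le> \<bar>t\<bar> ^ 3 * (\<bar>h y\<bar> ^ 3 + \<bar>g x\<bar> ^ 3)" by simp
    then show ?thesis using u3[of y] by linarith
  qed
  have ic: "integrable (Q x) (\<lambda>y. \<bar>t\<bar> ^ 3 * (\<bar>h y\<bar> ^ 3 + \<bar>g x\<bar> ^ 3))" using elim by simp
  have iu3: "integrable (Q x) (\<lambda>y. \<bar>u y\<bar> ^ 3 / 6)"
  proof (rule Bochner_Integration.integrable_bound[OF ic])
    show "AE y in Q x. norm (\<bar>u y\<bar> ^ 3 / 6) \<le> norm (\<bar>t\<bar> ^ 3 * (\<bar>h y\<bar> ^ 3 + \<bar>g x\<bar> ^ 3))"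
    proof (intro AE_I2)
      fix y
      have "0 \<le> \<bar>t\<bar> ^ 3 * (\<bar>h y\<bar> ^ 3 + \<bar>g x\<bar> ^ 3)" "0 \<le> \<bar>u y\<bar> ^ 3 / 6" by simp_all
      then show "norm (\<bar>u y\<bar> ^ 3 / 6) \<le> norm (\<bar>t\<bar> ^ 3 * (\<bar>h y\<bar> ^ 3 + \<bar>g x\<bar> ^ 3))"
        using u3'[of y] by (simp only: real_norm_def abs_of_nonneg)
    qed
  qed measurable
  have ie: "integrable (Q x) (\<lambda>y. iexp (u y))"
    by (rule Qx.integrable_const_bound[where B=1]) auto
  have ip: "integrable (Q x) (\<lambda>y. 1 + \<i> * complex_of_real (u y) - complex_of_real ((u y)\<^sup>2) / 2)"
    using iu iu2 by (auto intro!: Bochner_Integration.integrable_add Bochner_Integration.integrable_diff simp del: of_real_power)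
  have "(\<integral>y. 1 + \<i> * complex_of_real (u y) - complex_of_real ((u y)\<^sup>2) / 2 \<partial>Q x)
      = 1 + \<i> * complex_of_real (\<integral>y. u y \<partial>Q x) - complex_of_real (\<integral>y. (u y)\<^sup>2 \<partial>Q x) / 2"
    using iu iu2 by (simp add: Qx.prob_space del: of_real_power)
  also have "(\<integral>y. u y \<partial>Q x) = 0" unfolding u_def using elim by (simp add: Qx.prob_space)
  also have "(\<integral>y. (u y)\<^sup>2 \<partial>Q x) = t\<^sup>2 * ((\<integral>y. (h y)\<^sup>2 \<partial>Q x) - (g x)\<^sup>2)"
    unfolding u2 using elim by (simp add: Qx.prob_space power2_eq_square)
  finally have P0: "(\<integral>y. 1 + \<i> * complex_of_real (u y) - complex_of_real ((u y)\<^sup>2) / 2 \<partial>Q x)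
      = 1 + \<i> * complex_of_real 0 - complex_of_real (t\<^sup>2 * ((\<integral>y. (h y)\<^sup>2 \<partial>Q x) - (g x)\<^sup>2)) / 2" .
  have "1 - t\<^sup>2 * ((\<integral>y. (h y)\<^sup>2 \<partial>Q x) - (g x)\<^sup>2) / 2
      = (1 - s2 * t\<^sup>2 / 2) + - (t\<^sup>2 / 2) * ((\<integral>y. (h y)\<^sup>2 \<partial>Q x) - (g x)\<^sup>2 - s2)"
    by (simp add: algebra_simps add_divide_distrib diff_divide_distrib)
  from this[THEN arg_cong[where f=complex_of_real]]
  have P: "(\<integral>y. 1 + \<i> * complex_of_real (u y) - complex_of_real ((u y)\<^sup>2) / 2 \<partial>Q x)
      = of_real (1 - s2 * t\<^sup>2 / 2) + - of_real (t\<^sup>2 / 2) * \<psi> x"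
    unfolding P0 elim(3) by simp
  have "tw.T (\<lambda>_. 1) x = (\<integral>y. iexp (u y) \<partial>Q x)" unfolding twist_eq u_def by simp
  then have "tw.T (\<lambda>_. 1) x - (of_real (1 - s2 * t\<^sup>2 / 2) + - of_real (t\<^sup>2 / 2) * \<psi> x)
    = (\<integral>y. iexp (u y) - (1 + \<i> * complex_of_real (u y) - complex_of_real ((u y)\<^sup>2) / 2) \<partial>Q x)"
    unfolding P[symmetric] by (simp only: Bochner_Integration.integral_diff[OF ie ip])
  also have "cmod \<dots> \<le> (\<integral>y. \<bar>u y\<bar> ^ 3 / 6 \<partial>Q x)"
    by (intro norm_integral_le_integral Bochner_Integration.integrable_diff ie ip iu3 iexp_taylor2)
  also have "\<dots> \<le> (\<integral>y. \<bar>t\<bar> ^ 3 * (\<bar>h y\<bar> ^ 3 + \<bar>g x\<bar> ^ 3) \<partial>Q x)"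
    by (rule integral_mono[OF iu3 ic u3'])
  also have "\<dots> = \<bar>t\<bar> ^ 3 * cube x" using elim by (simp add: cube_def Qx.prob_space)
  finally show ?case .
qed

text \<open>The phase differs from 1 by at most \<open>|t| * |h y - g x|\<close>, and this
  multiplies \<open>psip p\<close>: a product of an L^3 and an L^(3/2) function, split by Young's
  inequality with the weight \<open>F p\<close>.\<close>

lemma twist_psip_AE:
  "AE x in \<nu>. cmod (tw.T (psip p) x - psip (Suc p) x)
     \<le> \<bar>t\<bar> * (4 * F p * cube x + (\<integral>y. cmod (psip p y) powr (3/2) \<partial>Q x) / sqrt (F p))"
  using AE_good AE_integrable_Q[OF psip_int[of p]] AE_integrable_Q[OF psi_int[of p]]
proof eventually_elim
  case (elim x)
  then have x: "x \<in> space E" by simp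
  interpret Qx: prob_space "Q x" using prob_space_Q x by blast
  have [measurable]: "h \<in> borel_measurable (Q x)" "psip p \<in> borel_measurable (Q x)" by (simp_all add: meas_Q[OF x])
  have ie: "integrable (Q x) (\<lambda>y. iexp (t * (h y - g x)) * psip p y)"
    by (rule Bochner_Integration.integrable_bound[where f="psip p"])
       (use elim in \<open>auto simp: norm_mult simp del: of_real_mult of_real_diff\<close>)
  define w where "w y = \<bar>t\<bar> * (4 * F p * (\<bar>h y\<bar> ^ 3 + \<bar>g x\<bar> ^ 3) + cmod (psip p y) powr (3/2) / sqrt (F p))" for y
  have "tw.T (psip p) x - psip (Suc p) x = (\<integral>y. iexp (t * (h y - g x)) * psip p y - psip p y \<partial>Q x)"
    unfolding twist_eq using ie elim by (simp add: kop_def)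
  also have "cmod \<dots> \<le> (\<integral>y. w y \<partial>Q x)"
  proof (rule norm_integral_le_integral)
    show "integrable (Q x) w" unfolding w_def using elim
      by (intro integrable_mult_right Bochner_Integration.integrable_add integrable_divide_zero) auto
    show "norm (iexp (t * (h y - g x)) * psip p y - psip p y) \<le> w y" for y
    proof -
      have "norm (iexp (t * (h y - g x)) * psip p y - psip p y) = cmod (iexp (t * (h y - g x)) - 1) * cmod (psip p y)"
        by (subst norm_mult[symmetric]) (simp only: left_diff_distrib mult_1_left)
      also have "\<dots> \<le> \<bar>t * (h y - g x)\<bar> * cmod (psip p y)"
        by (intro mult_right_mono cmod_iexp_minus_one_le) auto
      also have "\<dots> = \<bar>t\<bar> * (\<bar>h y - g x\<bar> * cmod (psip p y))" by (simp add: abs_mult)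
      also have "\<dots> \<le> \<bar>t\<bar> * (F p * \<bar>h y - g x\<bar> ^ 3 + cmod (psip p y) powr (3/2) / sqrt (F p))"
        using F_pos by (intro mult_left_mono young_three_halves) auto
      also have "\<dots> \<le> \<bar>t\<bar> * (F p * (4 * (\<bar>h y\<bar> ^ 3 + \<bar>g x\<bar> ^ 3)) + cmod (psip p y) powr (3/2) / sqrt (F p))"
        using less_imp_le[OF F_pos[of p]] by (intro mult_left_mono add_right_mono abs_diff_cubed_le abs_ge_zero)
      also have "\<dots> = w y" by (simp add: w_def mult_ac)
      finally show ?thesis .
    qed
    show "integrable (Q x) (\<lambda>y. iexp (t * (h y - g x)) * psip p y - psip p y)"
      using elim by (intro Bochner_Integration.integrable_diff ie) simp
  qed
  also have "\<dots> = \<bar>t\<bar> * (4 * F p * cube x + (\<integral>y. cmod (psip p y) powr (3/2) \<partial>Q x) / sqrt (F p))"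
  proof -
    have i3: "integrable (Q x) (\<lambda>y. 4 * F p * (\<bar>h y\<bar> ^ 3 + \<bar>g x\<bar> ^ 3))"
      and ip: "integrable (Q x) (\<lambda>y. cmod (psip p y) powr (3/2) / sqrt (F p))"
      using elim by (intro integrable_mult_right Bochner_Integration.integrable_add integrable_divide_zero; simp)+
    have "(\<integral>y. \<bar>h y\<bar> ^ 3 + \<bar>g x\<bar> ^ 3 \<partial>Q x) = cube x"
      using elim by (simp add: cube_def Qx.prob_space)
    then show ?thesis unfolding w_def
      by (simp only: integral_mult_right_zero Bochner_Integration.integral_add[OF i3 ip] integral_divide_zero)
  qed
  finally show ?case .
qed

lemma state_psip_step:
  "cmod (tw.state (Suc n) (psip p) - tw.state n (psip (Suc p))) \<le> \<bar>t\<bar> * ((4 * m3 + 1) * F p)"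
proof -
  have i1: "integrable \<nu> (\<lambda>x. \<integral>y. cmod (psip p y) powr (3/2) \<partial>Q x)" using integral_Q(1)[OF psi_int] .
  have "cmod (tw.state (Suc n) (psip p) - tw.state n (psip (Suc p)))
    \<le> (\<integral>x. \<bar>t\<bar> * (4 * F p * cube x + (\<integral>y. cmod (psip p y) powr (3/2) \<partial>Q x) / sqrt (F p)) \<partial>\<nu>)"
    unfolding tw.state_Suc
    using tw.twist_integrable(1)[OF psip_int[of p]] psip_int[of "Suc p"] cube(1) i1 twist_psip_AE[of p]
    by (intro tw.state_diff_le) auto
  also have "\<dots> = \<bar>t\<bar> * (4 * F p * m3 + (\<integral>x. cmod (psip p x) powr (3/2) \<partial>\<nu>) / sqrt (F p))"
  proof -
    have i3: "integrable \<nu> (\<lambda>x. 4 * F p * cube x)"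
      and ip: "integrable \<nu> (\<lambda>x. (\<integral>y. cmod (psip p y) powr (3/2) \<partial>Q x) / sqrt (F p))"
      using cube(1) i1 by (intro integrable_mult_right integrable_divide_zero; simp)+
    show ?thesis
      by (simp only: integral_mult_right_zero Bochner_Integration.integral_add[OF i3 ip] integral_divide_zero
          cube(2) integral_integral_Q_real[OF psi_int[of p]])
  qed
  also have "\<dots> \<le> \<bar>t\<bar> * (4 * F p * m3 + F p)"
    by (intro mult_left_mono add_left_mono F_bound) auto
  finally show ?thesis by (simp add: algebra_simps)
qed

text \<open>Each step trades one application of the weighted kernel for a plain one, replacing
  \<open>psip p\<close> by \<open>psip (Suc p)\<close> at cost \<open>|t| * F p\<close>. When no
  weighted step is left, only a mean remains, and it is zero by invariance.\<close>

lemma state_psip_bound: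
  "cmod (tw.state n (psip p)) \<le> \<bar>t\<bar> * ((4 * m3 + 1) * (\<Sum>j<n. F (p + j)))"
proof (induction n arbitrary: p)
  case 0
  show ?case unfolding tw.state_def by (simp add: psip_mean)
next
  case (Suc n)
  have "cmod (tw.state (Suc n) (psip p))
      \<le> cmod (tw.state (Suc n) (psip p) - tw.state n (psip (Suc p))) + cmod (tw.state n (psip (Suc p)))"
    by (metis add.commute diff_add_cancel norm_triangle_ineq)
  also have "\<dots> \<le> \<bar>t\<bar> * ((4 * m3 + 1) * F p) + \<bar>t\<bar> * ((4 * m3 + 1) * (\<Sum>j<n. F (Suc p + j)))"
    by (intro add_mono state_psip_step Suc.IH)
  also have "\<dots> = \<bar>t\<bar> * ((4 * m3 + 1) * (\<Sum>j<Suc n. F (p + j)))"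
    by (simp add: sum.lessThan_Suc_shift distrib_left del: sum.lessThan_Suc)
  finally show ?case .
qed

definition Kpsi :: real where "Kpsi = (4 * m3 + 1) * suminf F"

lemma Kpsi_nonneg: "0 \<le> Kpsi" unfolding Kpsi_def
  using m3_nonneg F_pos by (intro mult_nonneg_nonneg suminf_nonneg F_summable) (auto intro: less_imp_le)

lemma state_psi_bound: "cmod (tw.state n \<psi>) \<le> \<bar>t\<bar> * Kpsi"
proof -
  have "cmod (tw.state n \<psi>) \<le> \<bar>t\<bar> * ((4 * m3 + 1) * (\<Sum>j<n. F j))"
    using state_psip_bound[of n 0] by simp
  also have "\<dots> \<le> \<bar>t\<bar> * Kpsi" unfolding Kpsi_def
    using m3_nonneg F_pos by (intro mult_left_mono sum_le_suminf F_summable) (auto intro: less_imp_le)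
  finally show ?thesis .
qed

text \<open>The fluctuation \<open>\<psi>\<close> of the conditional variance enters with the factor
  \<open>t^2 / 2\<close> and its state is O(t), so it costs no more than the Taylor
  remainder.\<close>

lemma state_one_step:
  "cmod (tw.state (Suc n) (\<lambda>_. 1) - of_real (1 - s2 * t\<^sup>2 / 2) * tw.state n (\<lambda>_. 1)) \<le> \<bar>t\<bar> ^ 3 * (Kpsi + m3)"
proof -
  define r where "r = complex_of_real (1 - s2 * t\<^sup>2 / 2)"
  define c where "c = - complex_of_real (t\<^sup>2 / 2)"
  have i1: "integrable \<nu> (\<lambda>_. 1 :: complex)" by simp
  have ip: "integrable \<nu> \<psi>" using psip_int[of 0] by simp
  have e: "tw.state n (\<lambda>x. r + c * \<psi> x) = r * tw.state n (\<lambda>_. 1) + c * tw.state n \<psi>"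
    by (rule tw.state_affine[OF ip])
  have 1: "cmod (tw.state (Suc n) (\<lambda>_. 1) - tw.state n (\<lambda>x. r + c * \<psi> x)) \<le> \<bar>t\<bar> ^ 3 * m3"
  proof -
    have "cmod (tw.state (Suc n) (\<lambda>_. 1) - tw.state n (\<lambda>x. r + c * \<psi> x)) \<le> (\<integral>x. \<bar>t\<bar> ^ 3 * cube x \<partial>\<nu>)"
      unfolding tw.state_Suc r_def c_def
      by (rule tw.state_diff_le[OF tw.twist_integrable(1)[OF i1] _ _ twist_one_AE])
         (intro Bochner_Integration.integrable_add integrable_mult_right ip cube(1); simp)+
    then show ?thesis by (simp only: integral_mult_right_zero cube(2))
  qed
  have 2: "cmod (c * tw.state n \<psi>) \<le> \<bar>t\<bar> ^ 3 * Kpsi"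
  proof -
    have "cmod (c * tw.state n \<psi>) = t\<^sup>2 / 2 * cmod (tw.state n \<psi>)"
      by (simp add: c_def norm_mult norm_divide norm_power)
    also have "\<dots> \<le> t\<^sup>2 / 2 * (\<bar>t\<bar> * Kpsi)" by (intro mult_left_mono state_psi_bound) auto
    also have "\<dots> \<le> t\<^sup>2 * (\<bar>t\<bar> * Kpsi)" using Kpsi_nonneg by (intro mult_right_mono) auto
    also have "\<dots> = \<bar>t\<bar> ^ 3 * Kpsi"
      by (simp add: power3_eq_cube power2_eq_square)
    finally show ?thesis .
  qed
  have eq: "tw.state (Suc n) (\<lambda>_. 1) - r * tw.state n (\<lambda>_. 1)
      = (tw.state (Suc n) (\<lambda>_. 1) - tw.state n (\<lambda>x. r + c * \<psi> x)) + c * tw.state n \<psi>"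
    unfolding e by simp
  have "cmod (tw.state (Suc n) (\<lambda>_. 1) - r * tw.state n (\<lambda>_. 1)) \<le> \<bar>t\<bar> ^ 3 * m3 + \<bar>t\<bar> ^ 3 * Kpsi"
    unfolding eq by (rule norm_triangle_mono[OF 1 2])
  then show ?thesis by (simp only: r_def distrib_left add.commute)
qed

text \<open>The restriction on \<open>t\<close> keeps the factor \<open>1 - s2 * t^2 / 2\<close> in
  the unit disc, so the cubic one-step errors only add up.\<close>

lemma state_one_bound:
  assumes "s2 * t\<^sup>2 \<le> 2"
  shows "cmod (tw.state n (\<lambda>_. 1) - of_real (1 - s2 * t\<^sup>2 / 2) ^ n) \<le> real n * (\<bar>t\<bar> ^ 3 * (Kpsi + m3))"
proof (induction n)
  case 0
  show ?case unfolding tw.state_def using prob_space by simp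
next
  case (Suc n)
  define r where "r = complex_of_real (1 - s2 * t\<^sup>2 / 2)"
  have r: "cmod r \<le> 1" unfolding r_def norm_of_real using assms s2_nonneg by (auto simp: abs_le_iff)
  have eq: "tw.state (Suc n) (\<lambda>_. 1) - r ^ Suc n
      = (tw.state (Suc n) (\<lambda>_. 1) - r * tw.state n (\<lambda>_. 1)) + r * (tw.state n (\<lambda>_. 1) - r ^ n)"
    by (simp add: algebra_simps)
  have "cmod (tw.state (Suc n) (\<lambda>_. 1) - r ^ Suc n) \<le> \<bar>t\<bar> ^ 3 * (Kpsi + m3) + 1 * (real n * (\<bar>t\<bar> ^ 3 * (Kpsi + m3)))"
    unfolding eq
  proof (rule norm_triangle_mono)
    show "cmod (tw.state (Suc n) (\<lambda>_. 1) - r * tw.state n (\<lambda>_. 1)) \<le> \<bar>t\<bar> ^ 3 * (Kpsi + m3)"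
      unfolding r_def by (rule state_one_step)
    show "cmod (r * (tw.state n (\<lambda>_. 1) - r ^ n)) \<le> 1 * (real n * (\<bar>t\<bar> ^ 3 * (Kpsi + m3)))"
      unfolding norm_mult by (rule mult_mono[OF r]) (use Suc.IH in \<open>auto simp only: r_def norm_ge_zero\<close>)
  qed
  also have "\<dots> = real (Suc n) * (\<bar>t\<bar> ^ 3 * (Kpsi + m3))" by (simp add: algebra_simps)
  finally show ?case by (simp only: r_def)
qed

interpretation pl: twisted_kernel E Q \<nu> "\<lambda>_. 1" "\<lambda>x. iexp (t * \<xi> x)"
  by unfold_locales (auto simp: xi simp del: of_real_mult)

lemma kop_t_eq: "kop_t Q \<xi> t = pl.T"
  unfolding kop_t_def[abs_def] twist_def[abs_def] kop_def[abs_def] by simp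

text \<open>Since \<open>h = \<xi> + g\<close>, the phase of \<open>h\<close> on the right cancels
  the phase of \<open>-g\<close> on the left of the next factor up to the phase of
  \<open>\<xi>\<close>. Only the two outermost phases of \<open>g\<close> survive: this is the
  telescoping of the coboundary, at operator level and valid at every point.\<close>

lemma twist_pow_conj: "(tw.T ^^ n) f x = gphase x * (pl.T ^^ n) (\<lambda>y. iexp (t * g y) * f y) x"
proof (induction n arbitrary: x)
  case 0
  show ?case by (simp add: exp_add[symmetric] flip: mult.assoc)
next
  case (Suc n)
  have *: "hphase y * gphase y = iexp (t * \<xi> y)" for y
    by (simp add: xi exp_add[symmetric] algebra_simps)
  have "(tw.T ^^ n) f = (\<lambda>y. gphase y * (pl.T ^^ n) (\<lambda>y. iexp (t * g y) * f y) y)"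
    by (rule ext) (rule Suc.IH)
  then have "(tw.T ^^ Suc n) f = tw.T (\<lambda>y. gphase y * (pl.T ^^ n) (\<lambda>y. iexp (t * g y) * f y) y)"
    by (simp only: funpow.simps o_apply)
  then have "(tw.T ^^ Suc n) f x = tw.T (\<lambda>y. gphase y * (pl.T ^^ n) (\<lambda>y. iexp (t * g y) * f y) y) x"
    by (rule fun_cong)
  also have "\<dots> = gphase x * pl.T ((pl.T ^^ n) (\<lambda>y. iexp (t * g y) * f y)) x"
    unfolding twist_def mult.assoc[symmetric] * by simp
  finally show ?case by simp
qed

text \<open>Each of the two surviving phases differs from 1 by at most \<open>|t| * |g|\<close>. The
  outer one multiplies a function bounded by 1; the inner one is passed through iterates that
  contract L^1.\<close>

lemma kop_t_state_bound:
  "cmod ((\<integral>x. (kop_t Q \<xi> t ^^ n) (\<lambda>_. 1) x \<partial>\<nu>) - tw.state n (\<lambda>_. 1)) \<le> 2 * (\<bar>t\<bar> * (\<integral>x. \<bar>g x\<bar> \<partial>\<nu>))"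
proof -
  define e where "e = (\<lambda>x. iexp (t * g x))"
  have [measurable]: "e \<in> borel_measurable E" unfolding e_def by measurable
  have ie: "integrable \<nu> e"
    by (rule integrable_const_bound[where B=1]) (auto simp: meas_nu e_def simp del: of_real_mult)
  have ig: "integrable \<nu> (\<lambda>x. \<bar>t\<bar> * \<bar>g x\<bar>)" using int_g by simp
  have le: "cmod (iexp (t * g x) - 1) \<le> \<bar>t\<bar> * \<bar>g x\<bar>" for x
    using cmod_iexp_minus_one_le[of "t * g x"] by (simp add: abs_mult)
  have le': "cmod (gphase x - 1) \<le> \<bar>t\<bar> * \<bar>g x\<bar>" for x
    using cmod_iexp_minus_one_le[of "- (t * g x)"] by (simp add: abs_mult)
  have i: "integrable \<nu> ((pl.T ^^ n) e)" using pl.twist_pow_integrable[OF ie] by blast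
  have pm: "(pl.T ^^ n) e \<in> borel_measurable E" for n
    by (rule integrable_nu_meas) (use pl.twist_pow_integrable[OF ie] in blast)
  \<comment> \<open>Stated on \<open>space E\<close> only: elsewhere \<open>Q x\<close> need not be
    a probability.\<close>
  have em: "cmod ((pl.T ^^ n) e x) \<le> 1" if "x \<in> space E" for x
    using that
  proof (induction n arbitrary: x)
    case 0 show ?case by (simp add: e_def del: of_real_mult)
  next
    case (Suc n)
    interpret Qx: prob_space "Q x" using prob_space_Q Suc.prems by blast
    have "cmod ((pl.T ^^ Suc n) e x) = cmod (\<integral>y. iexp (t * \<xi> y) * (pl.T ^^ n) e y \<partial>Q x)"
      by (simp add: twist_def kop_def)
    also have "\<dots> \<le> (\<integral>y. cmod (iexp (t * \<xi> y) * (pl.T ^^ n) e y) \<partial>Q x)" by (rule integral_norm_bound)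
    also have "\<dots> \<le> 1"
      using Suc.IH pm by (intro Qx.integral_le_const[where c=1] Qx.integrable_const_bound[where B=1])
        (auto simp: norm_mult space_Q[OF Suc.prems] meas_Q[OF Suc.prems] intro!: AE_I2 simp del: of_real_mult
          intro!: borel_measurable_norm)
    finally show ?case .
  qed
  have 1: "cmod (tw.state n (\<lambda>_. 1) - (\<integral>x. (pl.T ^^ n) e x \<partial>\<nu>)) \<le> \<bar>t\<bar> * (\<integral>x. \<bar>g x\<bar> \<partial>\<nu>)"
  proof -
    have "integrable \<nu> (\<lambda>x. gphase x * (pl.T ^^ n) e x)"
      by (rule mult_integrable(1)[OF i]) auto
    then have "tw.state n (\<lambda>_. 1) - (\<integral>x. (pl.T ^^ n) e x \<partial>\<nu>) = (\<integral>x. gphase x * (pl.T ^^ n) e x - (pl.T ^^ n) e x \<partial>\<nu>)"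
      using i unfolding tw.state_def twist_pow_conj e_def by simp
    also have "cmod \<dots> \<le> (\<integral>x. \<bar>t\<bar> * \<bar>g x\<bar> \<partial>\<nu>)"
    proof (rule norm_integral_le_integral[OF _ ig])
      show "integrable \<nu> (\<lambda>x. gphase x * (pl.T ^^ n) e x - (pl.T ^^ n) e x)"
        using i mult_integrable(1)[OF i tw.a_meas tw.a_le] by simp
      fix x assume "x \<in> space \<nu>"
      then have "cmod (gphase x - 1) * cmod ((pl.T ^^ n) e x) \<le> \<bar>t\<bar> * \<bar>g x\<bar> * 1"
        using le'[of x] em[of x] by (intro mult_mono) auto
      then show "norm (gphase x * (pl.T ^^ n) e x - (pl.T ^^ n) e x) \<le> \<bar>t\<bar> * \<bar>g x\<bar>"
        unfolding norm_mult[symmetric] by (simp only: left_diff_distrib mult_1_left)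
    qed
    finally show ?thesis by simp
  qed
  have 2: "cmod (pl.state n e - pl.state n (\<lambda>_. 1)) \<le> (\<integral>x. \<bar>t\<bar> * \<bar>g x\<bar> \<partial>\<nu>)"
    by (rule pl.state_diff_le) (use ie ig le in \<open>auto simp: e_def\<close>)
  have eq: "(\<integral>x. (kop_t Q \<xi> t ^^ n) (\<lambda>_. 1) x \<partial>\<nu>) - tw.state n (\<lambda>_. 1)
    = - ((tw.state n (\<lambda>_. 1) - (\<integral>x. (pl.T ^^ n) e x \<partial>\<nu>)) + (pl.state n e - pl.state n (\<lambda>_. 1)))"
    unfolding kop_t_eq pl.state_def by simp
  have "cmod ((\<integral>x. (kop_t Q \<xi> t ^^ n) (\<lambda>_. 1) x \<partial>\<nu>) - tw.state n (\<lambda>_. 1))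
      \<le> \<bar>t\<bar> * (\<integral>x. \<bar>g x\<bar> \<partial>\<nu>) + (\<integral>x. \<bar>t\<bar> * \<bar>g x\<bar> \<partial>\<nu>)"
    unfolding eq norm_minus_cancel by (rule norm_triangle_mono[OF 1 2])
  then show ?thesis by (simp only: integral_mult_right_zero mult_2)
qed

end

theorem stationary_char_estimate:
  obtains C where "0 \<le> C" "\<And>t n. s2 * t\<^sup>2 \<le> 2 \<Longrightarrow>
    cmod ((\<integral>x. (kop_t Q \<xi> t ^^ n) (\<lambda>_. 1) x \<partial>\<nu>) - of_real (1 - s2 * t\<^sup>2 / 2) ^ n) \<le> C * (\<bar>t\<bar> + real n * \<bar>t\<bar> ^ 3)"
proof
  define G where "G = (\<integral>x. \<bar>g x\<bar> \<partial>\<nu>)"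
  define C where "C = 2 * G + (Kpsi + m3)"
  have G: "0 \<le> G" unfolding G_def by simp
  show "0 \<le> C" using G Kpsi_nonneg m3_nonneg by (simp add: C_def)
  fix t :: real and n :: nat assume t: "s2 * t\<^sup>2 \<le> 2"
  note a = kop_t_state_bound[where t=t and n=n, folded G_def]
  note b = state_one_bound[OF t, where n=n]
  have "cmod ((\<integral>x. (kop_t Q \<xi> t ^^ n) (\<lambda>_. 1) x \<partial>\<nu>) - of_real (1 - s2 * t\<^sup>2 / 2) ^ n)
     \<le> 2 * (\<bar>t\<bar> * G) + real n * (\<bar>t\<bar> ^ 3 * (Kpsi + m3))"
    using norm_triangle_mono[OF a b] by simp
  also have "\<dots> \<le> C * (\<bar>t\<bar> + real n * \<bar>t\<bar> ^ 3)"
    using G Kpsi_nonneg m3_nonneg unfolding C_def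
    by (simp add: algebra_simps)
  finally show "cmod ((\<integral>x. (kop_t Q \<xi> t ^^ n) (\<lambda>_. 1) x \<partial>\<nu>) - of_real (1 - s2 * t\<^sup>2 / 2) ^ n) \<le> C * (\<bar>t\<bar> + real n * \<bar>t\<bar> ^ 3)" .
qed

end

section \<open>Perturbed operators\<close>

text \<open>\<open>N\<close> and \<open>Nt\<close> stand for the norms inherited from the small and
  the large space, \<open>L\<close> for the mean under \<open>\<nu>\<close>. Linear operations are
  packed into \<open>f + c * g\<close>; scaling is an inequality, which already forces the norm of 0
  to be 0.\<close>

locale seminormed_functions =
  fixes V :: "('e \<Rightarrow> complex) set" and one :: "'e \<Rightarrow> complex"
    and N Nt :: "('e \<Rightarrow> complex) \<Rightarrow> real" and L :: "('e \<Rightarrow> complex) \<Rightarrow> complex"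
  assumes V_add: "\<And>f g c. f \<in> V \<Longrightarrow> g \<in> V \<Longrightarrow> (\<lambda>x. f x + c * g x) \<in> V"
    and V_one: "one \<in> V"
    and N_nonneg: "\<And>f. f \<in> V \<Longrightarrow> 0 \<le> N f" and Nt_nonneg: "\<And>f. f \<in> V \<Longrightarrow> 0 \<le> Nt f"
    and N_add: "\<And>f g c. f \<in> V \<Longrightarrow> g \<in> V \<Longrightarrow> N (\<lambda>x. f x + c * g x) \<le> N f + cmod c * N g"
    and Nt_add: "\<And>f g c. f \<in> V \<Longrightarrow> g \<in> V \<Longrightarrow> Nt (\<lambda>x. f x + c * g x) \<le> Nt f + cmod c * Nt g"
    and N_scale: "\<And>f c. f \<in> V \<Longrightarrow> N (\<lambda>x. c * f x) \<le> cmod c * N f"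
    and Nt_scale: "\<And>f c. f \<in> V \<Longrightarrow> Nt (\<lambda>x. c * f x) \<le> cmod c * Nt f"
    and l_add: "\<And>f g c. f \<in> V \<Longrightarrow> g \<in> V \<Longrightarrow> L (\<lambda>x. f x + c * g x) = L f + c * L g"
    and l_one: "L one = 1"
begin

lemma V_diff: "f \<in> V \<Longrightarrow> g \<in> V \<Longrightarrow> (\<lambda>x. f x - g x) \<in> V"
  using V_add[of f g "-1"] by simp

lemma V_scale: "f \<in> V \<Longrightarrow> (\<lambda>x. c * f x) \<in> V"
  using V_add[of f f "c - 1"] by (simp add: algebra_simps)

lemma l_diff: "f \<in> V \<Longrightarrow> g \<in> V \<Longrightarrow> L (\<lambda>x. f x - g x) = L f - L g"
  using l_add[of f g "-1"] by simp

lemma l_scale: "f \<in> V \<Longrightarrow> L (\<lambda>x. c * f x) = c * L f"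
  using l_add[of f f "c - 1"] by (simp add: algebra_simps)

end

text \<open>\<open>R\<close> is a fixed power of \<open>P t\<close> and \<open>\<eta>\<close> a
  multiple of \<open>|t|\<close>. The kernel of \<open>L\<close> is not invariant under
  \<open>R\<close>, and \<open>R_leak\<close> measures by how much it fails to be. The combination
  in \<open>eta_small\<close> is \<open>1 + W + N one\<close> for the radius \<open>W\<close>
  defined below.\<close>

locale perturbed_operator = seminormed_functions V one N Nt L
  for V :: "('e \<Rightarrow> complex) set" and one N Nt L +
  fixes R :: "('e \<Rightarrow> complex) \<Rightarrow> ('e \<Rightarrow> complex)" and D \<eta> :: real
  assumes R_V: "\<And>f. f \<in> V \<Longrightarrow> R f \<in> V"
    and R_add: "\<And>f g c. f \<in> V \<Longrightarrow> g \<in> V \<Longrightarrow> R (\<lambda>x. f x + c * g x) = (\<lambda>x. R f x + c * R g x)"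
    and R_contr: "\<And>f. f \<in> V \<Longrightarrow> L f = 0 \<Longrightarrow> N (R f) \<le> N f / 4"
    and R_leak: "\<And>f. f \<in> V \<Longrightarrow> L f = 0 \<Longrightarrow> cmod (L (R f)) \<le> \<eta> * N f"
    and R_one: "cmod (L (R one) - 1) \<le> \<eta>"
    and R_one_bound: "N (R one) \<le> D"
    and R_contr_t: "\<And>f. f \<in> V \<Longrightarrow> L f = 0 \<Longrightarrow> Nt (R f) \<le> \<eta> * N f + Nt f / 4"
    and R_one_t: "Nt (\<lambda>x. R one x - one x) \<le> \<eta>"
    and eta_nonneg: "0 \<le> \<eta>"
    and eta_small: "\<eta> * (1 + 2 * D + 3 * N one) \<le> 1 / 8"
begin

lemma R_diff: "f \<in> V \<Longrightarrow> g \<in> V \<Longrightarrow> R (\<lambda>x. f x - g x) = (\<lambda>x. R f x - R g x)"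
  using R_add[of f g "-1"] by simp

lemma R_scale: "f \<in> V \<Longrightarrow> R (\<lambda>x. c * f x) = (\<lambda>x. c * R f x)"
  using R_add[of f f "c - 1"] by (simp add: algebra_simps)

text \<open>The power method, normalised by \<open>L\<close> so that \<open>iter n - one\<close>
  always lies in the kernel of \<open>L\<close>, where \<open>R\<close> contracts. The functions are
  never passed to a limit, only the normalising factors are, so \<open>V\<close> need not be
  complete.\<close>

primrec iter :: "nat \<Rightarrow> 'e \<Rightarrow> complex" where
  "iter 0 = one"
| "iter (Suc n) = (\<lambda>x. inverse (L (R (iter n))) * R (iter n) x)"

declare iter.simps(2) [simp del]

abbreviation lam :: "nat \<Rightarrow> complex" where "lam n \<equiv> L (R (iter n))"

text \<open>Chosen so that a ball around \<open>one\<close> is stable under the normalised step: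
  \<open>4/3 * (D + W/4) + N one \<le> W\<close>, where 4/3 bounds the inverse of the normalising
  factor.\<close>

definition W :: real where "W = 2 * D + 2 * N one"

lemma D_nonneg: "0 \<le> D" using N_nonneg[OF R_V[OF V_one]] R_one_bound by linarith

lemma W_nonneg: "0 \<le> W" using D_nonneg N_nonneg[OF V_one] by (simp add: W_def)

lemma eta_W: "\<eta> * (1 + W + N one) \<le> 1 / 8" using eta_small by (simp add: W_def algebra_simps)

lemma eta_W': "\<eta> * (1 + W) \<le> 1 / 8"
proof -
  have "\<eta> * (1 + W) \<le> \<eta> * (1 + W + N one)"
    using eta_nonneg N_nonneg[OF V_one] by (intro mult_left_mono) auto
  then show ?thesis using eta_W by linarith
qed

text \<open>Write \<open>R f\<close> as \<open>R one + R (f - one)\<close>. The first part has mean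
  near 1, and \<open>f - one\<close> has mean 0, so the second contributes only through the
  leak.\<close>

lemma lam_step:
  assumes f: "f \<in> V" and l: "L f = 1" and e: "N (\<lambda>x. f x - one x) \<le> W"
  shows "cmod (L (R f) - 1) \<le> \<eta> * (1 + W)" "3 / 4 \<le> cmod (L (R f))"
proof -
  let ?e = "\<lambda>x. f x - one x"
  have eV: "?e \<in> V" and el: "L ?e = 0" using f V_one l by (simp_all add: V_diff l_diff l_one)
  have "R ?e = (\<lambda>x. R f x - R one x)" using f V_one by (rule R_diff)
  then have "L (R ?e) = L (R f) - L (R one)" using f V_one by (simp add: l_diff R_V)
  then have eq: "L (R f) - 1 = (L (R one) - 1) + L (R ?e)" by simp
  have "cmod (L (R f) - 1) \<le> \<eta> + \<eta> * N ?e"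
    unfolding eq by (rule norm_triangle_mono[OF R_one R_leak[OF eV el]])
  also have "\<dots> \<le> \<eta> + \<eta> * W" using e eta_nonneg by (intro add_left_mono mult_left_mono)
  finally show 1: "cmod (L (R f) - 1) \<le> \<eta> * (1 + W)" by (simp add: algebra_simps)
  have "1 \<le> cmod (L (R f)) + cmod (L (R f) - 1)"
    using norm_triangle_ineq4[of "L (R f)" "L (R f) - 1"] by simp
  then show "3 / 4 \<le> cmod (L (R f))" using 1 eta_W' by linarith
qed

lemma iter_props: "iter n \<in> V \<and> L (iter n) = 1 \<and> N (\<lambda>x. iter n x - one x) \<le> W"
proof (induction n)
  case 0
  have "N (\<lambda>x. 0 * one x) \<le> 0" using N_scale[OF V_one, of 0] by simp
  then show ?case using V_one l_one W_nonneg by simp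
next
  case (Suc n)
  let ?f = "iter n" and ?e = "\<lambda>x. iter n x - one x"
  have f: "?f \<in> V" "L ?f = 1" and e: "N ?e \<le> W" using Suc by auto
  have eV: "?e \<in> V" and el: "L ?e = 0" using f V_one by (simp_all add: V_diff l_diff l_one)
  note ls = lam_step[OF f e]
  then have l0: "lam n \<noteq> 0" by auto
  have RfV: "R ?f \<in> V" using f R_V by blast
  have "R ?e = (\<lambda>x. R ?f x - R one x)" using f(1) V_one by (rule R_diff)
  then have Rf: "R ?f = (\<lambda>x. R one x + 1 * R ?e x)" by auto
  have "N (R ?f) \<le> N (R one) + cmod 1 * N (R ?e)"
    unfolding Rf by (rule N_add) (use V_one eV R_V in auto)
  also have "\<dots> \<le> D + W / 4" using R_one_bound R_contr[OF eV el] e by simp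
  finally have NRf: "N (R ?f) \<le> D + W / 4" .
  have "(\<lambda>x. iter (Suc n) x - one x) = (\<lambda>x. inverse (lam n) * R ?f x + (-1) * one x)" by (simp add: iter.simps(2))
  then have "N (\<lambda>x. iter (Suc n) x - one x) \<le> N (\<lambda>x. inverse (lam n) * R ?f x) + cmod (-1) * N one"
    using N_add[OF V_scale[OF RfV, of "inverse (lam n)"] V_one, of "-1"] by simp
  also have "\<dots> \<le> cmod (inverse (lam n)) * N (R ?f) + N one"
    using N_scale[OF RfV] by simp
  also have "\<dots> \<le> 4 / 3 * (D + W / 4) + N one"
    using le_imp_inverse_le[OF ls(2)] NRf N_nonneg[OF RfV]
    by (intro add_right_mono mult_mono) (auto simp: norm_inverse)
  also have "\<dots> \<le> W" using D_nonneg N_nonneg[OF V_one] by (simp add: W_def)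
  finally have "N (\<lambda>x. iter (Suc n) x - one x) \<le> W" .
  moreover have "iter (Suc n) \<in> V" using V_scale[OF RfV] by (simp add: iter.simps(2))
  moreover have "L (iter (Suc n)) = 1" using l_scale[OF RfV] l0 by (simp add: iter.simps(2))
  ultimately show ?case by blast
qed

lemmas iter_V = iter_props[THEN conjunct1] and l_iter = iter_props[THEN conjunct2, THEN conjunct1]
  and N_iter = iter_props[THEN conjunct2, THEN conjunct2]

lemma lam_near_one: "cmod (lam n - 1) \<le> \<eta> * (1 + W)" and lam_ge: "3 / 4 \<le> cmod (lam n)"
  using lam_step[OF iter_V l_iter N_iter] by auto

lemma lam_nonzero: "lam n \<noteq> 0" using lam_ge[of n] by auto

lemma N_iter_le: "N (iter n) \<le> W + N one"
proof -
  have "iter n = (\<lambda>x. (iter n x - one x) + 1 * one x)" by auto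
  then have "N (iter n) \<le> N (\<lambda>x. iter n x - one x) + cmod 1 * N one"
    using N_add[OF V_diff[OF iter_V V_one] V_one, of n 1] by simp
  then show ?thesis using N_iter[of n] by simp
qed

lemma iter_pow: "(R ^^ n) one = (\<lambda>x. (\<Prod>k<n. lam k) * iter n x)"
proof (induction n)
  case (Suc n)
  have "(R ^^ Suc n) one = R (\<lambda>x. (\<Prod>k<n. lam k) * iter n x)" using Suc by simp
  also have "\<dots> = (\<lambda>x. (\<Prod>k<n. lam k) * R (iter n) x)" by (rule R_scale[OF iter_V])
  also have "\<dots> = (\<lambda>x. (\<Prod>k<Suc n. lam k) * iter (Suc n) x)"
    using lam_nonzero[of n] by (auto simp: field_simps iter.simps(2))
  finally show ?case .
qed simp

definition step :: "nat \<Rightarrow> 'e \<Rightarrow> complex" where "step n = (\<lambda>x. iter (Suc n) x - iter n x)"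

lemma step_V: "step n \<in> V" and l_step: "L (step n) = 0"
  unfolding step_def using iter_V l_iter by (simp_all add: V_diff l_diff)

lemma R_step: "R (step n) = (\<lambda>x. R (iter (Suc n)) x - R (iter n) x)"
  unfolding step_def by (rule R_diff[OF iter_V iter_V])

lemma lam_diff: "lam (Suc n) - lam n = L (R (step n))"
  unfolding R_step by (simp add: l_diff R_V iter_V)

text \<open>\<open>R (step n)\<close> has mean \<open>lam (Suc n) - lam n\<close>; subtracting this
  multiple of \<open>iter (Suc n)\<close>, which has mean 1, projects back onto the kernel of
  \<open>L\<close>.\<close>

lemma step_Suc: "step (Suc n) = (\<lambda>x. inverse (lam (Suc n)) * (R (step n) x + (- L (R (step n))) * iter (Suc n) x))"
proof
  fix x
  have a: "lam n * iter (Suc n) x = R (iter n) x" using lam_nonzero[of n] by (simp add: iter.simps(2))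
  have b: "step (Suc n) x = inverse (lam (Suc n)) * R (iter (Suc n)) x - iter (Suc n) x"
    by (simp add: step_def iter.simps(2)[of "Suc n"])
  have c: "R (step n) x = R (iter (Suc n)) x - lam n * iter (Suc n) x"
    unfolding a R_step ..
  have d: "L (R (step n)) = lam (Suc n) - lam n" by (rule lam_diff[symmetric])
  have "inverse (lam (Suc n)) * (R (step n) x + (- L (R (step n))) * iter (Suc n) x)
      = inverse (lam (Suc n)) * (R (iter (Suc n)) x - lam (Suc n) * iter (Suc n) x)"
    unfolding c d by (rule arg_cong[where f="\<lambda>z. inverse (lam (Suc n)) * z"]) (simp add: left_diff_distrib)
  then show "step (Suc n) x = inverse (lam (Suc n)) * (R (step n) x + (- L (R (step n))) * iter (Suc n) x)"
    unfolding b using lam_nonzero[of "Suc n"] by (simp only: right_diff_distrib mult.assoc[symmetric] left_inverse not_False_eq_True mult_1_left)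
qed

text \<open>The rate 1/2 is \<open>4/3 * (1/4 + 1/8)\<close>: normalisation times the sum of the
  contraction and the correction for the leak.\<close>

lemma N_step: "N (step n) \<le> W * (1 / 2) ^ n"
proof (induction n)
  case 0
  have "step 0 = (\<lambda>x. iter 1 x - one x)" by (simp add: step_def)
  then show ?case using N_iter[of 1] by simp
next
  case (Suc n)
  have RV: "R (step n) \<in> V" by (rule R_V[OF step_V])
  define h where "h = (\<lambda>x. R (step n) x + (- L (R (step n))) * iter (Suc n) x)"
  have hV: "h \<in> V" unfolding h_def by (rule V_add[OF RV iter_V])
  have "N h \<le> N (R (step n)) + cmod (- L (R (step n))) * N (iter (Suc n))"
    unfolding h_def by (rule N_add[OF RV iter_V])
  moreover have "N (R (step n)) \<le> N (step n) / 4" by (rule R_contr[OF step_V l_step])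
  moreover have "cmod (- L (R (step n))) * N (iter (Suc n)) \<le> (\<eta> * N (step n)) * (W + N one)"
    unfolding norm_minus_cancel using N_nonneg[OF iter_V[of "Suc n"]] N_nonneg[OF step_V[of n]] eta_nonneg
    by (intro mult_mono R_leak[OF step_V l_step] N_iter_le) auto
  moreover have "(\<eta> * N (step n)) * (W + N one) \<le> N (step n) * (1 / 8)"
  proof -
    have "\<eta> * (W + N one) \<le> 1 / 8" using eta_W eta_nonneg by (simp add: algebra_simps)
    from mult_left_mono[OF this N_nonneg[OF step_V[of n]]] show ?thesis by (simp add: mult_ac)
  qed
  ultimately have h: "N h \<le> N (step n) * (3 / 8)" by linarith
  have eq: "step (Suc n) = (\<lambda>x. inverse (lam (Suc n)) * h x)" unfolding h_def by (rule step_Suc)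
  have "N (step (Suc n)) \<le> cmod (inverse (lam (Suc n))) * N h"
    unfolding eq by (rule N_scale[OF hV])
  moreover have "cmod (inverse (lam (Suc n))) * N h \<le> 4 / 3 * (N (step n) * (3 / 8))"
  proof (rule mult_mono[OF _ h])
    show "cmod (inverse (lam (Suc n))) \<le> 4 / 3"
      unfolding norm_inverse using le_imp_inverse_le[OF lam_ge[of "Suc n"]] by simp
  qed (use N_nonneg[OF hV] in auto)
  ultimately show ?case using Suc by simp
qed

text \<open>Consecutive factors differ by the leak of a single step, which supplies the extra
  \<open>\<eta>\<close> beyond the geometric decay.\<close>

lemma lam_cauchy: "cmod (lam (Suc n) - lam n) \<le> \<eta> * W * (1 / 2) ^ n"
proof -
  have "cmod (lam (Suc n) - lam n) \<le> \<eta> * N (step n)"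
    unfolding lam_diff by (rule R_leak[OF step_V l_step])
  also have "\<dots> \<le> \<eta> * (W * (1 / 2) ^ n)" by (rule mult_left_mono[OF N_step eta_nonneg])
  finally show ?thesis by simp
qed

text \<open>In \<open>N\<close> the difference from \<open>one\<close> is merely bounded by
  \<open>W\<close>; in \<open>Nt\<close> it is O(\<eta>). With
  \<open>K = (1 + W) * (1 + Nt one) * \<eta>\<close> the new errors sum to \<open>K\<close>, the old
  error \<open>2 * K\<close> is contracted to \<open>K / 2\<close>, and normalisation by 4/3 returns
  \<open>2 * K\<close>.\<close>

lemma Nt_iter: "Nt (\<lambda>x. iter n x - one x) \<le> 2 * (1 + W) * (1 + Nt one) * \<eta>"
proof (induction n)
  case 0
  have "Nt (\<lambda>x. 0 * one x) \<le> 0" using Nt_scale[OF V_one, of 0] by simp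
  moreover have "0 \<le> 2 * (1 + W) * (1 + Nt one) * \<eta>"
    using W_nonneg Nt_nonneg[OF V_one] eta_nonneg by (intro mult_nonneg_nonneg) auto
  ultimately show ?case by simp
next
  case (Suc n)
  define K where "K = (1 + W) * (1 + Nt one) * \<eta>"
  let ?f = "iter n" and ?e = "\<lambda>x. iter n x - one x"
  have eV: "?e \<in> V" and el: "L ?e = 0" using iter_V[of n] l_iter[of n] V_one by (simp_all add: V_diff l_diff l_one)
  define h1 where "h1 = (\<lambda>x. (R one x - one x) + 1 * R ?e x)"
  define h where "h = (\<lambda>x. h1 x + (1 - lam n) * one x)"
  have v1: "(\<lambda>x. R one x - one x) \<in> V" and v2: "R ?e \<in> V" using V_one eV R_V V_diff by auto
  have v3: "h1 \<in> V" unfolding h1_def by (rule V_add[OF v1 v2])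
  have v4: "h \<in> V" unfolding h_def by (rule V_add[OF v3 V_one])
  have Re: "R ?e = (\<lambda>x. R ?f x - R one x)" by (rule R_diff[OF iter_V V_one])
  have eq: "(\<lambda>x. iter (Suc n) x - one x) = (\<lambda>x. inverse (lam n) * h x)"
    unfolding h_def h1_def Re using lam_nonzero[of n] by (auto simp: field_simps iter.simps(2))
  have "Nt h \<le> Nt h1 + cmod (1 - lam n) * Nt one" unfolding h_def by (rule Nt_add[OF v3 V_one])
  moreover have "Nt h1 \<le> Nt (\<lambda>x. R one x - one x) + cmod 1 * Nt (R ?e)"
    unfolding h1_def by (rule Nt_add[OF v1 v2])
  moreover have "Nt (R ?e) \<le> \<eta> * N ?e + Nt ?e / 4" by (rule R_contr_t[OF eV el])
  moreover have "\<eta> * N ?e \<le> \<eta> * W" by (rule mult_left_mono[OF N_iter eta_nonneg])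
  moreover have "Nt ?e \<le> 2 * K" using Suc unfolding K_def by (simp only: mult.assoc)
  moreover have "cmod (1 - lam n) * Nt one \<le> (\<eta> * (1 + W)) * Nt one"
    using lam_near_one[of n] Nt_nonneg[OF V_one] by (intro mult_right_mono) (simp_all add: norm_minus_commute)
  ultimately have "Nt h \<le> (\<eta> + \<eta> * W + K / 2) + (\<eta> * (1 + W)) * Nt one" using R_one_t by simp
  moreover have "\<eta> + \<eta> * W + (\<eta> * (1 + W)) * Nt one = K" by (simp add: K_def algebra_simps)
  ultimately have h: "Nt h \<le> K * (3 / 2)" by linarith
  have "Nt (\<lambda>x. iter (Suc n) x - one x) \<le> cmod (inverse (lam n)) * Nt h"
    unfolding eq by (rule Nt_scale[OF v4])
  moreover have "cmod (inverse (lam n)) * Nt h \<le> 4 / 3 * (K * (3 / 2))"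
  proof (rule mult_mono[OF _ h])
    show "cmod (inverse (lam n)) \<le> 4 / 3"
      unfolding norm_inverse using le_imp_inverse_le[OF lam_ge[of n]] by simp
  qed (use Nt_nonneg[OF v4] in auto)
  ultimately have "Nt (\<lambda>x. iter (Suc n) x - one x) \<le> 2 * K" by simp
  then show ?case unfolding K_def by (simp only: mult.assoc)
qed

end

section \<open>Scalar estimates: from products of converging factors to a Gaussian\<close>

lemma cmod_prod_minus_one_le:
  fixes x :: "nat \<Rightarrow> complex"
  assumes le: "\<And>k. cmod (x k) \<le> c * (1 / 2) ^ k" and c: "0 \<le> c" "2 * c \<le> 1"
  shows "cmod ((\<Prod>k<n. 1 + x k) - 1) \<le> 4 * c"
proof -
  have "cmod ((\<Prod>k<n. 1 + x k) - 1) \<le> (\<Prod>k<n. 1 + cmod (x k)) - 1"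
    by (rule norm_prod_minus1_le_prod_minus1)
  also have "(\<Prod>k<n. 1 + cmod (x k)) \<le> (\<Prod>k<n. exp (cmod (x k)))"
    by (intro prod_mono) (auto simp: exp_ge_add_one_self)
  also have "(\<Prod>k<n. exp (cmod (x k))) = exp (\<Sum>k<n. cmod (x k))" by (simp add: exp_sum)
  also have "(\<Sum>k<n. cmod (x k)) \<le> (\<Sum>k<n. c * (1 / 2) ^ k)" by (intro sum_mono le)
  also have "\<dots> = c * (\<Sum>k<n. (1 / 2) ^ k)" by (simp add: sum_distrib_left)
  also have "(\<Sum>k<n. (1 / 2 :: real) ^ k) \<le> (\<Sum>k. (1 / 2) ^ k)"
    by (intro sum_le_suminf summable_geometric) auto
  also have "\<dots> = 2" by (simp add: suminf_geometric)
  finally have "cmod ((\<Prod>k<n. 1 + x k) - 1) \<le> exp (c * 2) - 1" using c by (simp add: mult_left_mono)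
  also have "\<dots> \<le> 4 * c"
  proof -
    have "exp (c * 2) \<le> 1 + c * 2 + (c * 2)\<^sup>2" using c by (intro exp_bound) auto
    moreover have "(c * 2)\<^sup>2 \<le> c * 2" using c mult_left_mono[of "c * 2" 1 "c * 2"] by (simp add: power2_eq_square)
    ultimately show ?thesis by simp
  qed
  finally show ?thesis .
qed

lemma norm_power_diff_le:
  fixes x y :: complex
  assumes "cmod x \<le> M" "cmod y \<le> M"
  shows "cmod (x ^ n - y ^ n) \<le> real n * M ^ (n - 1) * cmod (x - y)"
proof (induction n)
  case (Suc n)
  have M: "0 \<le> M" using assms(1) norm_ge_zero[of x] by linarith
  have eq: "x ^ Suc n - y ^ Suc n = x * (x ^ n - y ^ n) + (x - y) * y ^ n" by (simp add: algebra_simps)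
  have "cmod (x ^ Suc n - y ^ Suc n) \<le> M * (real n * M ^ (n - 1) * cmod (x - y)) + cmod (x - y) * M ^ n"
    unfolding eq
    by (rule norm_triangle_mono; unfold norm_mult norm_power)
       (use Suc assms M in \<open>auto intro!: mult_mono mult_left_mono power_mono mult_nonneg_nonneg\<close>)
  also have "\<dots> = real (Suc n) * M ^ (Suc n - 1) * cmod (x - y)"
    by (cases n) (simp_all add: algebra_simps)
  finally show ?case .
qed simp

text \<open>\<open>(z - 1)\<close> times the sum of the powers of \<open>z\<close> is
  \<open>z ^ n - 1\<close>, and the sum has real part at least \<open>n / 2\<close>. An error valid
  at all times up to \<open>n\<close> is thereby divided by \<open>n\<close>.\<close>

lemma near_one_of_powers_near_one:
  fixes z :: complex
  assumes "\<And>q. q \<le> n \<Longrightarrow> cmod (z ^ q - 1) \<le> \<epsilon>" "\<epsilon> \<le> 1 / 2" "0 < n"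
  shows "cmod (z - 1) \<le> 2 * \<epsilon> / real n"
proof -
  have re: "1 / 2 \<le> Re (z ^ q)" if "q < n" for q
  proof -
    have "\<bar>Re (z ^ q - 1)\<bar> \<le> 1 / 2" using assms(1)[of q] assms(2) abs_Re_le_cmod[of "z ^ q - 1"] that by linarith
    then show ?thesis by (simp add: abs_if split: if_splits)
  qed
  have "real n / 2 = (\<Sum>q<n. 1 / 2)" by simp
  also have "\<dots> \<le> (\<Sum>q<n. Re (z ^ q))" by (intro sum_mono re) auto
  also have "\<dots> \<le> cmod (\<Sum>q<n. z ^ q)" using complex_Re_le_cmod[of "\<Sum>q<n. z ^ q"] by simp
  finally have s: "real n / 2 \<le> cmod (\<Sum>q<n. z ^ q)" .
  have "cmod (z - 1) * (real n / 2) \<le> cmod (z - 1) * cmod (\<Sum>q<n. z ^ q)" by (intro mult_left_mono s) auto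
  also have "\<dots> = cmod (z ^ n - 1)" unfolding norm_mult[symmetric] by (simp add: power_diff_1_eq)
  also have "\<dots> \<le> \<epsilon>" by (rule assms(1)) simp
  finally show ?thesis using assms(3) by (simp add: field_simps)
qed

lemma exp_minus_bounds:
  fixes y :: real
  assumes "0 \<le> y" "y \<le> 1 / 2"
  shows "exp (- 2 * y) \<le> 1 - y" "\<bar>(1 - y) - exp (- y)\<bar> \<le> y\<^sup>2"
proof -
  have 1: "exp (- y) \<le> 1 - y + y\<^sup>2"
  proof -
    have "1 \<le> (1 - y + y\<^sup>2) * (1 + y)" using assms by (simp add: algebra_simps power2_eq_square)
    also have "\<dots> \<le> (1 - y + y\<^sup>2) * exp y" using assms by (intro mult_left_mono exp_ge_add_one_self) auto
    finally show ?thesis by (simp add: exp_minus field_simps)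
  qed
  have 2: "1 - y \<le> exp (- y)" using exp_ge_add_one_self[of "-y"] by simp
  show "\<bar>(1 - y) - exp (- y)\<bar> \<le> y\<^sup>2" using 1 2 by simp
  have "1 \<le> (1 - y) * (1 + 2 * y)" using assms using mult_left_mono[of "2 * y" 1 y] by (simp add: algebra_simps)
  also have "\<dots> \<le> (1 - y) * exp (2 * y)" using assms by (intro mult_left_mono exp_ge_add_one_self) auto
  finally show "exp (- 2 * y) \<le> 1 - y" by (simp add: exp_minus field_simps)
qed

lemma geometric_cauchy_limit:
  fixes a :: "nat \<Rightarrow> complex"
  assumes "\<And>n. cmod (a (Suc n) - a n) \<le> c * (1 / 2) ^ n"
  obtains l where "\<And>n. cmod (a n - l) \<le> 2 * c * (1 / 2) ^ n"
proof -
  have s: "summable (\<lambda>k. c * (1 / 2) ^ (k + n))" for n :: nat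
    by (intro summable_mult summable_ignore_initial_segment summable_geometric) simp
  have sm: "summable (\<lambda>k. a (Suc (k + n)) - a (k + n))" for n
    by (rule summable_comparison_test'[OF s[of n], of 0]) (use assms in auto)
  have "summable (\<lambda>k. a (Suc k) - a k)" using sm[of 0] by simp
  then obtain d where "(\<lambda>n. \<Sum>k<n. a (Suc k) - a k) \<longlonglongrightarrow> d" by (auto simp: summable_def sums_def)
  from tendsto_add[OF this tendsto_const[of "a 0"]] obtain l where l: "a \<longlonglongrightarrow> l"
    by (auto simp: sum_lessThan_telescope)
  show ?thesis
  proof (rule that)
    fix n
    have "(\<lambda>k. a (Suc (k + n)) - a (k + n)) sums (l - a n)"
      using telescope_sums[of "\<lambda>k. a (k + n)" l] l by (simp add: LIMSEQ_ignore_initial_segment)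
    then have "l - a n = (\<Sum>k. a (Suc (k + n)) - a (k + n))" by (simp add: sums_iff)
    also have "cmod \<dots> \<le> (\<Sum>k. c * (1 / 2) ^ (k + n))"
      by (rule norm_suminf_le[OF _ s]) (use assms in auto)
    also have "\<dots> = (\<Sum>k. c * (1 / 2) ^ n * (1 / 2) ^ k)" by (simp add: power_add mult_ac)
    also have "\<dots> = 2 * c * (1 / 2) ^ n"
      by (subst suminf_mult) (simp_all add: suminf_geometric summable_geometric)
    finally show "cmod (a n - l) \<le> 2 * c * (1 / 2) ^ n" by (simp add: norm_minus_commute)
  qed
qed


text \<open>The product is \<open>l ^ q\<close> up to a relative error O(t), \<open>l\<close> being
  the limit of the factors. Compared with the known approximation for all \<open>q\<close> up to
  \<open>1/t^2\<close>, where its error is still O(t), this fixes \<open>l\<close> up to O(t^3),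
  hence up to O(t^3) as \<open>exp (- m s t^2 / 2)\<close>. The error of the powers is then of order
  \<open>q |t|^3\<close>, with Gaussian decay retained.\<close>

lemma gaussian_product_estimate:
  fixes c c' s :: real and m :: nat
  assumes c: "0 \<le> c" "0 \<le> c'" "0 < s" "0 < m"
  obtains \<delta> C a where "0 < \<delta>" "0 \<le> C" "0 < a"
    "\<And>t lam q. \<bar>t\<bar> \<le> \<delta> \<Longrightarrow> (\<And>n. cmod (lam (Suc n) - lam n) \<le> c * \<bar>t\<bar> * (1 / 2) ^ n) \<Longrightarrow>
       (\<And>n. cmod (lam n - 1) \<le> c * \<bar>t\<bar>) \<Longrightarrow>
       (\<And>q. cmod ((\<Prod>k<q. lam k) - complex_of_real (1 - s * t\<^sup>2 / 2) ^ (m * q)) \<le> c' * (\<bar>t\<bar> + real q * \<bar>t\<bar> ^ 3)) \<Longrightarrow>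
       cmod ((\<Prod>k<q. lam k) - complex_of_real (exp (- (real (m * q) * s * t\<^sup>2 / 2))))
         \<le> C * (\<bar>t\<bar> + real q * \<bar>t\<bar> ^ 3) * exp (- (a * real q * t\<^sup>2))"
proof -
  \<comment> \<open>\<open>c1\<close> bounds the relative error of \<open>l ^ q\<close>,
    \<open>b\<close> is a floor for the approximating powers up to time \<open>1/\<tau>^2\<close>,
    \<open>c2\<close> bounds the resulting error of the powers of \<open>z\<close>, and
    \<open>c3\<close> that of \<open>l\<close>. The rate \<open>a\<close> is half the true rate
    \<open>m s / 2\<close>, leaving room for the error in \<open>l\<close>. \<open>K\<close>
    collects all smallness conditions on \<open>t\<close>.\<close>
  define c1 where "c1 = 16 * c"
  define b where "b = exp (- (real m * s))"
  define c2 where "c2 = (4 * c1 + 2 * c') / b"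
  define c3 where "c3 = 4 * c2 + real m * s\<^sup>2 / 4"
  define a where "a = real m * s / 4"
  define b' where "b' = exp (- 2 * a)"
  define K where "K = 1 + 8 * c + 2 * c1 + 2 * c' + 2 * c2 + s + c3 / (b' * a)"
  have b: "0 < b" "b' > 0" "0 < a" using c by (simp_all add: b_def b'_def a_def)
  have cc: "0 \<le> c1" "0 \<le> c2" "0 \<le> c3" using c b by (simp_all add: c1_def c2_def c3_def)
  have K: "1 \<le> K" "8 * c \<le> K" "2 * c1 \<le> K" "2 * c' \<le> K" "2 * c2 \<le> K" "s \<le> K" "c3 / (b' * a) \<le> K"
    using c cc b by (simp_all add: K_def)
  show ?thesis
  proof (rule that[of "1 / K" "c1 + c3 * exp a" a])
    show "0 < 1 / K" "0 \<le> c1 + c3 * exp a" "0 < a" using K cc b by auto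
    fix t :: real and lam :: "nat \<Rightarrow> complex" and q :: nat
    assume t: "\<bar>t\<bar> \<le> 1 / K"
      and l1: "\<And>n. cmod (lam (Suc n) - lam n) \<le> c * \<bar>t\<bar> * (1 / 2) ^ n"
      and l2: "\<And>n. cmod (lam n - 1) \<le> c * \<bar>t\<bar>"
      and l3: "\<And>q. cmod ((\<Prod>k<q. lam k) - complex_of_real (1 - s * t\<^sup>2 / 2) ^ (m * q)) \<le> c' * (\<bar>t\<bar> + real q * \<bar>t\<bar> ^ 3)"
    define \<tau> where "\<tau> = \<bar>t\<bar>"
    have t2: "t\<^sup>2 = \<tau>\<^sup>2" by (simp add: \<tau>_def)
    have tau: "0 \<le> \<tau>" "\<tau> * K \<le> 1" using t K by (simp_all add: \<tau>_def field_simps)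
    have small: "x * \<tau> \<le> 1" if "x \<le> K" for x
      using mult_left_mono[OF that tau(1)] tau(2) by (simp add: mult.commute)
    have sm: "\<tau> \<le> 1" "8 * c * \<tau> \<le> 1" "2 * c1 * \<tau> \<le> 1" "2 * c' * \<tau> \<le> 1" "2 * c2 * \<tau> \<le> 1" "s * \<tau> \<le> 1" "c3 / (b' * a) * \<tau> \<le> 1"
      using small[OF K(1)] small[OF K(2)] small[OF K(3)] small[OF K(4)] small[OF K(5)] small[OF K(6)] small[OF K(7)] by simp_all
    define P where "P q = (\<Prod>k<q. lam k)" for q
    obtain l where l: "\<And>n. cmod (lam n - l) \<le> 2 * (c * \<tau>) * (1 / 2) ^ n"
      using geometric_cauchy_limit[OF l1] unfolding \<tau>_def by metis
    have lge: "1 / 2 \<le> cmod l"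
    proof -
      have "cmod (lam 0 - l) \<le> 2 * (c * \<tau>)" using l[of 0] by simp
      moreover have "cmod (lam 0 - 1) \<le> c * \<tau>" using l2[of 0] by (simp add: \<tau>_def)
      moreover have "1 \<le> cmod (lam 0 - 1) + cmod (lam 0 - l) + cmod l"
        using norm_triangle_ineq4[of "lam 0" "lam 0 - 1"] norm_triangle_ineq[of "lam 0 - l" l] by simp
      ultimately show ?thesis using sm(2) by linarith
    qed
    then have l0: "l \<noteq> 0" by auto
    \<comment> \<open>As \<open>l\<close> is at least 1/2 in modulus, dividing by it doubles the
      distance \<open>2 * c * \<tau> * (1/2)^k\<close> of the k-th factor from \<open>l\<close>; the
      product bound multiplies by 4 again, whence the 16.\<close>
    have ratio: "cmod (P q / l ^ q - 1) \<le> c1 * \<tau>" for q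
    proof -
      have "cmod (lam k / l - 1) \<le> 4 * (c * \<tau>) * (1 / 2) ^ k" for k
      proof -
        have "cmod (lam k / l - 1) = cmod (lam k - l) / cmod l"
          using l0 by (simp add: diff_divide_distrib flip: norm_divide)
        also have "\<dots> \<le> (2 * (c * \<tau>) * (1 / 2) ^ k) / (1 / 2)"
          using l[of k] lge c tau by (intro frac_le) auto
        finally show ?thesis by simp
      qed
      then have "cmod ((\<Prod>k<q. 1 + (lam k / l - 1)) - 1) \<le> 4 * (4 * (c * \<tau>))"
        using c tau sm(2) by (intro cmod_prod_minus_one_le) auto
      then show ?thesis by (simp add: P_def prod_dividef c1_def)
    qed
    have Pl: "cmod (P q - l ^ q) \<le> cmod l ^ q * (c1 * \<tau>)" for q
    proof -
      have "P q - l ^ q = l ^ q * (P q / l ^ q - 1)" using l0 by (simp add: field_simps)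
      then have "cmod (P q - l ^ q) = cmod l ^ q * cmod (P q / l ^ q - 1)" by (simp add: norm_mult norm_power)
      then show ?thesis using ratio[of q] by (simp add: mult_left_mono)
    qed
    define y where "y = s * \<tau>\<^sup>2 / 2"
    define r where "r = 1 - y"
    have y: "0 \<le> y" "y \<le> 1 / 2"
    proof -
      show "0 \<le> y" using c by (simp add: y_def)
      have "(s * \<tau>) * \<tau> \<le> 1 * 1" using sm(1,6) c tau by (intro mult_mono) auto
      then show "y \<le> 1 / 2" by (simp add: y_def power2_eq_square)
    qed
    have r: "0 < r" "r \<le> 1" "exp (- 2 * y) \<le> r" "\<bar>r - exp (- y)\<bar> \<le> y\<^sup>2"
      using y exp_minus_bounds[OF y] by (simp_all add: r_def)
    define u where "u = a * \<tau>\<^sup>2"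
    define e where "e = exp (- (2 * u))"
    have u: "0 \<le> u" "u \<le> a" using b sm(1) tau by (simp_all add: u_def mult_left_le power_le_one)
    have e_alt: "e = exp (- y) ^ m"
      by (simp add: e_def u_def a_def y_def exp_of_nat_mult[symmetric] mult_ac)
    have eq_exp: "exp (- (real (m * q) * s * t\<^sup>2 / 2)) = e ^ q"
      by (simp add: t2 e_def u_def a_def exp_of_nat_mult[symmetric] mult_ac)
    have key: "cmod (l - complex_of_real e) \<le> c3 * \<tau> ^ 3"
    proof (cases "\<tau> = 0")
      case True
      then have "l = 1" using l[of 0] l2[of 0] by (simp add: \<tau>_def)
      then show ?thesis using True by (simp add: e_def u_def)
    next
      case False
      then have tp: "0 < \<tau>" using tau by simp
      \<comment> \<open>The last time at which the accumulated error \<open>q * \<tau>^3\<close> is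
        still at most \<open>\<tau>\<close>. Rounding down costs a factor of at most 2.\<close>
      define Q where "Q = nat \<lfloor>1 / \<tau>\<^sup>2\<rfloor>"
      have one: "1 \<le> 1 / \<tau>\<^sup>2" using tp sm(1) by (simp add: power_le_one)
      have Q1: "real Q * \<tau>\<^sup>2 \<le> 1"
      proof -
        have "real Q \<le> 1 / \<tau>\<^sup>2" unfolding Q_def using one by (simp add: of_nat_floor)
        then show ?thesis using tp by (simp add: field_simps)
      qed
      have Q2: "1 / (2 * \<tau>\<^sup>2) \<le> real Q" "0 < Q"
      proof -
        have f: "1 \<le> \<lfloor>1 / \<tau>\<^sup>2\<rfloor>" using one by (simp add: le_floor_iff)
        then have "real Q = real_of_int \<lfloor>1 / \<tau>\<^sup>2\<rfloor>" by (simp add: Q_def)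
        moreover have "1 / \<tau>\<^sup>2 < real_of_int \<lfloor>1 / \<tau>\<^sup>2\<rfloor> + 1" by linarith
        ultimately have "1 / \<tau>\<^sup>2 \<le> 2 * real Q" using f by linarith
        then show "1 / (2 * \<tau>\<^sup>2) \<le> real Q" using tp by (simp add: field_simps)
        show "0 < Q" using f by (simp add: Q_def)
      qed
      define \<rho> where "\<rho> = r ^ m"
      have rho: "0 < \<rho>" "\<rho> \<le> 1" using r by (simp_all add: \<rho>_def power_le_one)
      define z where "z = l / complex_of_real \<rho>"
      have zq: "cmod (z ^ q - 1) \<le> c2 * \<tau>" if "q \<le> Q" for q
      proof -
        have q: "real q * \<tau>\<^sup>2 \<le> 1"
          using Q1 that mult_right_mono[of "real q" "real Q" "\<tau>\<^sup>2"] by simp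
        have q3: "real q * \<tau> ^ 3 \<le> \<tau>"
          using mult_right_mono[OF q tau(1)] by (simp add: power3_eq_cube power2_eq_square mult.assoc)
        have rq: "b \<le> \<rho> ^ q"
        proof -
          have "b \<le> exp (- (real m * s) * (real q * \<tau>\<^sup>2))"
            unfolding b_def using q c mult_left_mono[OF q, of "real m * s"] by simp
          also have "\<dots> = exp (- 2 * y) ^ (m * q)"
            by (simp add: y_def exp_of_nat_mult[symmetric] mult_ac)
          also have "\<dots> \<le> r ^ (m * q)" using r by (intro power_mono) auto
          finally show ?thesis by (simp add: \<rho>_def power_mult)
        qed
        have "cmod (P q - complex_of_real r ^ (m * q)) \<le> c' * (\<tau> + real q * \<tau> ^ 3)"
          using l3[of q] by (simp add: P_def r_def y_def t2 flip: \<tau>_def)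
        also have "\<dots> \<le> c' * (\<tau> + \<tau>)" using q3 c by (intro mult_left_mono add_left_mono)
        finally have Pr: "cmod (P q - complex_of_real (\<rho> ^ q)) \<le> 2 * c' * \<tau>"
          by (simp add: \<rho>_def power_mult)
        have rq1: "\<rho> ^ q \<le> 1" using rho by (simp add: power_le_one)
        have "cmod (P q) \<le> cmod (P q - complex_of_real (\<rho> ^ q)) + cmod (complex_of_real (\<rho> ^ q))"
          using norm_triangle_ineq[of "P q - complex_of_real (\<rho> ^ q)" "complex_of_real (\<rho> ^ q)"] by simp
        then have Pq: "cmod (P q) \<le> 2" using Pr sm(4) rq1 rho by (simp del: of_real_power)
        \<comment> \<open>\<open>P q\<close> is at most 2 in modulus and at least half of
          \<open>l ^ q\<close>, so \<open>l ^ q\<close> is bounded for \<open>q \<le> Q\<close>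
          without any prior estimate of \<open>l\<close> from above.\<close>
        have w: "1 / 2 \<le> cmod (P q / l ^ q)"
          using ratio[of q] sm(3) norm_triangle_ineq4[of "P q / l ^ q" "P q / l ^ q - 1"] by simp
        have "cmod (P q) = cmod (P q / l ^ q) * cmod l ^ q" using l0 by (simp add: norm_divide norm_power)
        then have "1 / 2 * cmod l ^ q \<le> cmod (P q)" using mult_right_mono[OF w, of "cmod l ^ q"] by simp
        then have lq: "cmod l ^ q \<le> 4" using Pq by simp
        have "cmod (P q - l ^ q) \<le> 4 * (c1 * \<tau>)"
          using Pl[of q] mult_right_mono[OF lq, of "c1 * \<tau>"] cc tau by simp
        then have "cmod (l ^ q - complex_of_real (\<rho> ^ q)) \<le> (4 * c1 + 2 * c') * \<tau>"
          using norm_triangle_mono[OF _ Pr, of "l ^ q - P q" "4 * (c1 * \<tau>)"] by (simp add: norm_minus_commute algebra_simps)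
        then have n: "cmod (l ^ q - complex_of_real (\<rho> ^ q)) / \<rho> ^ q \<le> (4 * c1 + 2 * c') * \<tau> / b"
          using rq b cc c tau by (intro frac_le) auto
        have "z ^ q - 1 = (l ^ q - complex_of_real (\<rho> ^ q)) / complex_of_real (\<rho> ^ q)"
          using rho by (simp add: z_def field_simps)
        then have "cmod (z ^ q - 1) = cmod (l ^ q - complex_of_real (\<rho> ^ q)) / \<rho> ^ q"
          using rho by (simp add: norm_divide del: of_real_power)
        then show ?thesis using n by (simp add: c2_def)
      qed
      have "cmod (z - 1) \<le> 2 * (c2 * \<tau>) / real Q"
        by (rule near_one_of_powers_near_one) (use zq sm(5) Q2 in auto)
      also have "\<dots> \<le> 2 * (c2 * \<tau>) / (1 / (2 * \<tau>\<^sup>2))"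
        using Q2 cc tau tp by (intro divide_left_mono) auto
      also have "\<dots> = 4 * c2 * \<tau> ^ 3" by (simp add: power3_eq_cube power2_eq_square)
      finally have z1: "cmod (z - 1) \<le> 4 * c2 * \<tau> ^ 3" .
      have "l - complex_of_real \<rho> = complex_of_real \<rho> * (z - 1)" using rho by (simp add: z_def field_simps)
      then have "cmod (l - complex_of_real \<rho>) = \<rho> * cmod (z - 1)" using rho by (simp add: norm_mult)
      also have "\<dots> \<le> 1 * (4 * c2 * \<tau> ^ 3)" using rho z1 by (intro mult_mono) auto
      finally have 1: "cmod (l - complex_of_real \<rho>) \<le> 4 * c2 * \<tau> ^ 3" by simp
      \<comment> \<open>Passing from \<open>1 - y\<close> to \<open>exp (- y)\<close> costs
        \<open>y^2\<close>, of order \<open>\<tau>^4\<close>, which is better than required.\<close>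
      have "\<bar>\<rho> - e\<bar> \<le> real m * \<bar>r - exp (- y)\<bar>"
        using norm_power_diff[of r "exp (- y)" m] r y by (simp add: \<rho>_def e_alt)
      also have "\<dots> \<le> real m * y\<^sup>2" using r by (intro mult_left_mono) auto
      also have "\<dots> = real m * s\<^sup>2 / 4 * \<tau> ^ 3 * \<tau>" by (simp add: y_def power2_eq_square power3_eq_cube)
      also have "\<dots> \<le> real m * s\<^sup>2 / 4 * \<tau> ^ 3 * 1" using sm(1) tau by (intro mult_left_mono) auto
      finally have 2: "cmod (complex_of_real \<rho> - complex_of_real e) \<le> real m * s\<^sup>2 / 4 * \<tau> ^ 3"
        by (simp flip: of_real_diff)
      show ?thesis using norm_triangle_mono[OF 1 2] by (simp add: c3_def algebra_simps)
    qed
    have eu: "e \<le> exp (- u)" using u by (simp add: e_def)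
    \<comment> \<open>Half of the Gaussian decay pays for the error in \<open>l\<close>: \<open>e +
      c3 * \<tau>^3 \<le> e * (1 + u) \<le> e * exp u = exp (- u)\<close>. The floor
      \<open>b'\<close> for \<open>e\<close> comes from \<open>u \<le> a\<close>.\<close>
    have lu: "cmod l \<le> exp (- u)"
    proof -
      have "c3 * \<tau> \<le> b' * a" using sm(7) b by (simp add: field_simps)
      then have "c3 * \<tau> * \<tau>\<^sup>2 \<le> b' * a * \<tau>\<^sup>2" by (intro mult_right_mono) auto
      then have "c3 * \<tau> ^ 3 \<le> b' * u" by (simp add: u_def power3_eq_cube power2_eq_square mult_ac)
      also have "\<dots> \<le> e * u" using u by (intro mult_right_mono) (auto simp: b'_def e_def)
      finally have "e + c3 * \<tau> ^ 3 \<le> e * (1 + u)" by (simp add: algebra_simps)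
      also have "\<dots> \<le> e * exp u" by (intro mult_left_mono exp_ge_add_one_self) (simp add: e_def)
      also have "\<dots> = exp (- u)" by (simp add: e_def flip: exp_add)
      finally have "e + c3 * \<tau> ^ 3 \<le> exp (- u)" .
      moreover have "cmod l \<le> cmod (l - complex_of_real e) + e"
        using norm_triangle_ineq[of "l - complex_of_real e" "complex_of_real e"] by (simp add: e_def)
      ultimately show ?thesis using key by linarith
    qed
    have luq: "cmod l ^ q \<le> exp (- (u * real q))"
      using power_mono[OF lu norm_ge_zero, of q] by (simp add: exp_of_nat_mult[symmetric] mult_ac)
    have A: "cmod (P q - l ^ q) \<le> exp (- (u * real q)) * (c1 * \<tau>)"
      using Pl[of q] mult_right_mono[OF luq, of "c1 * \<tau>"] cc tau by simp
    have B: "cmod (l ^ q - complex_of_real e ^ q) \<le> exp (- (u * real q)) * (c3 * exp a * (real q * \<tau> ^ 3))"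
    proof (cases q)
      case (Suc k)
      have "cmod (l ^ q - complex_of_real e ^ q) \<le> real q * exp (- u) ^ (q - 1) * cmod (l - complex_of_real e)"
        using lu eu by (intro norm_power_diff_le) (auto simp: e_def)
      also have "\<dots> \<le> real q * exp (- u) ^ (q - 1) * (c3 * \<tau> ^ 3)" using key by (intro mult_left_mono) auto
      \<comment> \<open>The missing power in \<open>q - 1\<close> is made up by a factor
        \<open>exp u\<close>, which is at most \<open>exp a\<close>.\<close>
      also have "exp (- u) ^ (q - 1) = exp (- (u * real q)) * exp u"
        using Suc by (simp add: exp_of_nat_mult[symmetric] algebra_simps flip: exp_add)
      also have "real q * (exp (- (u * real q)) * exp u) * (c3 * \<tau> ^ 3) \<le> real q * (exp (- (u * real q)) * exp a) * (c3 * \<tau> ^ 3)"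
        using u cc tau by (intro mult_right_mono mult_left_mono) auto
      finally show ?thesis by (simp add: mult_ac)
    qed simp
    have "cmod (P q - complex_of_real e ^ q) \<le> exp (- (u * real q)) * (c1 * \<tau>) + exp (- (u * real q)) * (c3 * exp a * (real q * \<tau> ^ 3))"
      using norm_triangle_mono[OF A B] by simp
    also have "\<dots> = exp (- (u * real q)) * (c1 * \<tau> + c3 * exp a * (real q * \<tau> ^ 3))" by (simp add: distrib_left)
    also have "\<dots> \<le> exp (- (u * real q)) * ((c1 + c3 * exp a) * (\<tau> + real q * \<tau> ^ 3))"
      using cc tau by (intro mult_left_mono) (auto simp: algebra_simps)
    also have "\<dots> = (c1 + c3 * exp a) * (\<bar>t\<bar> + real q * \<bar>t\<bar> ^ 3) * exp (- (a * real q * t\<^sup>2))"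
      by (simp add: u_def t2 mult_ac flip: \<tau>_def)
    finally show "cmod ((\<Prod>k<q. lam k) - complex_of_real (exp (- (real (m * q) * s * t\<^sup>2 / 2))))
         \<le> (c1 + c3 * exp a) * (\<bar>t\<bar> + real q * \<bar>t\<bar> ^ 3) * exp (- (a * real q * t\<^sup>2))"
      unfolding eq_exp P_def by simp
  qed
qed

section \<open>Families of operators near an ergodic one\<close>

lemma geometric_small:
  fixes A r e :: real
  assumes "0 \<le> A" "0 \<le> r" "r < 1" "0 < e"
  shows "\<forall>\<^sub>F n in sequentially. A * r ^ n \<le> e"
proof -
  have "(\<lambda>n. A * r ^ n) \<longlonglongrightarrow> A * 0" using assms by (intro tendsto_intros LIMSEQ_power_zero) auto
  then have "\<forall>\<^sub>F n in sequentially. A * r ^ n < e" using assms by (intro order_tendstoD) auto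
  then show ?thesis by (rule eventually_mono) simp
qed

text \<open>\<open>l1\<close> is the L^1 norm of \<open>\<nu>\<close>. The distance from
  \<open>P t\<close> to \<open>P 0\<close> is O(t) only from \<open>N\<close> into \<open>l1\<close>
  and into \<open>Nt\<close>; no continuity in \<open>N\<close> is available. Ergodicity is
  expressed on the kernel of \<open>L\<close>, where the limit of the powers is 0.\<close>

locale perturbed_family = seminormed_functions V one N Nt L
  for V :: "('e \<Rightarrow> complex) set" and one N Nt L +
  fixes l1 :: "('e \<Rightarrow> complex) \<Rightarrow> real" and P :: "real \<Rightarrow> ('e \<Rightarrow> complex) \<Rightarrow> ('e \<Rightarrow> complex)"
    and C \<kappa> C0 \<kappa>0 C1 \<kappa>1 c L1 L2 \<delta>0 :: real
  assumes P_V: "\<And>t f. \<bar>t\<bar> < \<delta>0 \<Longrightarrow> f \<in> V \<Longrightarrow> P t f \<in> V"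
    and P_add: "\<And>t f g a. \<bar>t\<bar> < \<delta>0 \<Longrightarrow> f \<in> V \<Longrightarrow> g \<in> V \<Longrightarrow> P t (\<lambda>x. f x + a * g x) = (\<lambda>x. P t f x + a * P t g x)"
    and P0_one: "P 0 one = one"
    and l1_add: "\<And>f g a. f \<in> V \<Longrightarrow> g \<in> V \<Longrightarrow> l1 (\<lambda>x. f x + a * g x) \<le> l1 f + cmod a * l1 g"
    and L_le: "\<And>f. f \<in> V \<Longrightarrow> cmod (L f) \<le> l1 f"
    and l1_N: "\<And>f. f \<in> V \<Longrightarrow> l1 f \<le> L1 * N f"
    and lasota_yorke: "\<And>t n f. \<bar>t\<bar> < \<delta>0 \<Longrightarrow> 1 \<le> n \<Longrightarrow> f \<in> V \<Longrightarrow> N ((P t ^^ n) f) \<le> C * \<kappa> ^ n * N f + C * l1 f"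
    and ergodic: "\<And>n f. 1 \<le> n \<Longrightarrow> f \<in> V \<Longrightarrow> L f = 0 \<Longrightarrow> N ((P 0 ^^ n) f) \<le> C0 * \<kappa>0 ^ n * N f"
    and ergodic_t: "\<And>n f. 1 \<le> n \<Longrightarrow> f \<in> V \<Longrightarrow> L f = 0 \<Longrightarrow> Nt ((P 0 ^^ n) f) \<le> C1 * \<kappa>1 ^ n * Nt f"
    and l1_perturb: "\<And>t f. \<bar>t\<bar> < \<delta>0 \<Longrightarrow> f \<in> V \<Longrightarrow> l1 (\<lambda>x. P t f x - P 0 f x) \<le> c * \<bar>t\<bar> * N f"
    and Nt_perturb: "\<And>t f. \<bar>t\<bar> < \<delta>0 \<Longrightarrow> f \<in> V \<Longrightarrow> Nt (\<lambda>x. P t f x - P 0 f x) \<le> c * \<bar>t\<bar> * N f"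
    and l1_P0: "\<And>f. f \<in> V \<Longrightarrow> l1 (P 0 f) \<le> l1 f"
    and L_P0: "\<And>f. f \<in> V \<Longrightarrow> L (P 0 f) = L f"
    and Nt_P0: "\<And>f. f \<in> V \<Longrightarrow> Nt (P 0 f) \<le> L2 * Nt f"
    and bounds: "0 \<le> C" "0 \<le> \<kappa>" "\<kappa> < 1" "0 \<le> C0" "0 \<le> \<kappa>0" "\<kappa>0 < 1" "0 \<le> C1" "0 \<le> \<kappa>1" "\<kappa>1 < 1"
      "0 \<le> c" "0 \<le> L1" "0 \<le> L2" "0 < \<delta>0"
begin

lemma pow_V: "\<bar>t\<bar> < \<delta>0 \<Longrightarrow> f \<in> V \<Longrightarrow> (P t ^^ n) f \<in> V"
  by (induction n) (auto intro: P_V)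

lemma pow_add:
  "\<bar>t\<bar> < \<delta>0 \<Longrightarrow> f \<in> V \<Longrightarrow> g \<in> V \<Longrightarrow> (P t ^^ n) (\<lambda>x. f x + a * g x) = (\<lambda>x. (P t ^^ n) f x + a * (P t ^^ n) g x)"
  by (induction n) (simp_all add: P_add pow_V)

definition D0 :: real where "D0 = C + C * L1 + 1"

lemma D0: "1 \<le> D0" using bounds by (simp add: D0_def)

lemma pow_bound:
  assumes t: "\<bar>t\<bar> < \<delta>0" and f: "f \<in> V"
  shows "N ((P t ^^ n) f) \<le> D0 * N f"
proof (cases "n = 0")
  case True
  then show ?thesis using mult_right_mono[OF D0 N_nonneg[OF f]] by simp
next
  case False
  have "N ((P t ^^ n) f) \<le> C * \<kappa> ^ n * N f + C * l1 f" by (rule lasota_yorke[OF t _ f]) (use False in simp)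
  also have "\<dots> \<le> C * 1 * N f + C * (L1 * N f)"
    using bounds N_nonneg[OF f] l1_N[OF f]
    by (intro add_mono mult_right_mono mult_left_mono) (auto simp: power_le_one)
  also have "\<dots> \<le> D0 * N f" using N_nonneg[OF f] by (simp add: D0_def algebra_simps)
  finally show ?thesis .
qed

abbreviation drift :: "real \<Rightarrow> nat \<Rightarrow> ('e \<Rightarrow> complex) \<Rightarrow> 'e \<Rightarrow> complex" where
  "drift t n f \<equiv> \<lambda>x. (P t ^^ n) f x - (P 0 ^^ n) f x"

lemma drift_V: "\<bar>t\<bar> < \<delta>0 \<Longrightarrow> f \<in> V \<Longrightarrow> drift t n f \<in> V"
  using bounds by (intro V_diff pow_V) auto

lemma P0_diff: "f \<in> V \<Longrightarrow> g \<in> V \<Longrightarrow> P 0 (\<lambda>x. f x - g x) = (\<lambda>x. P 0 f x - P 0 g x)"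
  using P_add[of 0 f g "-1"] bounds by simp

text \<open>In this order the perturbation acts on an iterate of \<open>P t\<close>, whose strong
  norm is uniformly bounded, and afterwards only \<open>P 0\<close> acts, which is bounded in both
  weak norms. The opposite splitting would apply \<open>P t\<close> in a weak norm.\<close>

lemma drift_Suc:
  assumes t: "\<bar>t\<bar> < \<delta>0" and f: "f \<in> V"
  shows "drift t (Suc n) f = (\<lambda>x. (P t ((P t ^^ n) f) x - P 0 ((P t ^^ n) f) x) + 1 * P 0 (drift t n f) x)"
proof -
  have "P 0 (drift t n f) = (\<lambda>x. P 0 ((P t ^^ n) f) x - P 0 ((P 0 ^^ n) f) x)"
    using t f bounds by (intro P0_diff pow_V) auto
  then show ?thesis by simp
qed

lemma step_V: "\<bar>t\<bar> < \<delta>0 \<Longrightarrow> f \<in> V \<Longrightarrow> (\<lambda>x. P t ((P t ^^ n) f) x - P 0 ((P t ^^ n) f) x) \<in> V"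
  using bounds by (intro V_diff P_V pow_V) auto

lemma l1_drift:
  assumes t: "\<bar>t\<bar> < \<delta>0" and f: "f \<in> V"
  shows "l1 (drift t n f) \<le> real n * (c * D0) * \<bar>t\<bar> * N f"
proof (induction n)
  case 0
  have z: "(\<lambda>x. f x + (-1) * f x) = (\<lambda>x. 0)" by simp
  have "l1 (\<lambda>x. f x + (-1) * f x) \<le> L1 * N (\<lambda>x. f x + (-1) * f x)" by (rule l1_N[OF V_add[OF f f]])
  moreover have "N (\<lambda>x. 0) \<le> 0" using N_scale[OF f, of 0] by simp
  ultimately have "l1 (\<lambda>x. 0) \<le> 0" unfolding z using bounds mult_nonneg_nonpos[of L1 "N (\<lambda>x. 0)"] by linarith
  then show ?case by simp
next
  case (Suc n)
  have "l1 (drift t (Suc n) f) \<le> l1 (\<lambda>x. P t ((P t ^^ n) f) x - P 0 ((P t ^^ n) f) x) + cmod 1 * l1 (P 0 (drift t n f))"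
    unfolding drift_Suc[OF t f] by (rule l1_add[OF step_V[OF t f] P_V[OF _ drift_V[OF t f]]]) (use bounds in simp)
  moreover have "l1 (\<lambda>x. P t ((P t ^^ n) f) x - P 0 ((P t ^^ n) f) x) \<le> c * \<bar>t\<bar> * N ((P t ^^ n) f)"
    by (rule l1_perturb[OF t pow_V[OF t f]])
  moreover have "c * \<bar>t\<bar> * N ((P t ^^ n) f) \<le> c * \<bar>t\<bar> * (D0 * N f)"
    using bounds by (intro mult_left_mono pow_bound[OF t f]) auto
  moreover have "l1 (P 0 (drift t n f)) \<le> real n * (c * D0) * \<bar>t\<bar> * N f"
    using l1_P0[OF drift_V[OF t f]] Suc by (rule order_trans)
  ultimately have "l1 (drift t (Suc n) f) \<le> c * \<bar>t\<bar> * (D0 * N f) + real n * (c * D0) * \<bar>t\<bar> * N f" by simp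
  then show ?case by (simp add: algebra_simps)
qed

text \<open>The constant of the drift in \<open>Nt\<close> after \<open>n\<close> steps. It may grow
  geometrically since \<open>P 0\<close> is only bounded by \<open>L2\<close> there; it is applied
  for boundedly many \<open>n\<close>.\<close>

fun et :: "nat \<Rightarrow> real" where
  "et 0 = 0"
| "et (Suc n) = c * D0 + L2 * et n"

lemma et_nonneg: "0 \<le> et n"
  using bounds D0 by (induction n) auto

lemma Nt_drift:
  assumes t: "\<bar>t\<bar> < \<delta>0" and f: "f \<in> V"
  shows "Nt (drift t n f) \<le> et n * \<bar>t\<bar> * N f"
proof (induction n)
  case 0
  have "Nt (\<lambda>x. 0 * f x) \<le> 0" using Nt_scale[OF f, of 0] by simp
  then show ?case by simp
next
  case (Suc n)
  have "Nt (drift t (Suc n) f) \<le> Nt (\<lambda>x. P t ((P t ^^ n) f) x - P 0 ((P t ^^ n) f) x) + cmod 1 * Nt (P 0 (drift t n f))"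
    unfolding drift_Suc[OF t f] by (rule Nt_add[OF step_V[OF t f] P_V[OF _ drift_V[OF t f]]]) (use bounds in simp)
  moreover have "Nt (\<lambda>x. P t ((P t ^^ n) f) x - P 0 ((P t ^^ n) f) x) \<le> c * \<bar>t\<bar> * N ((P t ^^ n) f)"
    by (rule Nt_perturb[OF t pow_V[OF t f]])
  moreover have "c * \<bar>t\<bar> * N ((P t ^^ n) f) \<le> c * \<bar>t\<bar> * (D0 * N f)"
    using bounds by (intro mult_left_mono pow_bound[OF t f]) auto
  moreover have "Nt (P 0 (drift t n f)) \<le> L2 * Nt (drift t n f)" by (rule Nt_P0[OF drift_V[OF t f]])
  moreover have "L2 * Nt (drift t n f) \<le> L2 * (et n * \<bar>t\<bar> * N f)" using Suc bounds by (intro mult_left_mono) auto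
  ultimately have "Nt (drift t (Suc n) f) \<le> c * \<bar>t\<bar> * (D0 * N f) + L2 * (et n * \<bar>t\<bar> * N f)" by simp
  then show ?case by (simp add: algebra_simps)
qed

lemma L_P0_pow: "f \<in> V \<Longrightarrow> L ((P 0 ^^ n) f) = L f"
  using bounds by (induction n) (simp_all add: L_P0 pow_V)

lemma P0_pow_one: "(P 0 ^^ n) one = one"
  by (induction n) (simp_all add: P0_one)

lemma L_drift:
  assumes t: "\<bar>t\<bar> < \<delta>0" and f: "f \<in> V"
  shows "cmod (L ((P t ^^ n) f) - L f) \<le> real n * (c * D0) * \<bar>t\<bar> * N f"
proof -
  have "L (drift t n f) = L ((P t ^^ n) f) - L f"
    using l_diff[OF pow_V[OF t f, of n] pow_V[of 0, OF _ f, of n]] bounds by (simp add: L_P0_pow[OF f])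
  then show ?thesis using L_le[OF drift_V[OF t f], of n] l1_drift[OF t f, of n] by simp
qed

lemma pow_split:
  assumes t: "\<bar>t\<bar> < \<delta>0" and f: "f \<in> V"
  shows "l1 ((P t ^^ n) f) \<le> l1 ((P 0 ^^ n) f) + l1 (drift t n f)"
    and "Nt ((P t ^^ n) f) \<le> Nt ((P 0 ^^ n) f) + Nt (drift t n f)"
proof -
  have v: "(P 0 ^^ n) f \<in> V" using f bounds by (intro pow_V) auto
  have eq: "(P t ^^ n) f = (\<lambda>x. (P 0 ^^ n) f x + 1 * drift t n f x)" by simp
  show "l1 ((P t ^^ n) f) \<le> l1 ((P 0 ^^ n) f) + l1 (drift t n f)"
    using l1_add[OF v drift_V[OF t f, of n], of 1] by simp
  show "Nt ((P t ^^ n) f) \<le> Nt ((P 0 ^^ n) f) + Nt (drift t n f)"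
    using Nt_add[OF v drift_V[OF t f, of n], of 1] by simp
qed

text \<open>The last \<open>k\<close> steps use the Lasota-Yorke inequality, whose weak term is the
  L^1 norm after \<open>n\<close> steps. That norm is exponentially small for \<open>P 0\<close> on
  the kernel of \<open>L\<close>, up to a drift O(t). This is how weak continuity yields a strong
  contraction.\<close>

lemma pow_contraction:
  assumes t: "\<bar>t\<bar> < \<delta>0" and f: "f \<in> V" and L: "L f = 0" and kn: "1 \<le> k" "1 \<le> n"
  shows "N ((P t ^^ (k + n)) f) \<le> (C * \<kappa> ^ k * D0 + C * L1 * C0 * \<kappa>0 ^ n + C * real n * (c * D0) * \<bar>t\<bar>) * N f"
proof -
  have fn: "(P t ^^ n) f \<in> V" by (rule pow_V[OF t f])
  have v0: "(P 0 ^^ n) f \<in> V" using f bounds by (intro pow_V) auto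
  have "N ((P t ^^ (k + n)) f) \<le> C * \<kappa> ^ k * N ((P t ^^ n) f) + C * l1 ((P t ^^ n) f)"
    using lasota_yorke[OF t kn(1) fn] by (simp add: funpow_add)
  moreover have "C * \<kappa> ^ k * N ((P t ^^ n) f) \<le> C * \<kappa> ^ k * (D0 * N f)"
    using bounds by (intro mult_left_mono pow_bound[OF t f]) auto
  moreover have "l1 ((P t ^^ n) f) \<le> L1 * (C0 * \<kappa>0 ^ n * N f) + real n * (c * D0) * \<bar>t\<bar> * N f"
  proof -
    have "l1 ((P 0 ^^ n) f) \<le> L1 * N ((P 0 ^^ n) f)" by (rule l1_N[OF v0])
    moreover have "L1 * N ((P 0 ^^ n) f) \<le> L1 * (C0 * \<kappa>0 ^ n * N f)"
      using bounds by (intro mult_left_mono ergodic[OF kn(2) f L]) auto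
    ultimately show ?thesis using pow_split(1)[OF t f, of n] l1_drift[OF t f, of n] by linarith
  qed
  then have "C * l1 ((P t ^^ n) f) \<le> C * (L1 * (C0 * \<kappa>0 ^ n * N f) + real n * (c * D0) * \<bar>t\<bar> * N f)"
    using bounds by (intro mult_left_mono) auto
  ultimately have "N ((P t ^^ (k + n)) f) \<le> C * \<kappa> ^ k * (D0 * N f) + C * (L1 * (C0 * \<kappa>0 ^ n * N f) + real n * (c * D0) * \<bar>t\<bar> * N f)"
    by linarith
  then show ?thesis by (simp add: algebra_simps)
qed

theorem perturbed_operator_pow:
  obtains m \<delta> b D where "0 < m" "0 < \<delta>" "\<delta> \<le> \<delta>0" "0 \<le> b"
    "\<And>t. \<bar>t\<bar> < \<delta> \<Longrightarrow> perturbed_operator V one N Nt L (P t ^^ m) D (b * \<bar>t\<bar>)"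
proof -
  \<comment> \<open>The required 1/4 in \<open>N\<close> is divided as 1/16 for ergodicity, 1/16 for
    Lasota-Yorke and 1/8 for the drift. The number of steps is fixed before \<open>t\<close> is made
    small, since the drift grows with it.\<close>
  have "\<forall>\<^sub>F n in sequentially. C * L1 * C0 * \<kappa>0 ^ n \<le> 1 / 16"
    using bounds by (intro geometric_small) auto
  moreover have "\<forall>\<^sub>F n in sequentially. C1 * \<kappa>1 ^ n \<le> 1 / 4" using bounds by (intro geometric_small) auto
  moreover have "\<forall>\<^sub>F n in sequentially. C * D0 * \<kappa> ^ n \<le> 1 / 16" using bounds D0 by (intro geometric_small) auto
  ultimately have "\<forall>\<^sub>F n in sequentially. C * L1 * C0 * \<kappa>0 ^ n \<le> 1 / 16 \<and> C1 * \<kappa>1 ^ n \<le> 1 / 4 \<and> C * D0 * \<kappa> ^ n \<le> 1 / 16"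
    by eventually_elim auto
  then obtain n0 where n0: "\<And>n. n0 \<le> n \<Longrightarrow> C * L1 * C0 * \<kappa>0 ^ n \<le> 1 / 16 \<and> C1 * \<kappa>1 ^ n \<le> 1 / 4 \<and> C * D0 * \<kappa> ^ n \<le> 1 / 16"
    by (auto simp: eventually_sequentially)
  define n where "n = Suc n0"
  have n: "C * L1 * C0 * \<kappa>0 ^ n \<le> 1 / 16" "C1 * \<kappa>1 ^ (n + n) \<le> 1 / 4" "C * D0 * \<kappa> ^ n \<le> 1 / 16" "1 \<le> n"
    using n0[of n] n0[of "n + n"] by (auto simp: n_def)
  \<comment> \<open>The factor \<open>1 + N one\<close> lets one constant serve the drift of a
    general \<open>f\<close>, measured against \<open>N f\<close>, and that of \<open>one\<close>,
    where \<open>N one\<close> goes into the constant.\<close>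
  define b where "b = (real (n + n) * (c * D0) + et (n + n)) * (1 + N one)"
  define D where "D = D0 * N one"
  define A where "A = C * real n * (c * D0)"
  define B where "B = b * (1 + 2 * D + 3 * N one)"
  have N1: "0 \<le> N one" by (rule N_nonneg[OF V_one])
  have nn: "0 \<le> b" "0 \<le> D" "0 \<le> A" "0 \<le> B"
    using N1 D0 bounds et_nonneg by (auto simp: b_def D_def A_def B_def)
  \<comment> \<open>\<open>A * |t| \<le> 1/8\<close> is the drift's share of the contraction,
    \<open>B * |t| \<le> 1/8\<close> the smallness of the leak.\<close>
  define \<delta> where "\<delta> = min \<delta>0 (1 / (8 * (1 + A + B)))"
  have \<delta>: "0 < \<delta>" "\<delta> \<le> \<delta>0" using nn bounds by (auto simp: \<delta>_def)
  have b_ge: "real (n + n) * (c * D0) \<le> b" "et (n + n) \<le> b"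
    "real (n + n) * (c * D0) * N one \<le> b" "et (n + n) * N one \<le> b"
    using N1 D0 bounds et_nonneg[of "n + n"] by (auto simp: b_def algebra_simps)
  show ?thesis
  proof (rule that[of "n + n" \<delta> b D])
    show "0 < n + n" using n by simp
    show "0 < \<delta>" "\<delta> \<le> \<delta>0" "0 \<le> b" by fact+
    fix t :: real assume t': "\<bar>t\<bar> < \<delta>"
    then have t: "\<bar>t\<bar> < \<delta>0" using \<delta> by simp
    have small: "x * \<bar>t\<bar> \<le> 1 / 8" if "x \<le> 1 + A + B" for x
    proof -
      have "x * \<bar>t\<bar> \<le> (1 + A + B) * \<bar>t\<bar>" using that by (intro mult_right_mono) auto
      also have "\<dots> \<le> (1 + A + B) * (1 / (8 * (1 + A + B)))"
        using t' nn by (intro mult_left_mono) (auto simp: \<delta>_def)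
      also have "\<dots> = 1 / 8" using nn by simp
      finally show ?thesis .
    qed
    have A8: "A * \<bar>t\<bar> \<le> 1 / 8" and B8: "B * \<bar>t\<bar> \<le> 1 / 8" using nn by (intro small; simp)+
    show "perturbed_operator V one N Nt L (P t ^^ (n + n)) D (b * \<bar>t\<bar>)"
    proof unfold_locales
      fix f assume f: "f \<in> V"
      show "(P t ^^ (n + n)) f \<in> V" by (rule pow_V[OF t f])
      fix g a assume g: "g \<in> V"
      show "(P t ^^ (n + n)) (\<lambda>x. f x + a * g x) = (\<lambda>x. (P t ^^ (n + n)) f x + a * (P t ^^ (n + n)) g x)"
        by (rule pow_add[OF t f g])
    next
      fix f assume f: "f \<in> V" and L: "L f = 0"
      have "N ((P t ^^ (n + n)) f) \<le> (C * \<kappa> ^ n * D0 + C * L1 * C0 * \<kappa>0 ^ n + C * real n * (c * D0) * \<bar>t\<bar>) * N f"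
        by (rule pow_contraction[OF t f L n(4) n(4)])
      also have "\<dots> \<le> 1 / 4 * N f"
      proof (rule mult_right_mono[OF _ N_nonneg[OF f]])
        have "C * \<kappa> ^ n * D0 = C * D0 * \<kappa> ^ n" by simp
        then show "C * \<kappa> ^ n * D0 + C * L1 * C0 * \<kappa>0 ^ n + C * real n * (c * D0) * \<bar>t\<bar> \<le> 1 / 4"
          using n(1,3) A8 unfolding A_def by linarith
      qed
      finally show "N ((P t ^^ (n + n)) f) \<le> N f / 4" by simp
      have "cmod (L ((P t ^^ (n + n)) f)) \<le> real (n + n) * (c * D0) * \<bar>t\<bar> * N f"
        using L_drift[OF t f, of "n + n"] L by simp
      also have "\<dots> \<le> b * \<bar>t\<bar> * N f"
        by (intro mult_right_mono b_ge N_nonneg[OF f]) auto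
      finally show "cmod (L ((P t ^^ (n + n)) f)) \<le> b * \<bar>t\<bar> * N f" .
      have "Nt ((P t ^^ (n + n)) f) \<le> C1 * \<kappa>1 ^ (n + n) * Nt f + et (n + n) * \<bar>t\<bar> * N f"
        using pow_split(2)[OF t f, of "n + n"] Nt_drift[OF t f, of "n + n"] ergodic_t[OF _ f L, of "n + n"] n(4) by simp
      moreover have "C1 * \<kappa>1 ^ (n + n) * Nt f \<le> 1 / 4 * Nt f" by (rule mult_right_mono[OF n(2) Nt_nonneg[OF f]])
      moreover have "et (n + n) * \<bar>t\<bar> * N f \<le> b * \<bar>t\<bar> * N f"
        by (intro mult_right_mono b_ge N_nonneg[OF f]) auto
      ultimately show "Nt ((P t ^^ (n + n)) f) \<le> b * \<bar>t\<bar> * N f + Nt f / 4" by linarith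
    next
      have "cmod (L ((P t ^^ (n + n)) one) - 1) \<le> real (n + n) * (c * D0) * N one * \<bar>t\<bar>"
        using L_drift[OF t V_one, of "n + n"] by (simp add: l_one mult_ac)
      also have "\<dots> \<le> b * \<bar>t\<bar>" by (intro mult_right_mono b_ge) auto
      finally show "cmod (L ((P t ^^ (n + n)) one) - 1) \<le> b * \<bar>t\<bar>" .
      show "N ((P t ^^ (n + n)) one) \<le> D" unfolding D_def by (rule pow_bound[OF t V_one])
      have "Nt (\<lambda>x. (P t ^^ (n + n)) one x - one x) \<le> et (n + n) * N one * \<bar>t\<bar>"
        using Nt_drift[OF t V_one, of "n + n"] by (simp add: P0_pow_one mult_ac)
      also have "\<dots> \<le> b * \<bar>t\<bar>" by (intro mult_right_mono b_ge) auto
      finally show "Nt (\<lambda>x. (P t ^^ (n + n)) one x - one x) \<le> b * \<bar>t\<bar>" .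
      show "0 \<le> b * \<bar>t\<bar>" using nn by simp
      show "b * \<bar>t\<bar> * (1 + 2 * D + 3 * N one) \<le> 1 / 8" using B8 by (simp add: B_def mult_ac)
    qed
  qed
qed

text \<open>Handles the fewer than \<open>m\<close> steps left over when the time is divided by the
  fixed power \<open>m\<close>: they disturb closeness to \<open>one\<close> in \<open>Nt\<close>
  only by a further O(t).\<close>

lemma Nt_pow_near_one:
  assumes t: "\<bar>t\<bar> < \<delta>0" and f: "f \<in> V" and Nf: "N f \<le> W" and Ntf: "Nt (\<lambda>x. f x - one x) \<le> K * \<bar>t\<bar>"
  shows "Nt (\<lambda>x. (P t ^^ n) f x - one x) \<le> (et n * W + L2 ^ n * K) * \<bar>t\<bar>"
proof -
  have t0: "\<bar>0\<bar> < \<delta>0" using bounds by simp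
  have fd: "(\<lambda>x. f x - one x) \<in> V" by (rule V_diff[OF f V_one])
  have pw: "Nt ((P 0 ^^ n) h) \<le> L2 ^ n * Nt h" if h: "h \<in> V" for h
  proof (induction n)
    case (Suc n)
    have "Nt (P 0 ((P 0 ^^ n) h)) \<le> L2 * Nt ((P 0 ^^ n) h)" by (rule Nt_P0[OF pow_V[OF t0 h]])
    also have "\<dots> \<le> L2 * (L2 ^ n * Nt h)" using Suc bounds by (intro mult_left_mono) auto
    finally show ?case by (simp add: mult.assoc)
  qed simp
  have "(P 0 ^^ n) (\<lambda>x. f x + (-1) * one x) = (\<lambda>x. (P 0 ^^ n) f x + (-1) * (P 0 ^^ n) one x)"
    by (rule pow_add[OF t0 f V_one])
  then have e: "(P 0 ^^ n) (\<lambda>x. f x - one x) = (\<lambda>x. (P 0 ^^ n) f x - one x)" by (simp add: P0_pow_one)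
  have eq: "(\<lambda>x. (P t ^^ n) f x - one x) = (\<lambda>x. drift t n f x + 1 * (P 0 ^^ n) (\<lambda>x. f x - one x) x)"
    unfolding e by simp
  have "Nt (\<lambda>x. (P t ^^ n) f x - one x) \<le> Nt (drift t n f) + cmod 1 * Nt ((P 0 ^^ n) (\<lambda>x. f x - one x))"
    unfolding eq by (rule Nt_add[OF drift_V[OF t f] pow_V[OF t0 fd]])
  moreover have "Nt (drift t n f) \<le> et n * \<bar>t\<bar> * N f" by (rule Nt_drift[OF t f])
  moreover have "et n * \<bar>t\<bar> * N f \<le> et n * \<bar>t\<bar> * W" using et_nonneg Nf by (intro mult_left_mono) auto
  moreover have "Nt ((P 0 ^^ n) (\<lambda>x. f x - one x)) \<le> L2 ^ n * Nt (\<lambda>x. f x - one x)" by (rule pw[OF fd])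
  moreover have "L2 ^ n * Nt (\<lambda>x. f x - one x) \<le> L2 ^ n * (K * \<bar>t\<bar>)"
    using bounds Ntf by (intro mult_left_mono) auto
  ultimately have "Nt (\<lambda>x. (P t ^^ n) f x - one x) \<le> et n * \<bar>t\<bar> * W + L2 ^ n * (K * \<bar>t\<bar>)" by simp
  then show ?thesis by (simp add: algebra_simps)
qed

text \<open>For \<open>n = r + m * q\<close> the iterate is a scalar product of \<open>q\<close>
  factors times \<open>(P t ^^ r) (iter q)\<close>. The functional \<open>U\<close>, continuous for
  \<open>Nt\<close>, sees the latter as 1 + O(t). The scalar is the same for every \<open>U\<close>;
  taking \<open>L\<close> in place of \<open>U\<close> compares it with the hypothesis.\<close>

theorem gaussian_estimate:
  fixes U :: "('e \<Rightarrow> complex) \<Rightarrow> complex"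
  assumes U_add: "\<And>f g a. f \<in> V \<Longrightarrow> g \<in> V \<Longrightarrow> U (\<lambda>x. f x + a * g x) = U f + a * U g"
    and U_one: "U one = 1" and U_le: "\<And>f. f \<in> V \<Longrightarrow> cmod (U f) \<le> CU * Nt f" and CU: "0 \<le> CU"
    and s: "0 < s" and C2: "0 \<le> C2" and \<delta>2: "0 < \<delta>2"
    and est: "\<And>t n. \<bar>t\<bar> < \<delta>2 \<Longrightarrow> cmod (L ((P t ^^ n) one) - complex_of_real (1 - s * t\<^sup>2 / 2) ^ n) \<le> C2 * (\<bar>t\<bar> + real n * \<bar>t\<bar> ^ 3)"
  obtains \<delta> G a where "0 < \<delta>" "0 \<le> G" "0 < a"
    "\<And>t n. \<bar>t\<bar> \<le> \<delta> \<Longrightarrow> cmod (U ((P t ^^ n) one) - complex_of_real (exp (- (real n * s * t\<^sup>2 / 2))))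
       \<le> G * (\<bar>t\<bar> + real n * \<bar>t\<bar> ^ 3) * exp (- (a * real n * t\<^sup>2))"
proof -
  obtain m \<delta>1 b D where m: "0 < m" and \<delta>1: "0 < \<delta>1" "\<delta>1 \<le> \<delta>0" and b: "0 \<le> b"
    and pert: "\<And>t. \<bar>t\<bar> < \<delta>1 \<Longrightarrow> perturbed_operator V one N Nt L (P t ^^ m) D (b * \<bar>t\<bar>)"
    using perturbed_operator_pow by blast
  have D: "0 \<le> D" using perturbed_operator.D_nonneg[OF pert[of 0]] \<delta>1 by simp
  define W where "W = 2 * D + 2 * N one"
  define c1 where "c1 = b * (1 + W)"
  define W1 where "W1 = W + N one"
  define K where "K = 2 * (1 + W) * (1 + Nt one) * b"
  have W: "0 \<le> W" "0 \<le> W1" using D N_nonneg[OF V_one] by (simp_all add: W_def W1_def)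
  have K: "0 \<le> K" "0 \<le> c1" using W b Nt_nonneg[OF V_one] by (simp_all add: K_def c1_def)
  obtain \<delta>3 C3 a3 where g: "0 < \<delta>3" "0 \<le> C3" "0 < a3"
    and gauss: "\<And>t lam q. \<bar>t\<bar> \<le> \<delta>3 \<Longrightarrow> (\<And>n. cmod (lam (Suc n) - lam n) \<le> c1 * \<bar>t\<bar> * (1 / 2) ^ n) \<Longrightarrow>
       (\<And>n. cmod (lam n - 1) \<le> c1 * \<bar>t\<bar>) \<Longrightarrow>
       (\<And>q. cmod ((\<Prod>k<q. lam k) - complex_of_real (1 - s * t\<^sup>2 / 2) ^ (m * q)) \<le> (C2 * real m) * (\<bar>t\<bar> + real q * \<bar>t\<bar> ^ 3)) \<Longrightarrow>
       cmod ((\<Prod>k<q. lam k) - complex_of_real (exp (- (real (m * q) * s * t\<^sup>2 / 2))))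
         \<le> C3 * (\<bar>t\<bar> + real q * \<bar>t\<bar> ^ 3) * exp (- (a3 * real q * t\<^sup>2))"
    using gaussian_product_estimate[OF K(2) _ s m, of "C2 * real m"] C2 by (metis mult_nonneg_nonneg of_nat_0_le_iff)
  \<comment> \<open>The sum over all remainders stands in for their maximum, its terms being
    nonnegative.\<close>
  define K1 where "K1 = CU * (\<Sum>r<m. et r * W1 + L2 ^ r * K)"
  have K1: "0 \<le> K1" unfolding K1_def using CU et_nonneg W bounds K
    by (intro mult_nonneg_nonneg sum_nonneg add_nonneg_nonneg) auto
  \<comment> \<open>Division by \<open>m\<close> converts a decay per block into a decay per step.
    The minimum makes the same rate valid for the Gaussian \<open>E\<close> itself.\<close>
  define a where "a = min a3 (real m * s / 2) / real m"
  have a: "0 < a" "a * real m \<le> a3" "a * real m \<le> real m * s / 2"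
    using g s m by (auto simp: a_def)
  define \<delta> where "\<delta> = min (min (\<delta>1 / 2) (\<delta>2 / 2)) (min (min \<delta>3 1) (1 / (1 + K1)))"
  have \<delta>: "0 < \<delta>" using \<delta>1 \<delta>2 g K1 by (simp add: \<delta>_def)
  define G where "G = exp (a * real m) * (2 * C3 + K1 + real m * s / 2)"
  show ?thesis
  proof (rule that[of \<delta> G a])
    show "0 < \<delta>" "0 < a" by fact+
    show "0 \<le> G" using g K1 s by (simp add: G_def)
    fix t :: real and n :: nat assume t: "\<bar>t\<bar> \<le> \<delta>"
    then have t1: "\<bar>t\<bar> < \<delta>1" "\<bar>t\<bar> < \<delta>0" "\<bar>t\<bar> < \<delta>2" "\<bar>t\<bar> \<le> \<delta>3" "\<bar>t\<bar> \<le> 1" "K1 * \<bar>t\<bar> \<le> 1"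
    proof -
      show "K1 * \<bar>t\<bar> \<le> 1"
      proof -
        have "K1 * \<bar>t\<bar> \<le> (1 + K1) * (1 / (1 + K1))"
          using t K1 by (intro mult_mono) (auto simp: \<delta>_def)
        then show ?thesis using K1 by simp
      qed
    qed (use t \<delta> \<delta>1 \<delta>2 in \<open>auto simp: \<delta>_def\<close>)
    interpret R: perturbed_operator V one N Nt L "P t ^^ m" D "b * \<bar>t\<bar>" by (rule pert[OF t1(1)])
    have RW: "R.W = W" by (simp add: R.W_def W_def)
    define \<tau> where "\<tau> = \<bar>t\<bar>"
    have tau: "0 \<le> \<tau>" "\<tau> \<le> 1" using t1 by (simp_all add: \<tau>_def)
    have t2: "t\<^sup>2 = \<tau>\<^sup>2" by (simp add: \<tau>_def)
    define q r where "q = n div m" and "r = n mod m"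
    have n: "n = r + m * q" and r: "r < m" using m by (simp_all add: q_def r_def)
    define p where "p = (\<Prod>k<q. R.lam k)"
    define w where "w = U ((P t ^^ r) (R.iter q))"
    define E where "E = exp (- (real (m * q) * s * t\<^sup>2 / 2))"
    have powR: "(P t ^^ (m * q)) one = (\<lambda>x. (\<Prod>k<q. R.lam k) * R.iter q x)" for q
      using R.iter_pow[of q] by (simp add: funpow_mult mult.commute)
    have U_scale: "U (\<lambda>x. a * f x) = a * U f" if "f \<in> V" for a f
      using U_add[OF that that, of "a - 1"] by (simp add: algebra_simps)
    have pow_scale: "(P t ^^ r) (\<lambda>x. a * f x) = (\<lambda>x. a * (P t ^^ r) f x)" if "f \<in> V" for a f
      using pow_add[OF t1(2) that that, of r "a - 1"] by (simp add: algebra_simps)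
    have itV: "(P t ^^ r) (R.iter q) \<in> V" by (rule pow_V[OF t1(2) R.iter_V])
    have Un: "U ((P t ^^ n) one) = p * w"
      unfolding n funpow_add o_apply powR pow_scale[OF R.iter_V] U_scale[OF itV] p_def w_def ..
    have pE: "cmod (p - complex_of_real E) \<le> C3 * (\<tau> + real q * \<tau> ^ 3) * exp (- (a3 * real q * t\<^sup>2))"
      unfolding p_def E_def \<tau>_def
    proof (rule gauss[OF t1(4)])
      fix k
      have "cmod (R.lam (Suc k) - R.lam k) \<le> b * \<bar>t\<bar> * W * (1 / 2) ^ k" using R.lam_cauchy[of k] by (simp add: RW)
      also have "\<dots> \<le> c1 * \<bar>t\<bar> * (1 / 2) ^ k"
        using b by (intro mult_right_mono) (auto simp: c1_def algebra_simps)
      finally show "cmod (R.lam (Suc k) - R.lam k) \<le> c1 * \<bar>t\<bar> * (1 / 2) ^ k" .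
      show "cmod (R.lam k - 1) \<le> c1 * \<bar>t\<bar>" using R.lam_near_one[of k] by (simp add: RW c1_def mult_ac)
    next
      fix q
      have "L ((P t ^^ (m * q)) one) = (\<Prod>k<q. R.lam k)"
        unfolding powR by (simp add: l_scale[OF R.iter_V] R.l_iter)
      then have "cmod ((\<Prod>k<q. R.lam k) - complex_of_real (1 - s * t\<^sup>2 / 2) ^ (m * q)) \<le> C2 * (\<bar>t\<bar> + real (m * q) * \<bar>t\<bar> ^ 3)"
        using est[OF t1(3), of "m * q"] by simp
      also have "\<dots> \<le> C2 * (real m * (\<bar>t\<bar> + real q * \<bar>t\<bar> ^ 3))"
        using C2 m mult_right_mono[of 1 "real m" "\<bar>t\<bar>"] by (intro mult_left_mono) (auto simp: algebra_simps)
      finally show "cmod ((\<Prod>k<q. R.lam k) - complex_of_real (1 - s * t\<^sup>2 / 2) ^ (m * q)) \<le> C2 * real m * (\<bar>t\<bar> + real q * \<bar>t\<bar> ^ 3)"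
        by (simp add: mult.assoc)
    qed
    have w1: "cmod (w - 1) \<le> K1 * \<tau>"
    proof -
      have nt: "Nt (\<lambda>x. (P t ^^ r) (R.iter q) x - one x) \<le> (et r * W1 + L2 ^ r * K) * \<bar>t\<bar>"
        using R.N_iter_le[of q] R.Nt_iter[of q]
        by (intro Nt_pow_near_one[OF t1(2) R.iter_V]) (simp_all add: RW W1_def K_def mult_ac)
      have "w - 1 = U (\<lambda>x. (P t ^^ r) (R.iter q) x - one x)"
        using U_add[OF itV V_one, of "-1"] by (simp add: w_def U_one)
      then have "cmod (w - 1) \<le> CU * Nt (\<lambda>x. (P t ^^ r) (R.iter q) x - one x)"
        using U_le[OF V_diff[OF itV V_one]] by simp
      also have "\<dots> \<le> CU * ((et r * W1 + L2 ^ r * K) * \<bar>t\<bar>)" by (rule mult_left_mono[OF nt CU])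
      also have "\<dots> \<le> CU * ((\<Sum>r<m. et r * W1 + L2 ^ r * K) * \<bar>t\<bar>)"
        using r et_nonneg W bounds K CU
        by (intro mult_left_mono mult_right_mono member_le_sum add_nonneg_nonneg mult_nonneg_nonneg) auto
      finally show ?thesis by (simp add: K1_def \<tau>_def mult.assoc)
    qed
    have w2: "cmod w \<le> 2"
      using w1 t1(6) norm_triangle_ineq[of "w - 1" 1] by (simp add: \<tau>_def)
    \<comment> \<open>The factor \<open>exp (a * real m)\<close> pays for the incomplete block:
      \<open>a * r * t^2 \<le> a * m\<close> because \<open>r < m\<close> and
      \<open>|t| \<le> 1\<close>.\<close>
    define Z where "Z = exp (a * real m) * exp (- (a * real n * t\<^sup>2))"
    have Z: "exp (- (x * real q * t\<^sup>2)) \<le> Z" if "a * real m \<le> x" for x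
    proof -
      have "a * real n * t\<^sup>2 = a * real r * t\<^sup>2 + a * real m * (real q * t\<^sup>2)" by (simp add: n algebra_simps)
      also have "\<dots> \<le> a * real m * 1 + x * (real q * t\<^sup>2)"
        using a r that tau by (intro add_mono mult_mono mult_right_mono) (auto simp: t2 power_le_one)
      finally show ?thesis unfolding Z_def exp_add[symmetric] by (simp add: mult_ac)
    qed
    have E0: "0 \<le> E" "E \<le> Z"
      using Z[OF a(3)] by (simp_all add: E_def mult_ac)
    have A: "cmod (p * w - complex_of_real E * w) \<le> Z * (2 * C3) * (\<tau> + real q * \<tau> ^ 3)"
    proof -
      have "cmod (p * w - complex_of_real E * w) = cmod (p - complex_of_real E) * cmod w"
        by (simp only: norm_mult[symmetric] left_diff_distrib)
      also have "\<dots> \<le> (C3 * (\<tau> + real q * \<tau> ^ 3) * exp (- (a3 * real q * t\<^sup>2))) * 2"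
        using pE w2 by (intro mult_mono) (auto intro: order_trans[OF norm_ge_zero])
      also have "\<dots> \<le> (C3 * (\<tau> + real q * \<tau> ^ 3) * Z) * 2"
        using Z[OF a(2)] g tau by (intro mult_right_mono mult_left_mono) auto
      finally show ?thesis by (simp add: mult_ac)
    qed
    have B: "cmod (complex_of_real E * w - complex_of_real E) \<le> Z * K1 * \<tau>"
    proof -
      have "complex_of_real E * w - complex_of_real E = complex_of_real E * (w - 1)" by (simp add: algebra_simps)
      then have "cmod (complex_of_real E * w - complex_of_real E) = E * cmod (w - 1)" using E0 by (simp add: norm_mult)
      also have "\<dots> \<le> Z * (K1 * \<tau>)" using E0 w1 by (intro mult_mono) auto
      finally show ?thesis by (simp add: mult.assoc)
    qed
    have F: "cmod (complex_of_real E - complex_of_real (exp (- (real n * s * t\<^sup>2 / 2)))) \<le> Z * (real m * s / 2) * \<tau>"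
    proof -
      define y where "y = real r * s * t\<^sup>2 / 2"
      have y: "0 \<le> y" using s by (simp add: y_def)
      have "y \<le> real m * s * \<tau> / 2"
      proof -
        have "real r * s * (\<tau> * \<tau>) \<le> real m * s * (\<tau> * 1)" using r s tau by (intro mult_mono mult_right_mono mult_left_mono) auto
        then show ?thesis unfolding y_def t2 by (simp add: power2_eq_square)
      qed
      moreover have "1 - exp (- y) \<le> y" using exp_ge_add_one_self[of "- y"] by simp
      ultimately have "\<bar>1 - exp (- y)\<bar> \<le> real m * s / 2 * \<tau>" using y by simp
      moreover have "exp (- (real n * s * t\<^sup>2 / 2)) = E * exp (- y)"
        unfolding E_def y_def exp_add[symmetric] by (simp add: n algebra_simps add_divide_distrib)
      then have "E - exp (- (real n * s * t\<^sup>2 / 2)) = E * (1 - exp (- y))" by (simp add: algebra_simps)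
      ultimately have "\<bar>E - exp (- (real n * s * t\<^sup>2 / 2))\<bar> \<le> Z * (real m * s / 2 * \<tau>)"
        using E0 by (simp only: abs_mult) (intro mult_mono, auto)
      then show ?thesis by (simp add: mult.assoc flip: of_real_diff)
    qed
    have tri: "cmod (x - z) \<le> cmod (x - y1) + cmod (y1 - y2) + cmod (y2 - z)" for x y1 y2 z :: complex
      using norm_triangle_ineq[of "x - y1" "y1 - y2"] norm_triangle_ineq[of "x - y2" "y2 - z"] by simp
    have "cmod (p * w - complex_of_real (exp (- (real n * s * t\<^sup>2 / 2))))
        \<le> Z * (2 * C3) * (\<tau> + real q * \<tau> ^ 3) + Z * K1 * \<tau> + Z * (real m * s / 2) * \<tau>"
      using tri[of "p * w" "complex_of_real (exp (- (real n * s * t\<^sup>2 / 2)))" "complex_of_real E * w" "complex_of_real E"] A B F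
      by linarith
    also have "\<dots> \<le> Z * (2 * C3 + K1 + real m * s / 2) * (\<tau> + real n * \<tau> ^ 3)"
    proof -
      have Z0: "0 \<le> Z" by (simp add: Z_def)
      have "q \<le> n" by (simp add: q_def)
      then have "real q * \<tau> ^ 3 \<le> real n * \<tau> ^ 3" using tau by (intro mult_right_mono) auto
      then have 1: "Z * (2 * C3) * (\<tau> + real q * \<tau> ^ 3) \<le> Z * (2 * C3) * (\<tau> + real n * \<tau> ^ 3)"
        using Z0 g by (intro mult_left_mono) auto
      have le: "\<tau> \<le> \<tau> + real n * \<tau> ^ 3" using tau by simp
      have 2: "Z * K1 * \<tau> \<le> Z * K1 * (\<tau> + real n * \<tau> ^ 3)" using Z0 K1 le by (intro mult_left_mono) auto
      have 3: "Z * (real m * s / 2) * \<tau> \<le> Z * (real m * s / 2) * (\<tau> + real n * \<tau> ^ 3)"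
        using Z0 s le by (intro mult_left_mono) auto
      show ?thesis using add_mono[OF add_mono[OF 1 2] 3] by (simp add: distrib_left distrib_right)
    qed
    also have "\<dots> = G * (\<bar>t\<bar> + real n * \<bar>t\<bar> ^ 3) * exp (- (a * real n * t\<^sup>2))"
      by (simp add: G_def Z_def \<tau>_def mult_ac)
    finally show "cmod (U ((P t ^^ n) one) - complex_of_real (exp (- (real n * s * t\<^sup>2 / 2))))
       \<le> G * (\<bar>t\<bar> + real n * \<bar>t\<bar> ^ 3) * exp (- (a * real n * t\<^sup>2))" unfolding Un .
  qed
qed

end

section \<open>The characteristic function of the partial sums\<close>

locale kernel_chain = markov_kernel E Q for E :: "'e measure" and Q +
  fixes \<mu>0 :: "'e measure" and M :: "'w measure" and X :: "nat \<Rightarrow> 'w \<Rightarrow> 'e"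
  assumes chain: "markov_chain E Q \<mu>0 M X"
begin

lemma prob_M: "prob_space M" and X_meas [measurable]: "X n \<in> M \<rightarrow>\<^sub>M E" and law_0: "distr M E (X 0) = \<mu>0"
  using chain unfolding markov_chain_def by blast+

lemma chain_step: "(\<And>i. i \<le> Suc n \<Longrightarrow> A i \<in> sets E) \<Longrightarrow>
        measure M {\<omega>\<in>space M. \<forall>i\<le>Suc n. X i \<omega> \<in> A i}
        = (\<integral>\<omega>. indicator {\<omega>\<in>space M. \<forall>i\<le>n. X i \<omega> \<in> A i} \<omega>
                  * measure (Q (X n \<omega>)) (A (Suc n)) \<partial>M)"
  using chain unfolding markov_chain_def by blast

end

sublocale kernel_chain \<subseteq> M: prob_space M by (rule prob_M)

context kernel_chain
begin

lemma X_space: "\<omega> \<in> space M \<Longrightarrow> X n \<omega> \<in> space E"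
  using measurable_space[OF X_meas] .

text \<open>The events in terms of which the chain property is formulated. They are closed under
  intersection, so identities of measures extend to the generated sigma-algebra, which is the
  history up to time \<open>n\<close>.\<close>

definition cylinders :: "nat \<Rightarrow> 'w set set" where
  "cylinders n = {{\<omega>\<in>space M. \<forall>i\<le>n. X i \<omega> \<in> A i} | A. \<forall>i\<le>n. A i \<in> sets E}"

definition past :: "nat \<Rightarrow> 'w measure" where "past n = sigma (space M) (cylinders n)"

lemma cylinders_subset: "cylinders n \<subseteq> Pow (space M)" "cylinders n \<subseteq> sets M"
proof -
  show "cylinders n \<subseteq> Pow (space M)" by (auto simp: cylinders_def)
  have "{\<omega>\<in>space M. \<forall>i\<le>n. X i \<omega> \<in> A i} \<in> sets M" if [measurable]: "\<forall>i\<le>n. A i \<in> sets E" for A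
  proof -
    have "{\<omega>\<in>space M. \<forall>i\<le>n. X i \<omega> \<in> A i} = (\<Inter>i\<in>{..n}. X i -` A i \<inter> space M)" by auto
    also have "\<dots> \<in> sets M" using that by (intro sets.finite_INT) (auto intro: measurable_sets[OF X_meas])
    finally show ?thesis .
  qed
  then show "cylinders n \<subseteq> sets M" unfolding cylinders_def by blast
qed

lemma space_past [simp]: "space (past n) = space M"
  and sets_past: "sets (past n) = sigma_sets (space M) (cylinders n)"
  unfolding past_def by (simp_all only: space_measure_of[OF cylinders_subset(1)] sets_measure_of[OF cylinders_subset(1)])

lemma subalgebra_past: "subalgebra M (past n)"
  using sets.sigma_sets_subset[OF cylinders_subset(2)] by (simp add: subalgebra_def sets_past)

lemma Int_stable_cylinders: "Int_stable (cylinders n)"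
proof (rule Int_stableI)
  fix a b assume "a \<in> cylinders n" "b \<in> cylinders n"
  then obtain A B where AB: "\<forall>i\<le>n. A i \<in> sets E" "\<forall>i\<le>n. B i \<in> sets E"
    "a = {\<omega>\<in>space M. \<forall>i\<le>n. X i \<omega> \<in> A i}" "b = {\<omega>\<in>space M. \<forall>i\<le>n. X i \<omega> \<in> B i}"
    unfolding cylinders_def by blast
  show "a \<inter> b \<in> cylinders n" unfolding cylinders_def
    by (rule CollectI, rule exI[of _ "\<lambda>i. A i \<inter> B i"]) (use AB in auto)
qed

lemma X_past: "i \<le> n \<Longrightarrow> X i \<in> past n \<rightarrow>\<^sub>M E"
proof (rule measurableI)
  fix B assume i: "i \<le> n" and B: "B \<in> sets E"
  have "X i -` B \<inter> space M = {\<omega>\<in>space M. \<forall>j\<le>n. X j \<omega> \<in> (if j = i then B else space E)}"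
    using X_space i by auto
  also have "\<dots> \<in> cylinders n" unfolding cylinders_def
    by (rule CollectI, rule exI[of _ "\<lambda>j. if j = i then B else space E"]) (use B in auto)
  finally show "X i -` B \<inter> space (past n) \<in> sets (past n)" by (simp add: sets_past sigma_sets.Basic)
qed (simp add: X_space)

lemma Q_X_meas [measurable]: "(\<lambda>\<omega>. Q (X n \<omega>)) \<in> M \<rightarrow>\<^sub>M subprob_algebra E"
  by (rule measurable_compose[OF X_meas Q_subprob])

lemma emeasure_QX_meas [measurable]: "A \<in> sets E \<Longrightarrow> (\<lambda>\<omega>. emeasure (Q (X n \<omega>)) A) \<in> borel_measurable M"
  by (rule measurable_compose[OF Q_X_meas measurable_emeasure_subprob_algebra])

lemma QX_emeasure: "\<omega> \<in> space M \<Longrightarrow> emeasure (Q (X n \<omega>)) A = ennreal (measure (Q (X n \<omega>)) A)"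
  using prob_space_Q[OF X_space, of \<omega>] by (simp add: finite_measure.emeasure_eq_measure prob_space_def)

lemma cylinder_transition:
  assumes D: "D \<in> cylinders n" and A: "A \<in> sets E"
  shows "emeasure M (D \<inter> (X (Suc n) -` A \<inter> space M)) = (\<integral>\<^sup>+\<omega>\<in>D. emeasure (Q (X n \<omega>)) A \<partial>M)"
proof -
  obtain B where B: "\<forall>i\<le>n. B i \<in> sets E" and Deq: "D = {\<omega>\<in>space M. \<forall>i\<le>n. X i \<omega> \<in> B i}"
    using D unfolding cylinders_def by blast
  have Dm [measurable]: "D \<in> sets M" using D cylinders_subset(2) by auto
  define C where "C = B(Suc n := A)"
  have "measure M {\<omega>\<in>space M. \<forall>i\<le>Suc n. X i \<omega> \<in> C i}
      = (\<integral>\<omega>. indicator {\<omega>\<in>space M. \<forall>i\<le>n. X i \<omega> \<in> C i} \<omega> * measure (Q (X n \<omega>)) (C (Suc n)) \<partial>M)"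
    by (rule chain_step) (use A B in \<open>auto simp: C_def le_Suc_eq\<close>)
  moreover have "{\<omega>\<in>space M. \<forall>i\<le>Suc n. X i \<omega> \<in> C i} = D \<inter> (X (Suc n) -` A \<inter> space M)"
    unfolding Deq C_def by (auto simp: le_Suc_eq)
  moreover have "{\<omega>\<in>space M. \<forall>i\<le>n. X i \<omega> \<in> C i} = D" unfolding Deq C_def by auto
  moreover have "C (Suc n) = A" by (simp add: C_def)
  ultimately have "measure M (D \<inter> (X (Suc n) -` A \<inter> space M)) = (\<integral>\<omega>. indicator D \<omega> * measure (Q (X n \<omega>)) A \<partial>M)"
    by simp
  then have "emeasure M (D \<inter> (X (Suc n) -` A \<inter> space M)) = ennreal (\<integral>\<omega>. indicator D \<omega> * measure (Q (X n \<omega>)) A \<partial>M)"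
    by (simp add: M.emeasure_eq_measure)
  also have "\<dots> = (\<integral>\<^sup>+\<omega>. ennreal (indicator D \<omega> * measure (Q (X n \<omega>)) A) \<partial>M)"
  proof (rule nn_integral_eq_integral[symmetric])
    have "(\<lambda>\<omega>. measure (Q (X n \<omega>)) A) \<in> borel_measurable M"
      using A by (intro measurable_compose[OF Q_X_meas measurable_measure_subprob_algebra])
    moreover have "measure (Q (X n \<omega>)) A \<le> 1" if "\<omega> \<in> space M" for \<omega>
      using prob_space.prob_le_1[OF prob_space_Q[OF X_space[OF that]]] .
    ultimately show "integrable M (\<lambda>\<omega>. indicator D \<omega> * measure (Q (X n \<omega>)) A)"
      by (intro M.integrable_const_bound[where B=1]) (auto simp: indicator_def)
  qed simp
  also have "\<dots> = (\<integral>\<^sup>+\<omega>\<in>D. emeasure (Q (X n \<omega>)) A \<partial>M)"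
    by (intro nn_integral_cong) (auto simp: indicator_def QX_emeasure)
  finally show ?thesis .
qed

text \<open>Both sides are finite measures in \<open>D\<close>. They agree on cylinders by the chain
  property, hence on the sigma-algebra of the past.\<close>

lemma past_transition:
  assumes D: "D \<in> sets (past n)" and A [measurable]: "A \<in> sets E"
  shows "emeasure M (D \<inter> (X (Suc n) -` A \<inter> space M)) = (\<integral>\<^sup>+\<omega>\<in>D. emeasure (Q (X n \<omega>)) A \<partial>M)"
proof -
  define m1 where "m1 = density M (indicator (X (Suc n) -` A \<inter> space M))"
  define m2 where "m2 = density M (\<lambda>\<omega>. emeasure (Q (X n \<omega>)) A)"
  have XA [measurable]: "X (Suc n) -` A \<inter> space M \<in> sets M" by (rule measurable_sets[OF X_meas A])
  have sub: "subalgebra m1 (past n)" "subalgebra m2 (past n)"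
    using subalgebra_past[of n] by (auto simp: subalgebra_def m1_def m2_def)
  have e1: "emeasure m1 D = emeasure M (D \<inter> (X (Suc n) -` A \<inter> space M))" if [measurable]: "D \<in> sets M" for D
  proof -
    have "emeasure m1 D = (\<integral>\<^sup>+\<omega>. indicator (D \<inter> (X (Suc n) -` A \<inter> space M)) \<omega> \<partial>M)"
      unfolding m1_def by (subst emeasure_density) (auto intro!: nn_integral_cong split: split_indicator simp del: nn_integral_indicator)
    then show ?thesis by simp
  qed
  have e2: "emeasure m2 D = (\<integral>\<^sup>+\<omega>\<in>D. emeasure (Q (X n \<omega>)) A \<partial>M)" if "D \<in> sets M" for D
    unfolding m2_def using that A by (subst emeasure_density) auto
  have "restr_to_subalg m1 (past n) = restr_to_subalg m2 (past n)"
  proof (rule measure_eqI_generator_eq[OF Int_stable_cylinders cylinders_subset(1)])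
    fix D assume D: "D \<in> cylinders n"
    then have "D \<in> sets (past n)" "D \<in> sets M" using cylinders_subset(2) by (auto simp: sets_past)
    then show "emeasure (restr_to_subalg m1 (past n)) D = emeasure (restr_to_subalg m2 (past n)) D"
      using cylinder_transition[OF D A] by (simp add: emeasure_restr_to_subalg[OF sub(1)] emeasure_restr_to_subalg[OF sub(2)] e1 e2)
  next
    show "sets (restr_to_subalg m1 (past n)) = sigma_sets (space M) (cylinders n)"
      "sets (restr_to_subalg m2 (past n)) = sigma_sets (space M) (cylinders n)"
      by (simp_all add: sets_restr_to_subalg[OF sub(1)] sets_restr_to_subalg[OF sub(2)] sets_past)
    have top: "space M \<in> cylinders n" unfolding cylinders_def
      by (rule CollectI, rule exI[of _ "\<lambda>j. space E"]) (auto simp: X_space)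
    show "range (\<lambda>_::nat. space M) \<subseteq> cylinders n" "(\<Union>i::nat. space M) = space M" using top by auto
    show "emeasure (restr_to_subalg m1 (past n)) (space M) \<noteq> \<infinity>"
      using top cylinders_subset(2)[of n]
      by (subst emeasure_restr_to_subalg[OF sub(1)]) (auto simp: sets_past e1 sigma_sets_top M.emeasure_finite)
  qed
  then have "emeasure m1 D = emeasure m2 D"
    using D emeasure_restr_to_subalg[OF sub(1) D] emeasure_restr_to_subalg[OF sub(2) D] by simp
  moreover have "D \<in> sets M" using D subalgebra_past[of n] by (auto simp: subalgebra_def)
  ultimately show ?thesis by (simp add: e1 e2)
qed

text \<open>Under \<open>M\<close> restricted to the event \<open>D\<close>, the law of
  \<open>X (Suc n)\<close> is the mixture of the laws \<open>Q (X n \<omega>)\<close>. Once this is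
  an equality of measures, integrating a bounded function over a mixture gives the claim.\<close>

lemma past_integral_transition:
  fixes f :: "'e \<Rightarrow> real"
  assumes D: "D \<in> sets (past n)" and f [measurable]: "f \<in> borel_measurable E"
    and b: "\<And>x. x \<in> space E \<Longrightarrow> \<bar>f x\<bar> \<le> b"
  shows "(\<integral>\<omega>\<in>D. f (X (Suc n) \<omega>) \<partial>M) = (\<integral>\<omega>\<in>D. (\<integral>y. f y \<partial>Q (X n \<omega>)) \<partial>M)"
proof -
  have DM [measurable]: "D \<in> sets M" using D subalgebra_past[of n] by (auto simp: subalgebra_def)
  define m where "m = density M (indicator D)"
  have [measurable_cong]: "sets m = sets M" by (simp add: m_def)
  have fin: "finite_measure m"
  proof (rule finite_measureI)
    have "emeasure m (space m) = (\<integral>\<^sup>+\<omega>. indicator D \<omega> \<partial>M)"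
      unfolding m_def by (subst emeasure_density) (auto intro!: nn_integral_cong split: split_indicator simp del: nn_integral_indicator)
    then show "emeasure m (space m) \<noteq> \<infinity>" by simp
  qed
  have eq: "distr m E (X (Suc n)) = bind m (\<lambda>\<omega>. Q (X n \<omega>))"
  proof (rule measure_eqI)
    have ne: "space m \<noteq> {}" using M.not_empty by (simp add: m_def)
    have QX: "(\<lambda>\<omega>. Q (X n \<omega>)) \<in> m \<rightarrow>\<^sub>M subprob_algebra E" by measurable
    show "sets (distr m E (X (Suc n))) = sets (bind m (\<lambda>\<omega>. Q (X n \<omega>)))"
      using sets_bind[OF sets_kernel[OF QX] ne] by simp
    fix A assume "A \<in> sets (distr m E (X (Suc n)))"
    then have A [measurable]: "A \<in> sets E" by simp
    have XA [measurable]: "X (Suc n) -` A \<inter> space M \<in> sets M" by (rule measurable_sets[OF X_meas A])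
    have "emeasure (distr m E (X (Suc n))) A = emeasure m (X (Suc n) -` A \<inter> space M)"
      by (subst emeasure_distr) (auto simp: m_def)
    also have "\<dots> = (\<integral>\<^sup>+\<omega>. indicator (D \<inter> (X (Suc n) -` A \<inter> space M)) \<omega> \<partial>M)"
      unfolding m_def by (subst emeasure_density) (auto intro!: nn_integral_cong split: split_indicator simp del: nn_integral_indicator)
    also have "\<dots> = emeasure M (D \<inter> (X (Suc n) -` A \<inter> space M))" by simp
    also have "\<dots> = (\<integral>\<^sup>+\<omega>\<in>D. emeasure (Q (X n \<omega>)) A \<partial>M)" by (rule past_transition[OF D A])
    also have "\<dots> = (\<integral>\<^sup>+\<omega>. emeasure (Q (X n \<omega>)) A \<partial>m)"
      unfolding m_def by (subst nn_integral_density) (auto simp: mult.commute)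
    also have "\<dots> = emeasure (bind m (\<lambda>\<omega>. Q (X n \<omega>))) A"
      by (rule emeasure_bind[OF ne QX A, symmetric])
    finally show "emeasure (distr m E (X (Suc n))) A = emeasure (bind m (\<lambda>\<omega>. Q (X n \<omega>))) A" .
  qed
  have "(\<integral>\<omega>. f (X (Suc n) \<omega>) \<partial>m) = (\<integral>x. f x \<partial>distr m E (X (Suc n)))"
    by (rule integral_distr[symmetric]) auto
  also have "\<dots> = (\<integral>\<omega>. (\<integral>y. f y \<partial>Q (X n \<omega>)) \<partial>m)"
    unfolding eq
  proof (rule integral_bind[OF f b _ fin])
    show "(\<lambda>\<omega>. Q (X n \<omega>)) \<in> m \<rightarrow>\<^sub>M subprob_algebra E" by measurable
    show "AE \<omega> in m. emeasure (Q (X n \<omega>)) (space (Q (X n \<omega>))) \<le> ennreal 1"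
      by (rule AE_I2) (simp add: m_def prob_space.emeasure_space_1[OF prob_space_Q[OF X_space]])
  qed
  finally have "(\<integral>\<omega>. f (X (Suc n) \<omega>) \<partial>m) = (\<integral>\<omega>. (\<integral>y. f y \<partial>Q (X n \<omega>)) \<partial>m)" .
  moreover have "(\<integral>\<omega>. h \<omega> \<partial>m) = (\<integral>\<omega>\<in>D. h \<omega> \<partial>M)" if [measurable]: "h \<in> borel_measurable M" for h :: "'w \<Rightarrow> real"
  proof -
    have "m = density M (\<lambda>\<omega>. ennreal (indicator D \<omega>))" unfolding m_def by (simp add: ennreal_indicator)
    then show ?thesis by (simp add: integral_density set_lebesgue_integral_def)
  qed
  ultimately show ?thesis by simp
qed

text \<open>The preceding identity identifies the conditional expectation of
  \<open>f (X (Suc n))\<close> given the past as the kernel integral at \<open>X n\<close>; a factor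
  measurable for the past can be pulled out.\<close>

lemma transition_real:
  fixes f :: "'e \<Rightarrow> real" and h :: "'w \<Rightarrow> real"
  assumes h [measurable]: "h \<in> borel_measurable (past n)" and f [measurable]: "f \<in> borel_measurable E"
    and b: "\<And>x. x \<in> space E \<Longrightarrow> \<bar>f x\<bar> \<le> b" and bh: "\<And>\<omega>. \<omega> \<in> space M \<Longrightarrow> \<bar>h \<omega>\<bar> \<le> c"
  shows "(\<integral>\<omega>. h \<omega> * f (X (Suc n) \<omega>) \<partial>M) = (\<integral>\<omega>. h \<omega> * (\<integral>y. f y \<partial>Q (X n \<omega>)) \<partial>M)"
proof -
  interpret fms: finite_measure_subalgebra M "past n"
    by unfold_locales (rule subalgebra_past)
  have hM [measurable]: "h \<in> borel_measurable M" by (rule measurable_from_subalg[OF subalgebra_past h])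
  have Qf [measurable]: "(\<lambda>\<omega>. \<integral>y. f y \<partial>Q (X n \<omega>)) \<in> borel_measurable (past n)"
    by (rule measurable_compose[OF X_past integral_Q_measurable]) auto
  have QfM [measurable]: "(\<lambda>\<omega>. \<integral>y. f y \<partial>Q (X n \<omega>)) \<in> borel_measurable M"
    by (rule measurable_from_subalg[OF subalgebra_past Qf])
  have Qfb: "\<bar>\<integral>y. f y \<partial>Q (X n \<omega>)\<bar> \<le> b" if "\<omega> \<in> space M" for \<omega>
  proof -
    interpret Qx: prob_space "Q (X n \<omega>)" by (rule prob_space_Q[OF X_space[OF that]])
    have ae: "AE y in Q (X n \<omega>). \<bar>f y\<bar> \<le> b"
      by (rule AE_I2) (simp add: space_Q[OF X_space[OF that]] b)
    have "integrable (Q (X n \<omega>)) f"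
      by (rule Qx.integrable_const_bound[where B=b]) (use ae f in \<open>simp_all add: meas_Q[OF X_space[OF that]]\<close>)
    then have "integrable (Q (X n \<omega>)) (\<lambda>y. \<bar>f y\<bar>)" by simp
    from Qx.integral_le_const[OF this ae]
    have "(\<integral>y. \<bar>f y\<bar> \<partial>Q (X n \<omega>)) \<le> b" .
    moreover have "\<bar>\<integral>y. f y \<partial>Q (X n \<omega>)\<bar> \<le> (\<integral>y. \<bar>f y\<bar> \<partial>Q (X n \<omega>))" by (rule integral_abs_bound)
    ultimately show ?thesis by linarith
  qed
  have 1: "AE \<omega> in M. real_cond_exp M (past n) (\<lambda>\<omega>. f (X (Suc n) \<omega>)) \<omega> = (\<integral>y. f y \<partial>Q (X n \<omega>))"
    by (rule fms.real_cond_exp_charact[OF past_integral_transition[OF _ f b]])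
       (auto intro!: M.integrable_const_bound[where B=b] AE_I2 b X_space Qfb)
  have int: "integrable M (\<lambda>\<omega>. h \<omega> * f (X (Suc n) \<omega>))"
  proof (rule M.integrable_const_bound[where B="c * b"])
    show "AE \<omega> in M. norm (h \<omega> * f (X (Suc n) \<omega>)) \<le> c * b"
    proof (rule AE_I2)
      fix \<omega> assume \<omega>: "\<omega> \<in> space M"
      have "\<bar>h \<omega>\<bar> * \<bar>f (X (Suc n) \<omega>)\<bar> \<le> c * b"
        using bh[OF \<omega>] b[OF X_space[OF \<omega>, of "Suc n"]] by (intro mult_mono) auto
      then show "norm (h \<omega> * f (X (Suc n) \<omega>)) \<le> c * b" by (simp add: abs_mult)
    qed
  qed simp
  have "(\<integral>\<omega>. h \<omega> * f (X (Suc n) \<omega>) \<partial>M) = (\<integral>\<omega>. h \<omega> * real_cond_exp M (past n) (\<lambda>\<omega>. f (X (Suc n) \<omega>)) \<omega> \<partial>M)"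
    by (rule fms.real_cond_exp_intg(2)[OF int, symmetric]) auto
  also have "\<dots> = (\<integral>\<omega>. h \<omega> * (\<integral>y. f y \<partial>Q (X n \<omega>)) \<partial>M)"
    using 1 by (intro integral_cong_AE) (auto elim!: eventually_mono)
  finally show ?thesis .
qed

lemma transition_complex:
  fixes f :: "'e \<Rightarrow> complex" and h :: "'w \<Rightarrow> complex"
  assumes h [measurable]: "h \<in> borel_measurable (past n)" and f [measurable]: "f \<in> borel_measurable E"
    and b: "\<And>x. x \<in> space E \<Longrightarrow> cmod (f x) \<le> b" and bh: "\<And>\<omega>. \<omega> \<in> space M \<Longrightarrow> cmod (h \<omega>) \<le> c"
  shows "(\<integral>\<omega>. h \<omega> * f (X (Suc n) \<omega>) \<partial>M) = (\<integral>\<omega>. h \<omega> * kop Q f (X n \<omega>) \<partial>M)"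
proof -
  have hM [measurable]: "h \<in> borel_measurable M" by (rule measurable_from_subalg[OF subalgebra_past h])
  have fQ: "integrable (Q (X n \<omega>)) f" if "\<omega> \<in> space M" for \<omega>
  proof -
    interpret Qx: prob_space "Q (X n \<omega>)" by (rule prob_space_Q[OF X_space[OF that]])
    show ?thesis
      by (rule Qx.integrable_const_bound[where B=b])
         (use f in \<open>auto intro!: AE_I2 b simp: meas_Q[OF X_space[OF that]] space_Q[OF X_space[OF that]]\<close>)
  qed
  have kb: "cmod (kop Q f (X n \<omega>)) \<le> b" if "\<omega> \<in> space M" for \<omega>
  proof -
    interpret Qx: prob_space "Q (X n \<omega>)" by (rule prob_space_Q[OF X_space[OF that]])
    have "cmod (kop Q f (X n \<omega>)) \<le> (\<integral>y. cmod (f y) \<partial>Q (X n \<omega>))" unfolding kop_def by (rule integral_norm_bound)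
    also have "\<dots> \<le> b"
      by (rule Qx.integral_le_const)
         (auto intro!: AE_I2 b fQ[OF that] simp: space_Q[OF X_space[OF that]])
    finally show ?thesis .
  qed
  have [measurable]: "kop Q f \<in> borel_measurable E" by (rule kop_measurable[OF f])
  have kX [measurable]: "(\<lambda>\<omega>. kop Q f (X n \<omega>)) \<in> borel_measurable M" by measurable
  have int: "integrable M (\<lambda>\<omega>. p (h \<omega>) * q (g \<omega>))"
    if [measurable]: "g \<in> borel_measurable M" "p \<in> borel_measurable borel" "q \<in> borel_measurable borel"
      and "\<And>\<omega>. \<omega> \<in> space M \<Longrightarrow> cmod (g \<omega>) \<le> b" "\<And>z. \<bar>p z\<bar> \<le> cmod z" "\<And>z. \<bar>q z\<bar> \<le> cmod z"
    for g :: "'w \<Rightarrow> complex" and p q :: "complex \<Rightarrow> real"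
  proof (rule M.integrable_const_bound[where B="c * b"])
    show "AE \<omega> in M. norm (p (h \<omega>) * q (g \<omega>)) \<le> c * b"
    proof (rule AE_I2)
      fix \<omega> assume \<omega>: "\<omega> \<in> space M"
      have "\<bar>p (h \<omega>)\<bar> \<le> c" by (rule order_trans[OF that(5) bh[OF \<omega>]])
      moreover have "\<bar>q (g \<omega>)\<bar> \<le> b" by (rule order_trans[OF that(6) that(4)[OF \<omega>]])
      ultimately have pq: "\<bar>p (h \<omega>)\<bar> \<le> c" "\<bar>q (g \<omega>)\<bar> \<le> b" .
      show "norm (p (h \<omega>) * q (g \<omega>)) \<le> c * b"
        using mult_mono[OF pq] pq by (simp add: abs_mult)
    qed
  qed simp
  have tr: "(\<integral>\<omega>. p (h \<omega>) * q (f (X (Suc n) \<omega>)) \<partial>M) = (\<integral>\<omega>. p (h \<omega>) * q (kop Q f (X n \<omega>)) \<partial>M)"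
    if [measurable]: "p \<in> borel_measurable borel" "q \<in> borel_measurable borel" and bl: "bounded_linear q"
      and "\<And>z. \<bar>p z\<bar> \<le> cmod z" "\<And>z. \<bar>q z\<bar> \<le> cmod z"
    for p q :: "complex \<Rightarrow> real"
  proof -
    have "(\<integral>\<omega>. p (h \<omega>) * q (f (X (Suc n) \<omega>)) \<partial>M) = (\<integral>\<omega>. p (h \<omega>) * (\<integral>y. q (f y) \<partial>Q (X n \<omega>)) \<partial>M)"
    proof (rule transition_real[where b=b and c=c])
      show "(\<lambda>\<omega>. p (h \<omega>)) \<in> borel_measurable (past n)" by (rule measurable_compose[OF h that(1)])
      show "(\<lambda>x. q (f x)) \<in> borel_measurable E" by (rule measurable_compose[OF f that(2)])
      show "\<bar>q (f x)\<bar> \<le> b" if "x \<in> space E" for x by (rule order_trans[OF _ b[OF that]]) fact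
      show "\<bar>p (h \<omega>)\<bar> \<le> c" if "\<omega> \<in> space M" for \<omega> by (rule order_trans[OF _ bh[OF that]]) fact
    qed
    also have "\<dots> = (\<integral>\<omega>. p (h \<omega>) * q (kop Q f (X n \<omega>)) \<partial>M)"
      using fQ by (intro Bochner_Integration.integral_cong) (auto simp: kop_def integral_bounded_linear[OF bl])
    finally show ?thesis .
  qed
  \<comment> \<open>Splitting a product of complex functions into four real products reduces the
    claim to the real case term by term.\<close>
  have expand: "(\<integral>\<omega>. h \<omega> * g \<omega> \<partial>M) =
      complex_of_real ((\<integral>\<omega>. Re (h \<omega>) * Re (g \<omega>) \<partial>M) - (\<integral>\<omega>. Im (h \<omega>) * Im (g \<omega>) \<partial>M))
      + \<i> * complex_of_real ((\<integral>\<omega>. Re (h \<omega>) * Im (g \<omega>) \<partial>M) + (\<integral>\<omega>. Im (h \<omega>) * Re (g \<omega>) \<partial>M))"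
    if g: "g \<in> borel_measurable M" "\<And>\<omega>. \<omega> \<in> space M \<Longrightarrow> cmod (g \<omega>) \<le> b" for g
  proof -
    have i: "integrable M (\<lambda>\<omega>. Re (h \<omega>) * Re (g \<omega>))" "integrable M (\<lambda>\<omega>. Im (h \<omega>) * Im (g \<omega>))"
      "integrable M (\<lambda>\<omega>. Re (h \<omega>) * Im (g \<omega>))" "integrable M (\<lambda>\<omega>. Im (h \<omega>) * Re (g \<omega>))"
      by (rule int; use g abs_Re_le_cmod abs_Im_le_cmod in auto)+
    have "(\<integral>\<omega>. h \<omega> * g \<omega> \<partial>M) = (\<integral>\<omega>. complex_of_real (Re (h \<omega>) * Re (g \<omega>) - Im (h \<omega>) * Im (g \<omega>))
       + \<i> * complex_of_real (Re (h \<omega>) * Im (g \<omega>) + Im (h \<omega>) * Re (g \<omega>)) \<partial>M)"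
      by (intro Bochner_Integration.integral_cong) (auto simp: complex_eq_iff)
    also have "\<dots> = complex_of_real (\<integral>\<omega>. Re (h \<omega>) * Re (g \<omega>) - Im (h \<omega>) * Im (g \<omega>) \<partial>M)
       + \<i> * complex_of_real (\<integral>\<omega>. Re (h \<omega>) * Im (g \<omega>) + Im (h \<omega>) * Re (g \<omega>) \<partial>M)"
      using Bochner_Integration.integrable_diff[OF i(1,2)] Bochner_Integration.integrable_add[OF i(3,4)]
      by (subst Bochner_Integration.integral_add) (simp_all del: of_real_add of_real_diff of_real_mult add: integrable_of_real)
    finally show ?thesis using i by simp
  qed
  have t: "(\<integral>\<omega>. Re (h \<omega>) * Re (f (X (Suc n) \<omega>)) \<partial>M) = (\<integral>\<omega>. Re (h \<omega>) * Re (kop Q f (X n \<omega>)) \<partial>M)"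
    "(\<integral>\<omega>. Im (h \<omega>) * Im (f (X (Suc n) \<omega>)) \<partial>M) = (\<integral>\<omega>. Im (h \<omega>) * Im (kop Q f (X n \<omega>)) \<partial>M)"
    "(\<integral>\<omega>. Re (h \<omega>) * Im (f (X (Suc n) \<omega>)) \<partial>M) = (\<integral>\<omega>. Re (h \<omega>) * Im (kop Q f (X n \<omega>)) \<partial>M)"
    "(\<integral>\<omega>. Im (h \<omega>) * Re (f (X (Suc n) \<omega>)) \<partial>M) = (\<integral>\<omega>. Im (h \<omega>) * Re (kop Q f (X n \<omega>)) \<partial>M)"
    by (rule tr; simp add: abs_Re_le_cmod abs_Im_le_cmod bounded_linear_Re bounded_linear_Im)+
  have fX: "(\<lambda>\<omega>. f (X (Suc n) \<omega>)) \<in> borel_measurable M" by (rule measurable_compose[OF X_meas f])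
  have fXb: "cmod (f (X (Suc n) \<omega>)) \<le> b" if "\<omega> \<in> space M" for \<omega> by (rule b[OF X_space[OF that]])
  show ?thesis
    by (rule trans[OF expand[OF fX fXb, unfolded t] expand[OF kX kb, symmetric]])
qed

text \<open>The induction needs a test function at the final time: the last phase and
  \<open>f\<close> form a function of \<open>X (Suc n)\<close>, whose kernel integral is
  \<open>kop_t\<close> applied to \<open>f\<close>, a new test function at time \<open>n\<close>
  that is again bounded by 1.\<close>

theorem char_partial_sums:
  assumes xi [measurable]: "\<xi> \<in> borel_measurable E"
  shows "(\<integral>\<omega>. iexp (t * (\<Sum>k=1..n. \<xi> (X k \<omega>))) \<partial>M) = (\<integral>x. (kop_t Q \<xi> t ^^ n) (\<lambda>_. 1) x \<partial>\<mu>0)"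
proof -
  define S where "S n \<omega> = (\<Sum>k=1..n. \<xi> (X k \<omega>))" for n \<omega>
  have S_past: "S n \<in> borel_measurable (past n)" for n
    unfolding S_def[abs_def] by (intro borel_measurable_sum measurable_compose[OF X_past xi]) auto
  have "(\<integral>\<omega>. iexp (t * S n \<omega>) * f (X n \<omega>) \<partial>M) = (\<integral>x. (kop_t Q \<xi> t ^^ n) f x \<partial>\<mu>0)"
    if "f \<in> borel_measurable E" "\<And>x. x \<in> space E \<Longrightarrow> cmod (f x) \<le> 1" for f
    using that
  proof (induction n arbitrary: f)
    case 0
    have "(\<integral>x. f x \<partial>\<mu>0) = (\<integral>\<omega>. f (X 0 \<omega>) \<partial>M)"
      unfolding law_0[symmetric] using 0(1) by (intro integral_distr) auto
    then show ?case by (simp add: S_def)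
  next
    case (Suc n)
    note f [measurable] = Suc.prems(1)
    define g where "g = (\<lambda>y. iexp (t * \<xi> y) * f y)"
    have g [measurable]: "g \<in> borel_measurable E" unfolding g_def by measurable
    have gb: "cmod (g x) \<le> 1" if "x \<in> space E" for x
      using Suc.prems(2)[OF that] by (simp add: g_def norm_mult del: of_real_mult)
    have kg: "kop Q g = kop_t Q \<xi> t f" by (simp add: g_def kop_def[abs_def] kop_t_def[abs_def])
    have kb: "cmod (kop Q g x) \<le> 1" if "x \<in> space E" for x
    proof -
      interpret Qx: prob_space "Q x" by (rule prob_space_Q[OF that])
      have "cmod (kop Q g x) \<le> (\<integral>y. cmod (g y) \<partial>Q x)" unfolding kop_def by (rule integral_norm_bound)
      also have "\<dots> \<le> 1"
        by (rule Qx.integral_le_const[OF Qx.integrable_const_bound[where B=1]])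
           (auto intro!: AE_I2 gb simp: meas_Q[OF that] space_Q[OF that])
      finally show ?thesis .
    qed
    have "(\<integral>\<omega>. iexp (t * S (Suc n) \<omega>) * f (X (Suc n) \<omega>) \<partial>M) = (\<integral>\<omega>. iexp (t * S n \<omega>) * g (X (Suc n) \<omega>) \<partial>M)"
      by (intro Bochner_Integration.integral_cong) (auto simp: S_def g_def algebra_simps exp_add)
    also have "\<dots> = (\<integral>\<omega>. iexp (t * S n \<omega>) * kop Q g (X n \<omega>) \<partial>M)"
      using S_past[of n] by (intro transition_complex[where b=1 and c=1] g gb) (auto simp del: of_real_mult)
    also have "\<dots> = (\<integral>x. (kop_t Q \<xi> t ^^ n) (kop Q g) x \<partial>\<mu>0)"
      by (rule Suc.IH) (auto intro: kb)
    also have "\<dots> = (\<integral>x. (kop_t Q \<xi> t ^^ Suc n) f x \<partial>\<mu>0)" by (simp only: kg funpow_Suc_right o_apply)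
    finally show ?case .
  qed
  from this[of "\<lambda>_. 1"] show ?thesis by (simp add: S_def)
qed

end

section \<open>The Poisson equation and quotient norms\<close>

lemma AE_zero_of_integral_le:
  assumes i: "integrable M (f :: 'a \<Rightarrow> complex)" and le: "\<And>N. (\<integral>x. cmod (f x) \<partial>M) \<le> a N" and lim: "a \<longlonglongrightarrow> 0"
  shows "AE x in M. f x = 0"
proof -
  have "(\<integral>x. cmod (f x) \<partial>M) \<le> 0" by (rule LIMSEQ_le_const[OF lim]) (use le in auto)
  then have "(\<integral>x. cmod (f x) \<partial>M) = 0" by (intro antisym Bochner_Integration.integral_nonneg) auto
  then have "AE x in M. cmod (f x) = 0"
    using integral_nonneg_eq_0_iff_AE[of M "\<lambda>x. cmod (f x)"] i by simp
  then show ?thesis by simp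
qed

section \<open>Function spaces with a complete norm\<close>

locale banach_functions =
  fixes E :: "'e measure" and B :: "('e \<Rightarrow> complex) set" and nB :: "('e \<Rightarrow> complex) \<Rightarrow> real"
  assumes banach: "banach_fun_space E B nB"
begin

lemma B_meas: "f \<in> B \<Longrightarrow> f \<in> borel_measurable E"
  and B_zero: "(\<lambda>_. 0) \<in> B"
  and B_plus: "f \<in> B \<Longrightarrow> g \<in> B \<Longrightarrow> f + g \<in> B"
  and B_scale: "f \<in> B \<Longrightarrow> (\<lambda>x. c * f x) \<in> B"
  and nB_nonneg: "f \<in> B \<Longrightarrow> 0 \<le> nB f"
  and nB_eq_0: "f \<in> B \<Longrightarrow> nB f = 0 \<longleftrightarrow> f = (\<lambda>_. 0)"
  and nB_scale: "f \<in> B \<Longrightarrow> nB (\<lambda>x. c * f x) = cmod c * nB f"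
  and nB_plus: "f \<in> B \<Longrightarrow> g \<in> B \<Longrightarrow> nB (f + g) \<le> nB f + nB g"
  using banach unfolding banach_fun_space_def by blast+

lemma complete:
  "(\<And>n. s n \<in> B) \<Longrightarrow> (\<And>e. e > 0 \<Longrightarrow> \<exists>N. \<forall>m\<ge>N. \<forall>k\<ge>N. nB (s m - s k) < e) \<Longrightarrow>
     \<exists>f\<in>B. (\<lambda>n. nB (s n - f)) \<longlonglongrightarrow> 0"
  using banach unfolding banach_fun_space_def by blast

lemma B_add: "f \<in> B \<Longrightarrow> g \<in> B \<Longrightarrow> (\<lambda>x. f x + c * g x) \<in> B"
  using B_plus[OF _ B_scale, of f g c] by (simp add: plus_fun_def)

lemma nB_add: "f \<in> B \<Longrightarrow> g \<in> B \<Longrightarrow> nB (\<lambda>x. f x + c * g x) \<le> nB f + cmod c * nB g"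
  using nB_plus[OF _ B_scale, of f g c] by (simp add: plus_fun_def nB_scale)

lemma diff_eq: "f - g = (\<lambda>x. f x + (-1) * g x)" for f g :: "'e \<Rightarrow> complex"
  by (simp add: fun_eq_iff)

lemma B_diff: "f \<in> B \<Longrightarrow> g \<in> B \<Longrightarrow> f - g \<in> B"
  unfolding diff_eq by (rule B_add)

lemma nB_diff: "f \<in> B \<Longrightarrow> g \<in> B \<Longrightarrow> nB (f - g) \<le> nB f + nB g"
  using nB_add[of f g "-1"] by (simp add: diff_eq)

lemma nB_diff_commute: "f \<in> B \<Longrightarrow> g \<in> B \<Longrightarrow> nB (f - g) = nB (g - f)"
proof -
  assume fg: "f \<in> B" "g \<in> B"
  have "f - g = (\<lambda>x. (-1) * (g - f) x)" by (simp add: fun_eq_iff)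
  then have "nB (f - g) = cmod (-1) * nB (g - f)" using nB_scale[OF B_diff[OF fg(2,1)], of "-1"] by simp
  then show ?thesis by simp
qed

text \<open>Turns the O(|t|) assumptions, which speak of the unit ball, into bounds proportional to
  the norm. Definiteness of the norm covers the functions that cannot be normalised.\<close>

lemma unit_ball_bound:
  fixes F :: "('e \<Rightarrow> complex) \<Rightarrow> real"
  assumes scale: "\<And>c f. f \<in> B \<Longrightarrow> F (\<lambda>x. c * f x) = cmod c * F f"
    and ball: "\<And>f. f \<in> B \<Longrightarrow> nB f \<le> 1 \<Longrightarrow> F f \<le> K" and f: "f \<in> B"
  shows "F f \<le> K * nB f"
proof (cases "nB f = 0")
  case True
  then have "f = (\<lambda>_. 0)" using nB_eq_0[OF f] by simp
  then have "F f = 0" using scale[OF f, of 0] by simp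
  then show ?thesis using True by simp
next
  case False
  then have p: "0 < nB f" using nB_nonneg[OF f] by simp
  let ?c = "complex_of_real (1 / nB f)"
  have c: "cmod ?c = 1 / nB f" using p by (simp del: of_real_divide)
  have "F (\<lambda>x. ?c * f x) \<le> K"
    by (rule ball[OF B_scale[OF f]]) (use p in \<open>simp add: nB_scale[OF f] c del: of_real_divide\<close>)
  then have "1 / nB f * F f \<le> K" unfolding scale[OF f] c .
  then show ?thesis using p by (simp add: field_simps)
qed

end

text \<open>The norm of \<open>B\<close> sees the values of a function off \<open>space E\<close>, where the kernel is arbitrary.
  The quotient norm of the restrictions to \<open>space E\<close> removes this artefact.\<close>

definition restr :: "'e measure \<Rightarrow> ('e \<Rightarrow> complex) \<Rightarrow> 'e \<Rightarrow> complex" where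
  "restr E f = (\<lambda>x. if x \<in> space E then f x else 0)"

definition quotient_norm ::
  "'e measure \<Rightarrow> ('e \<Rightarrow> complex) set \<Rightarrow> (('e \<Rightarrow> complex) \<Rightarrow> real) \<Rightarrow> ('e \<Rightarrow> complex) \<Rightarrow> real" where
  "quotient_norm E B nB f = Inf {nB g | g. g \<in> B \<and> restr E g = f}"

lemma restr_eqD: "restr E f = h \<Longrightarrow> x \<in> space E \<Longrightarrow> h x = f x"
  by (auto simp: restr_def)

lemma restr_add: "restr E (\<lambda>x. f x + c * g x) = (\<lambda>x. restr E f x + c * restr E g x)"
  by (auto simp: restr_def)

lemma restr_scale: "restr E (\<lambda>x. c * g x) = (\<lambda>x. c * restr E g x)"
  by (auto simp: restr_def)

lemma restr_measurable: "f \<in> borel_measurable E \<Longrightarrow> restr E f \<in> borel_measurable E"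
  by (subst measurable_cong[where g=f]) (auto simp: restr_def)

context banach_functions
begin

abbreviation "qn \<equiv> quotient_norm E B nB"

lemma qn_le: "g \<in> B \<Longrightarrow> qn (restr E g) \<le> nB g"
  unfolding quotient_norm_def by (rule cInf_lower) (auto intro!: bdd_belowI[where m=0] nB_nonneg)

text \<open>A bound holding for every representative passes to the infimum. The given representative
  keeps the infimum from being taken over the empty set, and the additive \<open>d\<close>
  accommodates terms depending on the class only, such as an L^1 norm.\<close>

lemma qn_bound:
  assumes g0: "g0 \<in> B" "restr E g0 = f"
    and le: "\<And>g. g \<in> B \<Longrightarrow> restr E g = f \<Longrightarrow> a \<le> d + C * nB g" and C: "0 \<le> C"
  shows "a \<le> d + C * qn f"
proof (cases "C = 0")
  case True
  then show ?thesis using le[OF g0] by simp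
next
  case False
  with C have C: "0 < C" by simp
  have "(a - d) / C \<le> qn f" unfolding quotient_norm_def
    by (rule cInf_greatest) (use g0 le C in \<open>auto simp: field_simps\<close>)
  then show ?thesis using C by (simp add: field_simps)
qed

lemma qn_nonneg: "g \<in> B \<Longrightarrow> restr E g = f \<Longrightarrow> 0 \<le> qn f"
  using qn_bound[of g f 0 0 1] nB_nonneg by simp

lemma qn_add:
  assumes g: "g \<in> B" "restr E g = f" and k: "k \<in> B" "restr E k = h"
  shows "qn (\<lambda>x. f x + c * h x) \<le> qn f + cmod c * qn h"
proof (rule qn_bound[OF k])
  fix k' assume k': "k' \<in> B" "restr E k' = h"
  have "qn (\<lambda>x. f x + c * h x) \<le> cmod c * nB k' + 1 * qn f"
  proof (rule qn_bound[OF g])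
    fix g' assume g': "g' \<in> B" "restr E g' = f"
    have "qn (restr E (\<lambda>x. g' x + c * k' x)) \<le> nB (\<lambda>x. g' x + c * k' x)"
      by (rule qn_le[OF B_add[OF g'(1) k'(1)]])
    also have "\<dots> \<le> nB g' + cmod c * nB k'" by (rule nB_add[OF g'(1) k'(1)])
    finally show "qn (\<lambda>x. f x + c * h x) \<le> cmod c * nB k' + 1 * nB g'"
      by (simp add: restr_add g' k')
  qed simp
  then show "qn (\<lambda>x. f x + c * h x) \<le> qn f + cmod c * nB k'" by simp
qed simp

lemma qn_scale:
  assumes g: "g \<in> B" "restr E g = f"
  shows "qn (\<lambda>x. c * f x) \<le> cmod c * qn f"
proof -
  have "qn (\<lambda>x. c * f x) \<le> 0 + cmod c * qn f"
  proof (rule qn_bound[OF g])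
    fix g' assume g': "g' \<in> B" "restr E g' = f"
    have "qn (restr E (\<lambda>x. c * g' x)) \<le> nB (\<lambda>x. c * g' x)" by (rule qn_le[OF B_scale[OF g'(1)]])
    then show "qn (\<lambda>x. c * f x) \<le> 0 + cmod c * nB g'" by (simp add: restr_scale g' nB_scale)
  qed simp
  then show ?thesis by simp
qed

end

section \<open>Geometric ergodicity and the Poisson equation\<close>

lemma sum_fun_apply: "(\<Sum>n<N. F n) x = (\<Sum>n<N. F n x)" for F :: "nat \<Rightarrow> 'e \<Rightarrow> complex"
  by (induction N) (simp_all add: zero_fun_def plus_fun_def)

locale ergodic_functions = stationary_kernel E Q \<nu> + banach_functions E B nB
  for E :: "'e measure" and Q \<nu> B nB +
  assumes erg: "geom_ergodic \<nu> Q B nB"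
begin

lemma one_B: "(\<lambda>_. 1) \<in> B" and B_int: "f \<in> B \<Longrightarrow> integrable \<nu> f" and kop_B: "f \<in> B \<Longrightarrow> kop Q f \<in> B"
  using erg unfolding geom_ergodic_def by blast+

lemma B_L1: obtains K where "0 \<le> K" "\<And>f. f \<in> B \<Longrightarrow> (\<integral>x. cmod (f x) \<partial>\<nu>) \<le> K * nB f"
proof -
  obtain K where K: "\<forall>f\<in>B. (\<integral>x. cmod (f x) \<partial>\<nu>) \<le> K * nB f"
    using erg unfolding geom_ergodic_def by blast
  show ?thesis
  proof (rule that[of "\<bar>K\<bar>"])
    fix f assume f: "f \<in> B"
    have "(\<integral>x. cmod (f x) \<partial>\<nu>) \<le> K * nB f" using K f by blast
    also have "\<dots> \<le> \<bar>K\<bar> * nB f" using nB_nonneg[OF f] by (intro mult_right_mono) auto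
    finally show "(\<integral>x. cmod (f x) \<partial>\<nu>) \<le> \<bar>K\<bar> * nB f" .
  qed simp
qed

lemma kop_bound: obtains K where "0 \<le> K" "\<And>f. f \<in> B \<Longrightarrow> nB (kop Q f) \<le> K * nB f"
proof -
  obtain K where K: "\<forall>f\<in>B. nB (kop Q f) \<le> K * nB f"
    using erg unfolding geom_ergodic_def by blast
  show ?thesis
  proof (rule that[of "\<bar>K\<bar>"])
    fix f assume f: "f \<in> B"
    have "nB (kop Q f) \<le> K * nB f" using K f by blast
    also have "\<dots> \<le> \<bar>K\<bar> * nB f" using nB_nonneg[OF f] by (intro mult_right_mono) auto
    finally show "nB (kop Q f) \<le> \<bar>K\<bar> * nB f" .
  qed simp
qed

lemma kop_pow_B: "f \<in> B \<Longrightarrow> (kop Q ^^ n) f \<in> B"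
  by (induction n) (simp_all add: kop_B)

lemma kop_pow_decay:
  obtains K r where "0 \<le> K" "0 \<le> r" "r < 1"
    "\<And>n f. 1 \<le> n \<Longrightarrow> f \<in> B \<Longrightarrow> (\<integral>x. f x \<partial>\<nu>) = 0 \<Longrightarrow> nB ((kop Q ^^ n) f) \<le> K * r ^ n * nB f"
proof -
  obtain r K where K: "0 \<le> r" "r < 1" "K \<ge> 0"
    "\<forall>n\<ge>1. \<forall>f\<in>B. nB ((kop Q ^^ n) f - (\<lambda>_. (\<integral>x. f x \<partial>\<nu>))) \<le> K * r ^ n * nB f"
    using erg unfolding geom_ergodic_def by blast
  show ?thesis
  proof (rule that[of K r])
    fix n :: nat and f assume n: "1 \<le> n" and f: "f \<in> B" and z: "(\<integral>x. f x \<partial>\<nu>) = 0"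
    have "(kop Q ^^ n) f - (\<lambda>_. 0) = (kop Q ^^ n) f" by (simp add: fun_eq_iff)
    then show "nB ((kop Q ^^ n) f) \<le> K * r ^ n * nB f" using K(4) n f z by metis
  qed (use K in auto)
qed

end

locale poisson_equation = ergodic_functions E Q \<nu> B nB
  for E :: "'e measure" and Q \<nu> B nB +
  fixes \<xi> :: "'e \<Rightarrow> real"
  assumes xi_B: "(\<lambda>x. complex_of_real (\<xi> x)) \<in> B" and xi_mean: "(\<integral>x. \<xi> x \<partial>\<nu>) = 0"
begin

abbreviation f0 :: "'e \<Rightarrow> complex" where "f0 \<equiv> \<lambda>x. complex_of_real (\<xi> x)"

definition psum :: "nat \<Rightarrow> 'e \<Rightarrow> complex" where "psum N = (\<Sum>n<N. (kop Q ^^ n) f0)"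

lemma psum_Suc: "psum (Suc N) = (\<lambda>x. psum N x + 1 * (kop Q ^^ N) f0 x)"
  by (simp add: psum_def plus_fun_def fun_eq_iff)

lemma psum_B: "psum N \<in> B"
proof (induction N)
  case 0
  then show ?case using B_zero by (simp add: psum_def zero_fun_def)
next
  case (Suc N)
  then show ?case unfolding psum_Suc by (rule B_add[OF _ kop_pow_B[OF xi_B]])
qed

lemma f0_mean: "(\<integral>x. f0 x \<partial>\<nu>) = 0"
  using xi_mean by simp

lemma psum_diff: "m \<ge> k \<Longrightarrow> nB (psum m - psum k) \<le> (\<Sum>n=k..<m. nB ((kop Q ^^ n) f0))"
proof (induction m rule: dec_induct)
  case base
  have "psum k - psum k = (\<lambda>_. 0)" by (simp add: fun_eq_iff)
  then show ?case using nB_eq_0[OF B_zero] by simp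
next
  case (step m)
  have "psum (Suc m) - psum k = (\<lambda>x. (psum m - psum k) x + 1 * (kop Q ^^ m) f0 x)"
    by (simp add: psum_Suc fun_eq_iff)
  then have 1: "nB (psum (Suc m) - psum k) \<le> nB (psum m - psum k) + cmod 1 * nB ((kop Q ^^ m) f0)"
    by (simp only: nB_add[OF B_diff[OF psum_B psum_B] kop_pow_B[OF xi_B]])
  have 2: "(\<Sum>n=k..<Suc m. nB ((kop Q ^^ n) f0)) = (\<Sum>n=k..<m. nB ((kop Q ^^ n) f0)) + nB ((kop Q ^^ m) f0)"
    using step.hyps by simp
  show ?case unfolding 2
    by (rule order_trans[OF 1]) (unfold norm_one mult_1_left, rule add_right_mono[OF step.IH])
qed

text \<open>\<open>\<xi>\<close> has mean 0, so its images under \<open>Q\<close> decay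
  geometrically in \<open>B\<close>, the series converges absolutely and completeness supplies the
  limit.\<close>

lemma psum_converges: "\<exists>g\<in>B. (\<lambda>N. nB (psum N - g)) \<longlonglongrightarrow> 0"
proof (rule complete[OF psum_B])
  fix e :: real assume e: "0 < e"
  obtain K r where K: "0 \<le> K" "0 \<le> r" "r < 1"
    "\<And>n f. 1 \<le> n \<Longrightarrow> f \<in> B \<Longrightarrow> (\<integral>x. f x \<partial>\<nu>) = 0 \<Longrightarrow> nB ((kop Q ^^ n) f) \<le> K * r ^ n * nB f"
    using kop_pow_decay by blast
  have "summable (\<lambda>n. nB ((kop Q ^^ n) f0))"
  proof (rule summable_comparison_test')
    show "summable (\<lambda>n. K * nB f0 * r ^ n)" using K by (intro summable_mult summable_geometric) auto
    show "norm (nB ((kop Q ^^ n) f0)) \<le> K * nB f0 * r ^ n" if "1 \<le> n" for n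
      using K(4)[OF that xi_B f0_mean] nB_nonneg[OF kop_pow_B[OF xi_B]] by (simp add: mult_ac)
  qed
  then obtain N where N: "\<And>m n. N \<le> m \<Longrightarrow> norm (\<Sum>k=m..<n. nB ((kop Q ^^ k) f0)) < e"
    using e unfolding summable_Cauchy by meson
  have le: "nB (psum m - psum k) < e" if "N \<le> k" "k \<le> m" for m k
    using psum_diff[OF that(2)] N[OF that(1), of m] by simp
  show "\<exists>N. \<forall>m\<ge>N. \<forall>k\<ge>N. nB (psum m - psum k) < e"
  proof (intro exI[of _ N] allI impI)
    fix m k assume "N \<le> m" "N \<le> k"
    then show "nB (psum m - psum k) < e"
      using le[of k m] le[of m k] nB_diff_commute[OF psum_B psum_B, of m k] by (cases "k \<le> m") auto
  qed
qed

abbreviation "xc \<equiv> xi_check Q B nB \<xi>"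

text \<open>The definite description is meaningful because limits are unique: a function at norm
  distance 0 from another equals it at every point.\<close>

lemma xi_check: "xc \<in> B" "(\<lambda>N. nB (psum N - xc)) \<longlonglongrightarrow> 0"
proof -
  obtain g where g: "g \<in> B" "(\<lambda>N. nB (psum N - g)) \<longlonglongrightarrow> 0" using psum_converges by blast
  have "xc = g" unfolding xi_check_def
  proof (rule the_equality)
    show "g \<in> B \<and> (\<lambda>N. nB ((\<Sum>n<N. (kop Q ^^ n) (\<lambda>x. complex_of_real (\<xi> x))) - g)) \<longlonglongrightarrow> 0"
      using g by (simp add: psum_def)
  next
    fix g' assume "g' \<in> B \<and> (\<lambda>N. nB ((\<Sum>n<N. (kop Q ^^ n) (\<lambda>x. complex_of_real (\<xi> x))) - g')) \<longlonglongrightarrow> 0"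
    then have g': "g' \<in> B" "(\<lambda>N. nB (psum N - g')) \<longlonglongrightarrow> 0" by (simp_all add: psum_def)
    have "nB (g' - g) \<le> nB (psum N - g) + nB (psum N - g')" for N
    proof -
      have "g' - g = (psum N - g) - (psum N - g')" by (simp add: fun_eq_iff)
      then show ?thesis using nB_diff[OF B_diff[OF psum_B g(1)] B_diff[OF psum_B g'(1)], of N N] by simp
    qed
    then have "nB (g' - g) \<le> 0 + 0"
      by (intro LIMSEQ_le_const[OF tendsto_add[OF g(2) g'(2)]]) auto
    then have "nB (g' - g) = 0" using nB_nonneg[OF B_diff[OF g'(1) g(1)]] by simp
    then have "g' - g = (\<lambda>_. 0)" using nB_eq_0[OF B_diff[OF g'(1) g(1)]] by simp
    then show "g' = g" by (simp add: fun_eq_iff)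
  qed
  then show "xc \<in> B" "(\<lambda>N. nB (psum N - xc)) \<longlonglongrightarrow> 0" using g by simp_all
qed

lemma psum_L1: "(\<lambda>N. \<integral>x. cmod (psum N x - xc x) \<partial>\<nu>) \<longlonglongrightarrow> 0"
proof -
  obtain K where K: "0 \<le> K" "\<And>f. f \<in> B \<Longrightarrow> (\<integral>x. cmod (f x) \<partial>\<nu>) \<le> K * nB f" using B_L1 by blast
  have "(\<lambda>N. K * nB (psum N - xc)) \<longlonglongrightarrow> K * 0" by (intro tendsto_intros xi_check)
  then have lim: "(\<lambda>N. K * nB (psum N - xc)) \<longlonglongrightarrow> 0" by simp
  show ?thesis
  proof (rule tendsto_sandwich[OF _ _ tendsto_const lim])
    show "\<forall>\<^sub>F N in sequentially. (\<integral>x. cmod (psum N x - xc x) \<partial>\<nu>) \<le> K * nB (psum N - xc)"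
      using K(2)[OF B_diff[OF psum_B xi_check(1)]] by simp
  qed simp
qed

lemma kop_psum_AE: "AE x in \<nu>. kop Q (psum N) x = psum (Suc N) x - f0 x"
proof (induction N)
  case 0
  show ?case by (simp add: psum_def kop_def zero_fun_def)
next
  case (Suc N)
  have "AE x in \<nu>. kop Q (psum (Suc N)) x = kop Q (psum N) x + 1 * kop Q ((kop Q ^^ N) f0) x"
    unfolding psum_Suc by (rule kop_add_AE[OF B_int[OF psum_B] B_int[OF kop_pow_B[OF xi_B]]])
  with Suc show ?case by eventually_elim (simp add: psum_Suc[of "Suc N"])
qed

text \<open>Partial sums satisfy \<open>Q psum_N = psum_{N+1} - \<xi>\<close>. Both sides converge
  in L^1, where \<open>Q\<close> is a contraction; \<open>Q\<close> is not applied to the limit of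
  the series termwise, so the equation holds only almost everywhere.\<close>

lemma poisson_AE: "AE x in \<nu>. xc x = f0 x + kop Q xc x"
proof -
  have ix: "integrable \<nu> xc" and ik: "integrable \<nu> (kop Q xc)" and i0: "integrable \<nu> f0"
    using B_int[OF xi_check(1)] B_int[OF kop_B[OF xi_check(1)]] B_int[OF xi_B] by simp_all
  define a where "a N = (\<integral>x. cmod (psum (Suc N) x - xc x) \<partial>\<nu>) + (\<integral>x. cmod (psum N x - xc x) \<partial>\<nu>)" for N
  have "(\<integral>x. cmod (xc x - f0 x - kop Q xc x) \<partial>\<nu>) \<le> a N" for N
  proof -
    have ip: "integrable \<nu> (psum N)" "integrable \<nu> (psum (Suc N))" using B_int[OF psum_B] by auto
    have id: "integrable \<nu> (\<lambda>x. psum N x + (-1) * xc x)" using ip ix by simp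
    note k = integral_kop[OF id]
    have "AE x in \<nu>. kop Q (\<lambda>y. psum N y + (-1) * xc y) x = kop Q (psum N) x + (-1) * kop Q xc x"
      by (rule kop_add_AE[OF ip(1) ix])
    with kop_psum_AE[of N]
    have "AE x in \<nu>. cmod (xc x - f0 x - kop Q xc x)
        \<le> cmod (psum (Suc N) x - xc x) + cmod (kop Q (\<lambda>y. psum N y + (-1) * xc y) x)"
    proof eventually_elim
      case (elim x)
      then have eq: "xc x - f0 x - kop Q xc x = - (psum (Suc N) x - xc x) + kop Q (\<lambda>y. psum N y + (-1) * xc y) x" by simp
      show ?case unfolding eq
        using norm_triangle_ineq[of "- (psum (Suc N) x - xc x)" "kop Q (\<lambda>y. psum N y + (-1) * xc y) x"]
        by (simp only: norm_minus_cancel)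
    qed
    then have "(\<integral>x. cmod (xc x - f0 x - kop Q xc x) \<partial>\<nu>)
        \<le> (\<integral>x. cmod (psum (Suc N) x - xc x) + cmod (kop Q (\<lambda>y. psum N y + (-1) * xc y) x) \<partial>\<nu>)"
      using ix ik i0 ip k(1) by (intro integral_mono_AE) auto
    also have "\<dots> = (\<integral>x. cmod (psum (Suc N) x - xc x) \<partial>\<nu>) + (\<integral>x. cmod (kop Q (\<lambda>y. psum N y + (-1) * xc y) x) \<partial>\<nu>)"
      using ix ip k(1) by (intro Bochner_Integration.integral_add) auto
    also have "\<dots> \<le> a N" using k(3) by (simp add: a_def)
    finally show ?thesis .
  qed
  moreover have "a \<longlonglongrightarrow> 0" unfolding a_def[abs_def]
    using tendsto_add[OF LIMSEQ_Suc[OF psum_L1] psum_L1] by simp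
  ultimately have "AE x in \<nu>. xc x - f0 x - kop Q xc x = 0"
    using ix ik i0 by (intro AE_zero_of_integral_le[where a=a]) auto
  then show ?thesis by eventually_elim (simp add: algebra_simps)
qed

lemma psum_real: "Im (psum N x) = 0"
proof -
  have "\<exists>u. (kop Q ^^ n) f0 = (\<lambda>x. complex_of_real (u x))" for n
  proof (induction n)
    case (Suc n)
    then obtain u where "(kop Q ^^ n) f0 = (\<lambda>x. complex_of_real (u x))" by blast
    then show ?case by (intro exI[of _ "\<lambda>x. \<integral>y. u y \<partial>Q x"]) (simp add: kop_def[abs_def])
  qed auto
  then have "Im ((kop Q ^^ n) f0 x) = 0" for n by (metis Im_complex_of_real)
  then show ?thesis by (simp add: psum_def sum_fun_apply)
qed

text \<open>The partial sums are real at every point, as integrals of real functions, and the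
  solution is their L^1 limit.\<close>

lemma xi_check_real: "AE x in \<nu>. Im (xc x) = 0"
proof -
  have ix: "integrable \<nu> xc" using B_int[OF xi_check(1)] .
  have "(\<integral>x. cmod (complex_of_real (Im (xc x))) \<partial>\<nu>) \<le> (\<integral>x. cmod (psum N x - xc x) \<partial>\<nu>)" for N
  proof (rule integral_mono)
    show "cmod (complex_of_real (Im (xc x))) \<le> cmod (psum N x - xc x)" for x
      using abs_Im_le_cmod[of "psum N x - xc x"] by (simp add: psum_real)
  qed (use ix B_int[OF psum_B] in auto)
  then have "AE x in \<nu>. complex_of_real (Im (xc x)) = 0"
    using ix by (intro AE_zero_of_integral_le[OF _ _ psum_L1]) auto
  then show ?thesis by simp
qed

text \<open>The solution of the Poisson equation is complex and solves it almost everywhere, so real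
  representatives have to be chosen. All later quantities are transferred to them up to null sets,
  and \<open>\<psi>\<close> has mean 0 by invariance and the formula for the variance.\<close>

theorem coboundary:
  assumes cube_int: "\<And>f. f \<in> B \<Longrightarrow> integrable \<nu> (\<lambda>x. cmod (f x) ^ 3)"
    and psi_int: "\<And>p. integrable \<nu> (\<lambda>x. cmod ((kop Q ^^ p) (psi \<nu> Q B nB \<xi>) x) powr (3/2))"
    and psi_summable: "summable (\<lambda>p. (\<integral>x. cmod ((kop Q ^^ p) (psi \<nu> Q B nB \<xi>) x) powr (3/2) \<partial>\<nu>) powr (2/3))"
    and xi_meas: "\<xi> \<in> borel_measurable E"
    and s2: "0 \<le> sigma2 \<nu> Q B nB \<xi>"
  shows "\<exists>h g. coboundary_kernel E Q \<nu> \<xi> h g (sigma2 \<nu> Q B nB \<xi>) (psi \<nu> Q B nB \<xi>)"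
proof -
  define s where "s = sigma2 \<nu> Q B nB \<xi>"
  define \<psi> where "\<psi> = psi \<nu> Q B nB \<xi>"
  \<comment> \<open>Defining \<open>h\<close> from \<open>\<xi>\<close> and \<open>g\<close>, and
    not as the real part of the solution, makes \<open>\<xi> = h - g\<close> exact at every
    point.\<close>
  define g where "g x = Re (kop Q xc x)" for x
  define h where "h x = \<xi> x + g x" for x
  have kB: "kop Q xc \<in> B" by (rule kop_B[OF xi_check(1)])
  note [measurable] = xi_meas B_meas[OF kB] B_meas[OF xi_check(1)]
  have g_meas [measurable]: "g \<in> borel_measurable E" unfolding g_def by measurable
  have h_meas [measurable]: "h \<in> borel_measurable E" unfolding h_def by measurable
  have kg: "AE x in \<nu>. kop Q xc x = complex_of_real (g x)"
    using poisson_AE xi_check_real by eventually_elim (simp add: g_def complex_eq_iff)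
  have xh: "AE x in \<nu>. xc x = complex_of_real (h x)"
    using poisson_AE kg by eventually_elim (simp add: h_def)
  have Qh: "AE x in \<nu>. (\<integral>y. h y \<partial>Q x) = g x"
  proof -
    have "AE x in \<nu>. kop Q xc x = kop Q (\<lambda>x. complex_of_real (h x)) x" by (rule kop_cong_AE[OF _ _ xh]) measurable
    with kg show ?thesis by eventually_elim (simp add: kop_def)
  qed
  have Qh2: "AE x in \<nu>. kop Q (\<lambda>y. (xc y)\<^sup>2) x = complex_of_real (\<integral>y. (h y)\<^sup>2 \<partial>Q x)"
  proof -
    have "AE x in \<nu>. kop Q (\<lambda>y. (xc y)\<^sup>2) x = kop Q (\<lambda>y. complex_of_real ((h y)\<^sup>2)) x"
      by (rule kop_cong_AE) (use xh in \<open>auto elim: eventually_mono\<close>)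
    then show ?thesis by (simp add: kop_def del: of_real_power)
  qed
  have g3: "integrable \<nu> (\<lambda>x. \<bar>g x\<bar> ^ 3)"
  proof (rule Bochner_Integration.integrable_bound[OF cube_int[OF kB]])
    show "AE x in \<nu>. norm (\<bar>g x\<bar> ^ 3) \<le> norm (cmod (kop Q xc x) ^ 3)"
      by (rule AE_I2) (simp add: g_def abs_Re_le_cmod power_mono)
  qed (simp add: meas_nu)
  have h3: "integrable \<nu> (\<lambda>x. \<bar>h x\<bar> ^ 3)"
  proof (rule Bochner_Integration.integrable_bound)
    show "integrable \<nu> (\<lambda>x. 4 * (cmod (f0 x) ^ 3 + \<bar>g x\<bar> ^ 3))" using cube_int[OF xi_B] g3 by simp
    show "AE x in \<nu>. norm (\<bar>h x\<bar> ^ 3) \<le> norm (4 * (cmod (f0 x) ^ 3 + \<bar>g x\<bar> ^ 3))"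
    proof (rule AE_I2)
      fix x
      have "\<bar>h x\<bar> ^ 3 \<le> 4 * (\<bar>\<xi> x\<bar> ^ 3 + \<bar>g x\<bar> ^ 3)" using abs_diff_cubed_le[of "\<xi> x" "- g x"] by (simp add: h_def)
      then show "norm (\<bar>h x\<bar> ^ 3) \<le> norm (4 * (cmod (f0 x) ^ 3 + \<bar>g x\<bar> ^ 3))" by simp
    qed
  qed (simp add: meas_nu)
  note h2 = integrable_power_of_cube[OF h_meas h3, of 2, simplified]
    and g2 = integrable_power_of_cube[OF g_meas g3, of 2, simplified]
  have psi_AE: "AE x in \<nu>. \<psi> x = complex_of_real ((\<integral>y. (h y)\<^sup>2 \<partial>Q x) - (g x)\<^sup>2 - s)"
    using Qh2 kg by eventually_elim (simp add: \<psi>_def psi_def s_def)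
  have s_eq: "s = (\<integral>x. (h x)\<^sup>2 \<partial>\<nu>) - (\<integral>x. (g x)\<^sup>2 \<partial>\<nu>)"
  proof -
    have "(\<integral>x. (xc x)\<^sup>2 \<partial>\<nu>) = (\<integral>x. complex_of_real ((h x)\<^sup>2) \<partial>\<nu>)"
      using xh by (intro integral_cong_AE) (auto simp: meas_nu elim: eventually_mono)
    moreover have "(\<integral>x. (kop Q xc x)\<^sup>2 \<partial>\<nu>) = (\<integral>x. complex_of_real ((g x)\<^sup>2) \<partial>\<nu>)"
      using kg by (intro integral_cong_AE) (auto simp: meas_nu elim: eventually_mono)
    ultimately show ?thesis by (simp add: s_def sigma2_def del: of_real_power)
  qed
  have psi_meas: "\<psi> \<in> borel_measurable E"
    unfolding \<psi>_def psi_def[abs_def] by (intro borel_measurable_diff kop_measurable borel_measurable_power) measurable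
  have psi_mean: "(\<integral>x. \<psi> x \<partial>\<nu>) = 0"
  proof -
    have "(\<integral>x. \<psi> x \<partial>\<nu>) = (\<integral>x. complex_of_real ((\<integral>y. (h y)\<^sup>2 \<partial>Q x) - (g x)\<^sup>2 - s) \<partial>\<nu>)"
      using psi_AE psi_meas by (intro integral_cong_AE) (auto simp: meas_nu)
    also have "\<dots> = complex_of_real ((\<integral>x. (h x)\<^sup>2 \<partial>\<nu>) - (\<integral>x. (g x)\<^sup>2 \<partial>\<nu>) - s)"
      using integral_Q(1)[OF h2] g2 integral_integral_Q_real[OF h2] prob_space
      by (simp del: of_real_diff)
    finally show ?thesis using s_eq by simp
  qed
  have "coboundary_kernel E Q \<nu> \<xi> h g s \<psi>"
    by unfold_locales
       (use h_meas g_meas h3 g3 Qh psi_meas psi_AE psi_int psi_summable psi_mean s2 in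
         \<open>simp_all add: s_def[symmetric] \<psi>_def[symmetric] h_def\<close>)
  then show ?thesis unfolding s_def \<psi>_def by blast
qed

end

section \<open>The Berry-Esseen theorem\<close>

lemma (in markov_kernel) kop_t_restr:
  assumes "x \<in> space E"
  shows "kop_t Q \<xi> t (restr E f) x = kop_t Q \<xi> t f x"
  unfolding kop_t_def using space_Q[OF assms]
  by (intro Bochner_Integration.integral_cong) (auto simp: restr_def)

lemma kop_t_0: "kop_t Q \<xi> 0 = kop Q"
  by (simp add: kop_t_def[abs_def] kop_def[abs_def])

text \<open>\<open>c\<close> and \<open>\<delta>0\<close> are a common constant and a common radius
  for all perturbation estimates; these are already in homogeneous form, for functions of arbitrary
  norm.\<close>

locale nagaev_setting = B: poisson_equation E Q \<nu> B nB \<xi> + Bt: ergodic_functions E Q \<nu> Bt nBt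
  for E :: "'e measure" and Q \<nu> B nB \<xi> Bt nBt +
  fixes C \<kappa> c \<delta>0 :: real
  assumes xi_meas [measurable]: "\<xi> \<in> borel_measurable E" and sub: "B \<subseteq> Bt"
    and kop_t_B: "\<And>t f. \<bar>t\<bar> < \<delta>0 \<Longrightarrow> f \<in> B \<Longrightarrow> kop_t Q \<xi> t f \<in> B"
    and LY: "\<And>t n f. \<bar>t\<bar> < \<delta>0 \<Longrightarrow> 1 \<le> n \<Longrightarrow> f \<in> B \<Longrightarrow>
        nB ((kop_t Q \<xi> t ^^ n) f) \<le> C * \<kappa> ^ n * nB f + C * (\<integral>x. cmod (f x) \<partial>\<nu>)"
    and pert_L1: "\<And>t f. \<bar>t\<bar> < \<delta>0 \<Longrightarrow> f \<in> B \<Longrightarrow> (\<integral>x. cmod (iexp (t * \<xi> x) - 1) * cmod (f x) \<partial>\<nu>) \<le> c * \<bar>t\<bar> * nB f"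
    and pert_Bt: "\<And>t f. \<bar>t\<bar> < \<delta>0 \<Longrightarrow> f \<in> B \<Longrightarrow> nBt (kop_t Q \<xi> t f - kop Q f) \<le> c * \<bar>t\<bar> * nB f"
    and bounds: "0 \<le> C" "0 \<le> \<kappa>" "\<kappa> < 1" "0 \<le> c" "0 < \<delta>0"
begin

abbreviation "N \<equiv> quotient_norm E B nB"
abbreviation "Nt \<equiv> quotient_norm E Bt nBt"

text \<open>Boundedness makes every kernel integral exist at every point of \<open>space E\<close>.
  Vanishing off \<open>space E\<close> makes equality of members equality on \<open>space E\<close>.
  The representative in \<open>B\<close> is unconstrained off \<open>space E\<close>.\<close>

definition V :: "('e \<Rightarrow> complex) set" where
  "V = {f. (\<exists>b. \<forall>x. cmod (f x) \<le> b) \<and> (\<exists>g\<in>B. restr E g = f)}"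

definition one :: "'e \<Rightarrow> complex" where "one = restr E (\<lambda>_. 1)"

definition P :: "real \<Rightarrow> ('e \<Rightarrow> complex) \<Rightarrow> 'e \<Rightarrow> complex" where "P t f = restr E (kop_t Q \<xi> t f)"

abbreviation mean :: "('e \<Rightarrow> complex) \<Rightarrow> complex" where "mean f \<equiv> (\<integral>x. f x \<partial>\<nu>)"
abbreviation l1 :: "('e \<Rightarrow> complex) \<Rightarrow> real" where "l1 f \<equiv> (\<integral>x. cmod (f x) \<partial>\<nu>)"

lemma V_rep: "f \<in> V \<Longrightarrow> \<exists>g\<in>B. restr E g = f" by (simp add: V_def)

lemma V_bound: assumes "f \<in> V" obtains b where "\<And>x. cmod (f x) \<le> b" "0 \<le> b"
proof -
  obtain b where b: "\<And>x. cmod (f x) \<le> b" using assms unfolding V_def by blast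
  show ?thesis using that[OF b] order_trans[OF norm_ge_zero b] by blast
qed

lemma V_meas: "f \<in> V \<Longrightarrow> f \<in> borel_measurable E"
  using V_rep[of f] restr_measurable B.B_meas by blast

lemma V_add: assumes f: "f \<in> V" and g: "g \<in> V" shows "(\<lambda>x. f x + a * g x) \<in> V"
proof -
  obtain b1 where b1: "\<And>x. cmod (f x) \<le> b1" using V_bound[OF f] by blast
  obtain b2 where b2: "\<And>x. cmod (g x) \<le> b2" using V_bound[OF g] by blast
  have "cmod (f x + a * g x) \<le> b1 + cmod a * b2" for x
    using b1[of x] mult_left_mono[OF b2[of x], of "cmod a"]
    by (intro norm_triangle_mono) (simp_all add: norm_mult)
  moreover obtain u w where "u \<in> B" "restr E u = f" "w \<in> B" "restr E w = g" using V_rep f g by metis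
  then have "(\<lambda>x. u x + a * w x) \<in> B" "restr E (\<lambda>x. u x + a * w x) = (\<lambda>x. f x + a * g x)"
    by (simp_all add: B.B_add restr_add)
  ultimately show ?thesis unfolding V_def by blast
qed

lemma V_one: "one \<in> V"
  unfolding V_def one_def using B.one_B by (auto intro!: exI[of _ 1] simp: restr_def)

lemma V_int: assumes f: "f \<in> V" shows "integrable \<nu> f"
proof -
  obtain b where b: "\<And>x. cmod (f x) \<le> b" using V_bound[OF f] by blast
  show ?thesis by (rule B.integrable_const_bound[where B=b]) (use b V_meas[OF f] in \<open>auto simp: B.meas_nu\<close>)
qed

lemma V_int_Q:
  assumes f: "f \<in> V" and x: "x \<in> space E"
  shows "integrable (Q x) f" "integrable (Q x) (\<lambda>y. iexp (t * \<xi> y) * f y)"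
proof -
  interpret Qx: prob_space "Q x" by (rule B.prob_space_Q[OF x])
  obtain b where b: "\<And>x. cmod (f x) \<le> b" using V_bound[OF f] by blast
  have [measurable]: "f \<in> borel_measurable E" by (rule V_meas[OF f])
  show "integrable (Q x) f"
    by (rule Qx.integrable_const_bound[where B=b]) (use b in \<open>auto simp: B.meas_Q[OF x]\<close>)
  show "integrable (Q x) (\<lambda>y. iexp (t * \<xi> y) * f y)"
    by (rule Qx.integrable_const_bound[where B=b])
       (use b in \<open>auto simp: B.meas_Q[OF x] norm_mult simp del: of_real_mult\<close>)
qed

text \<open>For \<open>x\<close> in \<open>space E\<close> the law \<open>Q x\<close> lives on
  \<open>space E\<close>, so values elsewhere never enter. Hence \<open>P t\<close> is well defined
  on classes, and bounds for \<open>kop_t\<close> on representatives descend to the quotient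
  norms.\<close>

lemma P_restr: "P t (restr E g) = restr E (kop_t Q \<xi> t g)"
  unfolding P_def by (auto simp: restr_def[of E "kop_t _ _ _ _"] B.kop_t_restr)

lemma P_pow_restr: "(P t ^^ n) (restr E g) = restr E ((kop_t Q \<xi> t ^^ n) g)"
  by (induction n) (simp_all add: P_restr)

lemma kop_t_pow_B: "\<bar>t\<bar> < \<delta>0 \<Longrightarrow> g \<in> B \<Longrightarrow> (kop_t Q \<xi> t ^^ n) g \<in> B"
  by (induction n) (simp_all add: kop_t_B)

lemma P_V: assumes t: "\<bar>t\<bar> < \<delta>0" and f: "f \<in> V" shows "P t f \<in> V"
proof -
  obtain b where b: "\<And>x. cmod (f x) \<le> b" "0 \<le> b" using V_bound[OF f] by blast
  have "cmod (P t f x) \<le> b" for x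
  proof (cases "x \<in> space E")
    case True
    interpret Qx: prob_space "Q x" by (rule B.prob_space_Q[OF True])
    have "cmod (kop_t Q \<xi> t f x) \<le> (\<integral>y. cmod (iexp (t * \<xi> y) * f y) \<partial>Q x)"
      unfolding kop_t_def by (rule integral_norm_bound)
    also have "\<dots> \<le> b"
      by (rule Qx.integral_le_const[OF integrable_norm[OF V_int_Q(2)[OF f True]]])
         (auto simp: norm_mult b simp del: of_real_mult)
    finally show ?thesis using True by (simp add: P_def restr_def)
  qed (simp add: P_def restr_def b)
  moreover obtain g where g: "g \<in> B" "restr E g = f" using V_rep[OF f] by blast
  then have "kop_t Q \<xi> t g \<in> B" "restr E (kop_t Q \<xi> t g) = P t f"
    using kop_t_B[OF t] P_restr[of t g] by auto
  ultimately show ?thesis unfolding V_def by blast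
qed

lemma P_add:
  assumes f: "f \<in> V" and g: "g \<in> V"
  shows "P t (\<lambda>x. f x + a * g x) = (\<lambda>x. P t f x + a * P t g x)"
proof
  fix x
  show "P t (\<lambda>x. f x + a * g x) x = P t f x + a * P t g x"
  proof (cases "x \<in> space E")
    case True
    have "kop_t Q \<xi> t (\<lambda>x. f x + a * g x) x = (\<integral>y. iexp (t * \<xi> y) * f y + a * (iexp (t * \<xi> y) * g y) \<partial>Q x)"
      unfolding kop_t_def by (intro Bochner_Integration.integral_cong) (simp_all add: algebra_simps)
    also have "\<dots> = kop_t Q \<xi> t f x + a * kop_t Q \<xi> t g x"
      unfolding kop_t_def using V_int_Q(2)[OF f True] V_int_Q(2)[OF g True]
      by (subst Bochner_Integration.integral_add) (auto intro: integrable_mult_right)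
    finally show ?thesis using True by (simp add: P_def restr_def)
  qed (simp add: P_def restr_def)
qed

lemma integral_rep:
  assumes "restr E g = f"
  shows "mean f = mean g" "l1 f = l1 g"
  using restr_eqD[OF assms] by (auto intro!: Bochner_Integration.integral_cong)

lemma P_0: "P 0 f = restr E (kop Q f)" by (simp add: P_def kop_t_0)

text \<open>Pointwise the difference is at most \<open>Q u\<close> with
  \<open>u = |exp (i t \<xi>) - 1| |f|\<close>. Invariance removes \<open>Q\<close> from the
  integral, and what is left is the quantity controlled for every representative in
  \<open>B\<close>.\<close>

lemma l1_perturb:
  assumes t: "\<bar>t\<bar> < \<delta>0" and f: "f \<in> V"
  shows "l1 (\<lambda>x. P t f x - P 0 f x) \<le> c * \<bar>t\<bar> * N f"
proof -
  define u where "u = (\<lambda>y. cmod (iexp (t * \<xi> y) - 1) * cmod (f y))"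
  obtain b where b: "\<And>x. cmod (f x) \<le> b" "0 \<le> b" using V_bound[OF f] by blast
  have [measurable]: "f \<in> borel_measurable E" by (rule V_meas[OF f])
  have um: "u \<in> borel_measurable E" unfolding u_def by measurable
  have ub: "\<bar>u y\<bar> \<le> 2 * b" for y
  proof -
    have "cmod (iexp (t * \<xi> y) - 1) \<le> 1 + 1"
      by (rule order_trans[OF norm_triangle_ineq4]) (simp del: of_real_mult)
    then show ?thesis unfolding u_def abs_mult using b by (intro mult_mono) auto
  qed
  have ui: "integrable \<nu> u" by (rule B.integrable_const_bound[where B="2 * b"]) (use um ub in \<open>auto simp: B.meas_nu\<close>)
  have le: "cmod (P t f x - P 0 f x) \<le> (\<integral>y. u y \<partial>Q x)" if x: "x \<in> space E" for x
  proof -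
    have "P t f x - P 0 f x = (\<integral>y. iexp (t * \<xi> y) * f y - f y \<partial>Q x)"
      using V_int_Q(1)[OF f x] V_int_Q(2)[OF f x, of t] x by (simp add: P_def P_0 restr_def kop_t_def kop_def)
    also have "cmod \<dots> \<le> (\<integral>y. cmod (iexp (t * \<xi> y) * f y - f y) \<partial>Q x)" by (rule integral_norm_bound)
    also have "(\<lambda>y. cmod (iexp (t * \<xi> y) * f y - f y)) = u"
    proof
      fix y
      have "iexp (t * \<xi> y) * f y - f y = (iexp (t * \<xi> y) - 1) * f y" by (simp add: algebra_simps)
      then show "cmod (iexp (t * \<xi> y) * f y - f y) = u y" by (simp only: u_def norm_mult)
    qed
    finally show ?thesis .
  qed
  have iPt: "integrable \<nu> (\<lambda>x. P t f x - P 0 f x)"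
    using V_int[OF P_V[OF t f]] V_int[OF P_V[of 0, OF _ f]] bounds by simp
  have "l1 (\<lambda>x. P t f x - P 0 f x) \<le> (\<integral>x. \<integral>y. u y \<partial>Q x \<partial>\<nu>)"
    using iPt B.integral_Q(1)[OF ui] le by (intro integral_mono) auto
  also have "\<dots> = (\<integral>x. u x \<partial>\<nu>)" by (rule B.integral_integral_Q_real[OF ui])
  finally have l: "l1 (\<lambda>x. P t f x - P 0 f x) \<le> (\<integral>x. u x \<partial>\<nu>)" .
  obtain g0 where g0: "g0 \<in> B" "restr E g0 = f" using V_rep[OF f] by blast
  have "l1 (\<lambda>x. P t f x - P 0 f x) \<le> 0 + c * \<bar>t\<bar> * N f"
  proof (rule B.qn_bound[OF g0])
    fix g assume g: "g \<in> B" "restr E g = f"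
    have "(\<integral>x. u x \<partial>\<nu>) = (\<integral>x. cmod (iexp (t * \<xi> x) - 1) * cmod (g x) \<partial>\<nu>)"
      unfolding u_def using restr_eqD[OF g(2)] by (intro Bochner_Integration.integral_cong) auto
    also have "\<dots> \<le> c * \<bar>t\<bar> * nB g" by (rule pert_L1[OF t g(1)])
    finally show "l1 (\<lambda>x. P t f x - P 0 f x) \<le> 0 + c * \<bar>t\<bar> * nB g" using l by simp
  qed (use bounds in simp)
  then show ?thesis by simp
qed

text \<open>Every representative \<open>g\<close> in \<open>B\<close> yields a representative of the
  difference in the larger space; the bound by \<open>nB g\<close> then passes to the infimum over
  \<open>g\<close>.\<close>

lemma Nt_perturb:
  assumes t: "\<bar>t\<bar> < \<delta>0" and f: "f \<in> V"
  shows "Nt (\<lambda>x. P t f x - P 0 f x) \<le> c * \<bar>t\<bar> * N f"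
proof -
  obtain g0 where g0: "g0 \<in> B" "restr E g0 = f" using V_rep[OF f] by blast
  have "Nt (\<lambda>x. P t f x - P 0 f x) \<le> 0 + c * \<bar>t\<bar> * N f"
  proof (rule B.qn_bound[OF g0])
    fix g assume g: "g \<in> B" "restr E g = f"
    have e: "(\<lambda>x. P t f x - P 0 f x) = restr E (kop_t Q \<xi> t g - kop Q g)"
      unfolding g(2)[symmetric] P_restr kop_t_0 by (auto simp: restr_def)
    have "kop_t Q \<xi> t g - kop Q g \<in> Bt"
      using B.B_diff[OF kop_t_B[OF t g(1)] B.kop_B[OF g(1)]] sub by blast
    then have "Nt (\<lambda>x. P t f x - P 0 f x) \<le> nBt (kop_t Q \<xi> t g - kop Q g)" unfolding e by (rule Bt.qn_le)
    also have "\<dots> \<le> c * \<bar>t\<bar> * nB g" by (rule pert_Bt[OF t g(1)])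
    finally show "Nt (\<lambda>x. P t f x - P 0 f x) \<le> 0 + c * \<bar>t\<bar> * nB g" by simp
  qed (use bounds in simp)
  then show ?thesis by simp
qed

lemma lasota_yorke:
  assumes t: "\<bar>t\<bar> < \<delta>0" and n: "1 \<le> n" and f: "f \<in> V"
  shows "N ((P t ^^ n) f) \<le> C * \<kappa> ^ n * N f + C * l1 f"
proof -
  obtain g0 where g0: "g0 \<in> B" "restr E g0 = f" using V_rep[OF f] by blast
  have "N ((P t ^^ n) f) \<le> C * l1 f + C * \<kappa> ^ n * N f"
  proof (rule B.qn_bound[OF g0])
    fix g assume g: "g \<in> B" "restr E g = f"
    have "N (restr E ((kop_t Q \<xi> t ^^ n) g)) \<le> nB ((kop_t Q \<xi> t ^^ n) g)"
      by (rule B.qn_le[OF kop_t_pow_B[OF t g(1)]])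
    also have "\<dots> \<le> C * \<kappa> ^ n * nB g + C * l1 g" by (rule LY[OF t n g(1)])
    finally show "N ((P t ^^ n) f) \<le> C * l1 f + C * \<kappa> ^ n * nB g"
      unfolding integral_rep(2)[OF g(2)] using P_pow_restr[where t=t and n=n and g=g] by (simp add: g(2))
  qed (use bounds in simp)
  then show ?thesis by simp
qed

lemma V_rep_t: "f \<in> V \<Longrightarrow> \<exists>g\<in>Bt. restr E g = f"
  using V_rep sub by blast

theorem family: "\<exists>C0 \<kappa>0 C1 \<kappa>1 L1 L2. perturbed_family V one N Nt mean l1 P C \<kappa> C0 \<kappa>0 C1 \<kappa>1 c L1 L2 \<delta>0"
proof -
  obtain C0 \<kappa>0 where d0: "0 \<le> C0" "0 \<le> \<kappa>0" "\<kappa>0 < 1"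
    "\<And>n f. 1 \<le> n \<Longrightarrow> f \<in> B \<Longrightarrow> mean f = 0 \<Longrightarrow> nB ((kop Q ^^ n) f) \<le> C0 * \<kappa>0 ^ n * nB f"
    using B.kop_pow_decay by blast
  obtain C1 \<kappa>1 where d1: "0 \<le> C1" "0 \<le> \<kappa>1" "\<kappa>1 < 1"
    "\<And>n f. 1 \<le> n \<Longrightarrow> f \<in> Bt \<Longrightarrow> mean f = 0 \<Longrightarrow> nBt ((kop Q ^^ n) f) \<le> C1 * \<kappa>1 ^ n * nBt f"
    using Bt.kop_pow_decay by blast
  obtain L1 where L1: "0 \<le> L1" "\<And>f. f \<in> B \<Longrightarrow> l1 f \<le> L1 * nB f" using B.B_L1 by blast
  obtain L2 where L2: "0 \<le> L2" "\<And>f. f \<in> Bt \<Longrightarrow> nBt (kop Q f) \<le> L2 * nBt f" using Bt.kop_bound by blast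
  have t0: "\<bar>0\<bar> < \<delta>0" using bounds by simp
  have "perturbed_family V one N Nt mean l1 P C \<kappa> C0 \<kappa>0 C1 \<kappa>1 c L1 L2 \<delta>0"
  proof unfold_locales
    fix f assume f: "f \<in> V"
    obtain gf where gf: "gf \<in> B" "restr E gf = f" using V_rep[OF f] by blast
    obtain gt where gt: "gt \<in> Bt" "restr E gt = f" using V_rep_t[OF f] by blast
    show "0 \<le> N f" by (rule B.qn_nonneg[OF gf])
    show "0 \<le> Nt f" by (rule Bt.qn_nonneg[OF gt])
    show "N (\<lambda>x. a * f x) \<le> cmod a * N f" for a by (rule B.qn_scale[OF gf])
    show "Nt (\<lambda>x. a * f x) \<le> cmod a * Nt f" for a by (rule Bt.qn_scale[OF gt])
    show "cmod (mean f) \<le> l1 f" by (rule integral_norm_bound)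
    have "l1 f \<le> 0 + L1 * N f"
      by (rule B.qn_bound[OF gf]) (use L1 integral_rep(2) in auto)
    then show "l1 f \<le> L1 * N f" by simp
    have fi: "integrable \<nu> f" by (rule V_int[OF f])
    have "l1 (P 0 f) = l1 (kop Q f)" unfolding P_0 by (rule integral_rep(2)[OF refl])
    then show "l1 (P 0 f) \<le> l1 f" using B.integral_kop(3)[OF fi] by simp
    have "mean (P 0 f) = mean (kop Q f)" unfolding P_0 by (rule integral_rep(1)[OF refl])
    then show "mean (P 0 f) = mean f" using B.integral_kop(2)[OF fi] by simp
    have "Nt (P 0 f) \<le> 0 + L2 * Nt f"
    proof (rule Bt.qn_bound[OF gt])
      fix g assume g: "g \<in> Bt" "restr E g = f"
      have "Nt (restr E (kop Q g)) \<le> nBt (kop Q g)" by (rule Bt.qn_le[OF Bt.kop_B[OF g(1)]])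
      then show "Nt (P 0 f) \<le> 0 + L2 * nBt g"
        unfolding g(2)[symmetric] P_restr kop_t_0 using L2(2)[OF g(1)] by simp
    qed (rule L2)
    then show "Nt (P 0 f) \<le> L2 * Nt f" by simp
    fix g a assume g: "g \<in> V"
    obtain gg where gg: "gg \<in> B" "restr E gg = g" using V_rep[OF g] by blast
    obtain ggt where ggt: "ggt \<in> Bt" "restr E ggt = g" using V_rep_t[OF g] by blast
    have gi: "integrable \<nu> g" by (rule V_int[OF g])
    show "(\<lambda>x. f x + a * g x) \<in> V" by (rule V_add[OF f g])
    show "N (\<lambda>x. f x + a * g x) \<le> N f + cmod a * N g" by (rule B.qn_add[OF gf gg])
    show "Nt (\<lambda>x. f x + a * g x) \<le> Nt f + cmod a * Nt g" by (rule Bt.qn_add[OF gt ggt])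
    show "mean (\<lambda>x. f x + a * g x) = mean f + a * mean g" using fi gi by simp
    have "l1 (\<lambda>x. f x + a * g x) \<le> (\<integral>x. cmod (f x) + cmod a * cmod (g x) \<partial>\<nu>)"
      using fi gi norm_triangle_ineq[of "f x" "a * g x" for x]
      by (intro integral_mono) (auto simp: norm_mult)
    then show "l1 (\<lambda>x. f x + a * g x) \<le> l1 f + cmod a * l1 g" using fi gi by simp
    fix t assume "\<bar>t\<bar> < \<delta>0"
    show "P t (\<lambda>x. f x + a * g x) = (\<lambda>x. P t f x + a * P t g x)" by (rule P_add[OF f g])
  next
    fix n f assume n: "(1::nat) \<le> n" and f: "f \<in> V" and m: "mean f = 0"
    obtain gf where gf: "gf \<in> B" "restr E gf = f" using V_rep[OF f] by blast
    obtain gt where gt: "gt \<in> Bt" "restr E gt = f" using V_rep_t[OF f] by blast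
    have "N ((P 0 ^^ n) f) \<le> 0 + C0 * \<kappa>0 ^ n * N f"
    proof (rule B.qn_bound[OF gf])
      fix g assume g: "g \<in> B" "restr E g = f"
      have "N (restr E ((kop Q ^^ n) g)) \<le> nB ((kop Q ^^ n) g)" by (rule B.qn_le[OF B.kop_pow_B[OF g(1)]])
      moreover have "nB ((kop Q ^^ n) g) \<le> C0 * \<kappa>0 ^ n * nB g"
        by (rule d0(4)[OF n g(1)]) (use m integral_rep(1)[OF g(2)] in simp)
      ultimately show "N ((P 0 ^^ n) f) \<le> 0 + C0 * \<kappa>0 ^ n * nB g"
        unfolding g(2)[symmetric] P_pow_restr kop_t_0 by simp
    qed (use d0 in simp)
    then show "N ((P 0 ^^ n) f) \<le> C0 * \<kappa>0 ^ n * N f" by simp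
    have "Nt ((P 0 ^^ n) f) \<le> 0 + C1 * \<kappa>1 ^ n * Nt f"
    proof (rule Bt.qn_bound[OF gt])
      fix g assume g: "g \<in> Bt" "restr E g = f"
      have "Nt (restr E ((kop Q ^^ n) g)) \<le> nBt ((kop Q ^^ n) g)" by (rule Bt.qn_le[OF Bt.kop_pow_B[OF g(1)]])
      moreover have "nBt ((kop Q ^^ n) g) \<le> C1 * \<kappa>1 ^ n * nBt g"
        by (rule d1(4)[OF n g(1)]) (use m integral_rep(1)[OF g(2)] in simp)
      ultimately show "Nt ((P 0 ^^ n) f) \<le> 0 + C1 * \<kappa>1 ^ n * nBt g"
        unfolding g(2)[symmetric] P_pow_restr kop_t_0 by simp
    qed (use d1 in simp)
    then show "Nt ((P 0 ^^ n) f) \<le> C1 * \<kappa>1 ^ n * Nt f" by simp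
  next
    fix t f assume t: "\<bar>t\<bar> < \<delta>0" and f: "f \<in> V"
    show "P t f \<in> V" by (rule P_V[OF t f])
    show "l1 (\<lambda>x. P t f x - P 0 f x) \<le> c * \<bar>t\<bar> * N f" by (rule l1_perturb[OF t f])
    show "Nt (\<lambda>x. P t f x - P 0 f x) \<le> c * \<bar>t\<bar> * N f" by (rule Nt_perturb[OF t f])
    fix n :: nat assume n: "1 \<le> n"
    show "N ((P t ^^ n) f) \<le> C * \<kappa> ^ n * N f + C * l1 f" by (rule lasota_yorke[OF t n f])
  next
    show "one \<in> V" by (rule V_one)
    have "mean one = mean (\<lambda>_. 1)" unfolding one_def by (rule integral_rep(1)[OF refl])
    then show "mean one = 1" using B.prob_space by simp
    show "P 0 one = one" unfolding one_def P_restr kop_t_0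
      using B.prob_space_Q by (auto simp: restr_def kop_def prob_space.prob_space)
  qed (use bounds d0 d1 L1 L2 in simp_all)
  then show ?thesis by blast
qed

text \<open>Integration against \<open>\<mu>0\<close> depends on values in \<open>space E\<close>
  only, so its continuity on the larger space is continuity for the quotient norm. The stationary
  estimate of the coboundary plays the part of the comparison that determines the scalar
  factor.\<close>

theorem char_estimate:
  assumes cob: "coboundary_kernel E Q \<nu> \<xi> h g s \<psi>" and s: "0 < s"
    and mu: "prob_space \<mu>0" "sets \<mu>0 = sets E"
    and mu_le: "\<And>f. f \<in> Bt \<Longrightarrow> cmod (\<integral>x. f x \<partial>\<mu>0) \<le> CU * nBt f" and CU: "0 \<le> CU"
  obtains \<delta> G a where "0 < \<delta>" "0 \<le> G" "0 < a"
    "\<And>t n. \<bar>t\<bar> \<le> \<delta> \<Longrightarrow> cmod ((\<integral>x. (kop_t Q \<xi> t ^^ n) (\<lambda>_. 1) x \<partial>\<mu>0) - complex_of_real (exp (- (real n * s * t\<^sup>2 / 2))))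
       \<le> G * (\<bar>t\<bar> + real n * \<bar>t\<bar> ^ 3) * exp (- (a * real n * t\<^sup>2))"
proof -
  obtain C0 \<kappa>0 C1 \<kappa>1 L1 L2 where fam: "perturbed_family V one N Nt mean l1 P C \<kappa> C0 \<kappa>0 C1 \<kappa>1 c L1 L2 \<delta>0"
    using family by blast
  interpret cob: coboundary_kernel E Q \<nu> \<xi> h g s \<psi> by fact
  interpret mu: prob_space \<mu>0 by fact
  have sp: "space \<mu>0 = space E" using mu(2) by (rule sets_eq_imp_space_eq)
  obtain C2 where C2: "0 \<le> C2" "\<And>t n. s * t\<^sup>2 \<le> 2 \<Longrightarrow>
    cmod ((\<integral>x. (kop_t Q \<xi> t ^^ n) (\<lambda>_. 1) x \<partial>\<nu>) - of_real (1 - s * t\<^sup>2 / 2) ^ n) \<le> C2 * (\<bar>t\<bar> + real n * \<bar>t\<bar> ^ 3)"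
    using cob.stationary_char_estimate by blast
  define \<delta>2 where "\<delta>2 = min 1 (1 / s)"
  have st: "s * t\<^sup>2 \<le> 2" if "\<bar>t\<bar> < \<delta>2" for t
  proof -
    have "s * (\<bar>t\<bar> * \<bar>t\<bar>) \<le> s * (1 / s * 1)" using that s by (intro mult_left_mono mult_mono) (auto simp: \<delta>2_def)
    then show ?thesis using s by (simp add: power2_eq_square)
  qed
  have Vmu: "integrable \<mu>0 f" if f: "f \<in> V" for f
  proof -
    obtain b where b: "\<And>x. cmod (f x) \<le> b" using V_bound[OF f] by blast
    have "f \<in> borel_measurable \<mu>0" using V_meas[OF f] mu(2) by (simp cong: measurable_cong_sets)
    then show ?thesis by (intro mu.integrable_const_bound[where B=b]) (auto simp: b)
  qed
  have rep: "(\<integral>x. restr E k x \<partial>\<mu>0) = (\<integral>x. k x \<partial>\<mu>0)" for k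
    by (rule Bochner_Integration.integral_cong) (auto simp: restr_def sp)
  show ?thesis
  proof (rule perturbed_family.gaussian_estimate[OF fam, where U="\<lambda>f. \<integral>x. f x \<partial>\<mu>0" and CU=CU and s=s and ?C2.0=C2 and ?\<delta>2.0=\<delta>2])
    show "(\<integral>x. f x + a * g x \<partial>\<mu>0) = (\<integral>x. f x \<partial>\<mu>0) + a * (\<integral>x. g x \<partial>\<mu>0)" if "f \<in> V" "g \<in> V" for f g a
      using Vmu[OF that(1)] Vmu[OF that(2)] by simp
    show "(\<integral>x. one x \<partial>\<mu>0) = 1" unfolding one_def rep using mu.prob_space by simp
    show "cmod (\<integral>x. f x \<partial>\<mu>0) \<le> CU * Nt f" if f: "f \<in> V" for f
    proof -
      obtain gt where gt: "gt \<in> Bt" "restr E gt = f" using V_rep_t[OF f] by blast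
      have "cmod (\<integral>x. f x \<partial>\<mu>0) \<le> 0 + CU * Nt f"
        by (rule Bt.qn_bound[OF gt]) (use mu_le rep CU in auto)
      then show ?thesis by simp
    qed
    show "0 < \<delta>2" using s by (simp add: \<delta>2_def)
    show "cmod (mean ((P t ^^ n) one) - complex_of_real (1 - s * t\<^sup>2 / 2) ^ n) \<le> C2 * (\<bar>t\<bar> + real n * \<bar>t\<bar> ^ 3)"
      if "\<bar>t\<bar> < \<delta>2" for t n
      unfolding one_def P_pow_restr integral_rep(1)[OF refl] by (rule C2(2)[OF st[OF that]])
    fix \<delta> G a :: real
    assume d: "0 < \<delta>" "0 \<le> G" "0 < a"
      and e: "\<And>t n. \<bar>t\<bar> \<le> \<delta> \<Longrightarrow> cmod ((\<integral>x. (P t ^^ n) one x \<partial>\<mu>0) - complex_of_real (exp (- (real n * s * t\<^sup>2 / 2))))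
       \<le> G * (\<bar>t\<bar> + real n * \<bar>t\<bar> ^ 3) * exp (- (a * real n * t\<^sup>2))"
    show thesis
      by (rule that[OF d]) (use e in \<open>simp only: one_def P_pow_restr rep\<close>)
  qed (use CU s C2 in auto)
qed

end

theorem theorem2p2:
  fixes E :: "'e measure" and Q :: "'e \<Rightarrow> 'e measure" and \<nu> \<mu>0 :: "'e measure"
    and M :: "'w measure" and X :: "nat \<Rightarrow> 'w \<Rightarrow> 'e" and \<xi> :: "'e \<Rightarrow> real"
    and B Bt :: "('e \<Rightarrow> complex) set" and nB nBt :: "('e \<Rightarrow> complex) \<Rightarrow> real"
  assumes Q_kernel: "Q \<in> E \<rightarrow>\<^sub>M prob_algebra E"
    and nu_prob: "prob_space \<nu>" and nu_sets: "sets \<nu> = sets E"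
    and nu_inv: "bind \<nu> Q = \<nu>"
    and chain: "markov_chain E Q \<mu>0 M X"
    and xi_meas: "\<xi> \<in> borel_measurable E"
    and xi_int: "integrable \<nu> \<xi>" and xi_centered: "(\<integral>x. \<xi> x \<partial>\<nu>) = 0"
    and Htilde: "hyp_H_tilde E \<nu> Q \<xi> B nB Bt nBt"
    and sigma_pos: "sigma2 \<nu> Q B nB \<xi> > 0"
    and mu0_B: "\<forall>f\<in>B. integrable \<mu>0 f"
    and mu0_B_cont: "\<exists>C. \<forall>f\<in>B. cmod (\<integral>x. f x \<partial>\<mu>0) \<le> C * nB f"
    and mu0_Bt: "\<forall>f\<in>Bt. integrable \<mu>0 f"
    and mu0_Bt_cont: "\<exists>C. \<forall>f\<in>Bt. cmod (\<integral>x. f x \<partial>\<mu>0) \<le> C * nBt f"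
  shows "\<exists>C. \<forall>\<^sub>F n in sequentially. \<forall>x::real.
           \<bar>measure M {\<omega>\<in>space M.
               (\<Sum>k=1..n. \<xi> (X k \<omega>)) / (sqrt (sigma2 \<nu> Q B nB \<xi>) * sqrt (real n)) \<le> x}
            - measure (density lborel std_normal_density) {..x}\<bar> \<le> C / sqrt (real n)"
proof -
  have H: "hyp_H E \<nu> Q \<xi> B nB" and bt: "banach_fun_space E Bt nBt" and sub: "B \<subseteq> Bt" and ergt: "geom_ergodic \<nu> Q Bt nBt"
    and Ht: "\<exists>C \<delta>. \<delta> > 0 \<and> (\<forall>t. \<bar>t\<bar> < \<delta> \<longrightarrow> (\<forall>f\<in>B. nB f \<le> 1 \<longrightarrow>
        nBt (kop_t Q \<xi> t f - kop Q f) \<le> C * \<bar>t\<bar>))"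
    using Htilde unfolding hyp_H_tilde_def by blast+
  have b: "banach_fun_space E B nB" and cube: "\<forall>f\<in>B. integrable \<nu> (\<lambda>x. cmod (f x) ^ 3)"
    and xiB: "(\<lambda>x. complex_of_real (\<xi> x)) \<in> B" and erg: "geom_ergodic \<nu> Q B nB"
    and psi_int: "\<forall>p. integrable \<nu> (\<lambda>x. cmod ((kop Q ^^ p) (psi \<nu> Q B nB \<xi>) x) powr (3/2))"
    and psi_sum: "summable (\<lambda>p. (\<integral>x. cmod ((kop Q ^^ p) (psi \<nu> Q B nB \<xi>) x) powr (3/2) \<partial>\<nu>) powr (2/3))"
    and H3: "\<exists>C \<delta>. \<delta> > 0 \<and> (\<forall>t. \<bar>t\<bar> < \<delta> \<longrightarrow> (\<forall>f\<in>B. nB f \<le> 1 \<longrightarrow>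
        (\<integral>x. cmod (exp (\<i> * complex_of_real (t * \<xi> x)) - 1) * cmod (f x) \<partial>\<nu>) \<le> C * \<bar>t\<bar>))"
    and H4: "\<exists>a b \<kappa> C. a < 0 \<and> 0 < b \<and> 0 \<le> \<kappa> \<and> \<kappa> < 1 \<and> C \<ge> 0 \<and>
        (\<forall>t\<in>{a<..<b}.
           (\<forall>f\<in>B. kop_t Q \<xi> t f \<in> B) \<and>
           (\<exists>D. \<forall>f\<in>B. nB (kop_t Q \<xi> t f) \<le> D * nB f) \<and>
           (\<forall>n\<ge>1. \<forall>f\<in>B. nB ((kop_t Q \<xi> t ^^ n) f)
                  \<le> C * \<kappa> ^ n * nB f + C * (\<integral>x. cmod (f x) \<partial>\<nu>)) \<and>
           ess_spectral_radius B nB (kop_t Q \<xi> t) \<le> \<kappa>)"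
    using H unfolding hyp_H_def by simp_all
  obtain C3 \<delta>3 where \<delta>3: "0 < \<delta>3" and C3: "\<And>t f. \<bar>t\<bar> < \<delta>3 \<Longrightarrow> f \<in> B \<Longrightarrow> nB f \<le> 1 \<Longrightarrow>
        (\<integral>x. cmod (iexp (t * \<xi> x) - 1) * cmod (f x) \<partial>\<nu>) \<le> C3 * \<bar>t\<bar>"
    using H3 by blast
  obtain Ct \<delta>t where \<delta>t: "0 < \<delta>t" and Ct: "\<And>t f. \<bar>t\<bar> < \<delta>t \<Longrightarrow> f \<in> B \<Longrightarrow> nB f \<le> 1 \<Longrightarrow>
        nBt (kop_t Q \<xi> t f - kop Q f) \<le> Ct * \<bar>t\<bar>"
    using Ht by blast
  obtain a4 b4 \<kappa> C4 where ab: "a4 < 0" "0 < b4" and \<kappa>: "0 \<le> \<kappa>" "\<kappa> < 1" and C4: "0 \<le> C4"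
    and kB: "\<And>t f. t \<in> {a4<..<b4} \<Longrightarrow> f \<in> B \<Longrightarrow> kop_t Q \<xi> t f \<in> B"
    and LY: "\<And>t n f. t \<in> {a4<..<b4} \<Longrightarrow> 1 \<le> n \<Longrightarrow> f \<in> B \<Longrightarrow>
       nB ((kop_t Q \<xi> t ^^ n) f) \<le> C4 * \<kappa> ^ n * nB f + C4 * (\<integral>x. cmod (f x) \<partial>\<nu>)"
    using H4 by metis
  interpret bB: banach_functions E B nB by unfold_locales (rule b)
  interpret bBt: banach_functions E Bt nBt by unfold_locales (rule bt)
  \<comment> \<open>The constants hidden in O(|t|) may be negative, hence the absolute
    values.\<close>
  define c where "c = max \<bar>C3\<bar> \<bar>Ct\<bar>"
  define \<delta>0 where "\<delta>0 = min (min \<delta>3 \<delta>t) (min (- a4) b4)"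
  have \<delta>0: "0 < \<delta>0" using \<delta>3 \<delta>t ab by (simp add: \<delta>0_def)
  have t4: "t \<in> {a4<..<b4}" if "\<bar>t\<bar> < \<delta>0" for t using that by (auto simp: \<delta>0_def)
  have "0 \<in> {a4<..<b4}" using ab by simp
  from kB[OF this] have kop_B: "f \<in> B \<Longrightarrow> kop Q f \<in> B" for f by (simp add: kop_t_0)
  \<comment> \<open>Homogeneity holds for every function, integrable or not, since scaling respects
    the convention that an undefined integral is 0. It is all that passing from the unit ball to
    arbitrary norms takes.\<close>
  have kop_t_scale: "kop_t Q \<xi> t (\<lambda>x. a * f x) = (\<lambda>x. a * kop_t Q \<xi> t f x)" for t a f
    by (simp add: kop_t_def[abs_def] mult.left_commute)
  have c_le: "C3 * \<bar>t\<bar> \<le> c * \<bar>t\<bar>" "Ct * \<bar>t\<bar> \<le> c * \<bar>t\<bar>" for t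
    by (intro mult_right_mono; simp add: c_def)+
  have p1: "(\<integral>x. cmod (iexp (t * \<xi> x) - 1) * cmod (f x) \<partial>\<nu>) \<le> c * \<bar>t\<bar> * nB f"
    if t: "\<bar>t\<bar> < \<delta>0" and f: "f \<in> B" for t f
  proof (rule bB.unit_ball_bound[OF _ _ f])
    fix a :: complex and f assume "f \<in> B"
    have "(\<integral>x. cmod (iexp (t * \<xi> x) - 1) * cmod (a * f x) \<partial>\<nu>) = (\<integral>x. cmod a * (cmod (iexp (t * \<xi> x) - 1) * cmod (f x)) \<partial>\<nu>)"
      by (intro Bochner_Integration.integral_cong) (simp_all add: norm_mult)
    then show "(\<integral>x. cmod (iexp (t * \<xi> x) - 1) * cmod (a * f x) \<partial>\<nu>) = cmod a * (\<integral>x. cmod (iexp (t * \<xi> x) - 1) * cmod (f x) \<partial>\<nu>)"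
      by simp
  next
    fix f assume "f \<in> B" "nB f \<le> 1"
    then show "(\<integral>x. cmod (iexp (t * \<xi> x) - 1) * cmod (f x) \<partial>\<nu>) \<le> c * \<bar>t\<bar>"
      using C3[of t f] c_le(1)[of t] t by (auto simp: \<delta>0_def)
  qed
  have p2: "nBt (kop_t Q \<xi> t f - kop Q f) \<le> c * \<bar>t\<bar> * nB f" if t: "\<bar>t\<bar> < \<delta>0" and f: "f \<in> B" for t f
  proof (rule bB.unit_ball_bound[OF _ _ f])
    fix a :: complex and f assume f: "f \<in> B"
    have e: "kop_t Q \<xi> t (\<lambda>x. a * f x) - kop Q (\<lambda>x. a * f x) = (\<lambda>x. a * (kop_t Q \<xi> t f - kop Q f) x)"
      unfolding kop_t_scale kop_t_0[of Q \<xi>, symmetric] by (simp add: fun_eq_iff right_diff_distrib)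
    have "kop_t Q \<xi> t f - kop Q f \<in> Bt" using bB.B_diff[OF kB[OF t4[OF t] f] kop_B[OF f]] sub by blast
    then show "nBt (kop_t Q \<xi> t (\<lambda>x. a * f x) - kop Q (\<lambda>x. a * f x)) = cmod a * nBt (kop_t Q \<xi> t f - kop Q f)"
      unfolding e by (rule bBt.nB_scale)
  next
    fix f assume "f \<in> B" "nB f \<le> 1"
    then have "nBt (kop_t Q \<xi> t f - kop Q f) \<le> Ct * \<bar>t\<bar>" using Ct[of t f] t by (simp add: \<delta>0_def)
    then show "nBt (kop_t Q \<xi> t f - kop Q f) \<le> c * \<bar>t\<bar>" using c_le(2)[of t] by (rule order_trans)
  qed
  interpret sk: stationary_kernel E Q \<nu>
    by (intro stationary_kernel.intro markov_kernel.intro stationary_kernel_axioms.intro; fact)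
  interpret eB: ergodic_functions E Q \<nu> B nB by unfold_locales (rule erg)
  interpret eBt: ergodic_functions E Q \<nu> Bt nBt by unfold_locales (rule ergt)
  interpret nag: nagaev_setting E Q \<nu> B nB \<xi> Bt nBt C4 \<kappa> c \<delta>0
  proof unfold_locales
    show "\<And>t n f. \<bar>t\<bar> < \<delta>0 \<Longrightarrow> 1 \<le> n \<Longrightarrow> f \<in> B \<Longrightarrow>
        nB ((kop_t Q \<xi> t ^^ n) f) \<le> C4 * \<kappa> ^ n * nB f + C4 * (\<integral>x. cmod (f x) \<partial>\<nu>)"
      by (rule LY[OF t4])
    show "\<And>t f. \<bar>t\<bar> < \<delta>0 \<Longrightarrow> f \<in> B \<Longrightarrow> kop_t Q \<xi> t f \<in> B" by (rule kB[OF t4])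
    show "0 \<le> c" by (simp add: c_def)
  qed (fact xiB xi_centered xi_meas sub p1 p2 C4 \<kappa> \<delta>0)+
  define s where "s = sigma2 \<nu> Q B nB \<xi>"
  have s: "0 < s" using sigma_pos by (simp add: s_def)
  obtain h g where cob: "coboundary_kernel E Q \<nu> \<xi> h g s (psi \<nu> Q B nB \<xi>)"
    using nag.B.coboundary[OF _ _ psi_sum xi_meas] cube psi_int sigma_pos unfolding s_def by force
  have mu: "prob_space \<mu>0" "sets \<mu>0 = sets E" using chain unfolding markov_chain_def by blast+
  obtain CU where CU: "\<forall>f\<in>Bt. cmod (\<integral>x. f x \<partial>\<mu>0) \<le> CU * nBt f" using mu0_Bt_cont by blast
  \<comment> \<open>A nonnegative constant is needed, and nonnegativity of the norm allows the
    change.\<close>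
  have CU': "cmod (\<integral>x. f x \<partial>\<mu>0) \<le> \<bar>CU\<bar> * nBt f" if "f \<in> Bt" for f
    using CU that mult_right_mono[OF abs_ge_self bBt.nB_nonneg[OF that], of CU] by force
  interpret ch: kernel_chain E Q \<mu>0 M X by unfold_locales (rule chain)
  obtain \<delta> G a where d: "0 < \<delta>" "0 \<le> G" "0 < a"
    and est: "\<And>t n. \<bar>t\<bar> \<le> \<delta> \<Longrightarrow> cmod ((\<integral>x. (kop_t Q \<xi> t ^^ n) (\<lambda>_. 1) x \<partial>\<mu>0) - complex_of_real (exp (- (real n * s * t\<^sup>2 / 2))))
       \<le> G * (\<bar>t\<bar> + real n * \<bar>t\<bar> ^ 3) * exp (- (a * real n * t\<^sup>2))"
    using nag.char_estimate[OF cob s mu CU' abs_ge_zero] by metis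
  have "\<exists>C. \<forall>n\<ge>1. \<forall>x. \<bar>measure M {\<omega>\<in>space M. (\<Sum>k=1..n. \<xi> (X k \<omega>)) / (sqrt s * sqrt (real n)) \<le> x}
            - measure std_normal_distribution {..x}\<bar> \<le> C / sqrt (real n)"
  proof (rule berry_esseen_of_char_estimate[OF ch.prob_M _ s d])
    show "(\<lambda>\<omega>. \<Sum>k=1..n. \<xi> (X k \<omega>)) \<in> borel_measurable M" for n
      by (intro borel_measurable_sum measurable_compose[OF ch.X_meas xi_meas])
    show "cmod ((\<integral>\<omega>. iexp (t * (\<Sum>k=1..n. \<xi> (X k \<omega>))) \<partial>M) - complex_of_real (exp (- (real n * s * t\<^sup>2 / 2))))
       \<le> G * (\<bar>t\<bar> + real n * \<bar>t\<bar> ^ 3) * exp (- (a * real n * t\<^sup>2))" if "\<bar>t\<bar> \<le> \<delta>" for t n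
      unfolding ch.char_partial_sums[OF xi_meas] by (rule est[OF that])
  qed
  then show ?thesis unfolding s_def eventually_sequentially by blast
qed

end
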